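(* Let $G$ be a locally compact non-compact group and let $m \in L_\infty(G)^* = L_1(G)^{**}$. Suppose that $m \odot n = m . n$ for every $n \in L_\infty(G)^*$ that is a Hahn-Banach extension of some functional in $\overline{\delta_G}^{w^*} \subseteq \mathrm{Ball}(\mathrm{LUC}(G)^* )$. Then $m \in L_1(G)$.
   Context: $L_1(G)$ is the group algebra (with respect to a left Haar measure) with convolution $*$, $L_\infty(G) = L_1(G)^*$, and $L_1(G)$ is regarded as a subspace of $L_1(G)^{**} = L_\infty(G)^*$ via the canonical embedding. The first (left) Arens product $\odot$ and second (right) Arens product $.$ on $L_1(G)^{**}$ are defined as follows, for $m,n \in L_1(G)^{**}$, $h \in L_\infty(G)$, $f,g \in L_1(G)$: $\langle h \odot f, g\rangle = \langle h, f*g\rangle$, $\langle n \odot h, f\rangle = \langle n, h \odot f\rangle$, $\langle m \odot n, h\rangle = \langle m, n \odot h\rangle$; and $\langle f . h, g\rangle = \langle h, g*f\rangle$, $\langle h . m, f\rangle = \langle m, f . h\rangle$, $\langle m . n, h\rangle = \langle n, h . m\rangle$. $\mathrm{LUC}(G) \subseteq L_\infty(G)$ is the Banach space (sup norm) of complex-valued bounded left uniformly continuous functions on $G$, i.e. bounded continuous $f$ such that $x \mapsto l_x f$ is norm continuous, where $(l_x f)(y) = f(xy)$. For $x \in G$, $\delta_x \in \mathrm{LUC}(G)^*$ is evaluation at $x$; $\delta_G = \{\delta_x : x \in G\}$, and $\overline{\delta_G}^{w^*}$ is its closure in $\mathrm{LUC}(G)^*$ in the weak$^*$ topology $\sigma(\mathrm{LUC}(G)^*,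 \mathrm{LUC}(G))$. $\mathrm{Ball}$ denotes the closed unit ball. A Hahn-Banach extension of a functional $\psi \in \mathrm{LUC}(G)^*$ is a norm-preserving linear extension of $\psi$ to an element of $L_\infty(G)^*$. *)

theory Defs
  imports "HOL-Analysis.Analysis"
begin

text \<open>
  Groups are types of the library class \<^class>\<open>topological_group_add\<close>. This class does not
  assume commutativity; only the notation is additive, so \<open>x + y\<close>, \<open>0\<close>, \<open>- x\<close> stand for
  \<open>xy\<close>, \<open>e\<close>, \<open>x\<inverse>\<close>.
\<close>

definition left_haar_measure :: "'g::{topological_group_add, t2_space} measure \<Rightarrow> bool" where
  "left_haar_measure \<mu> \<longleftrightarrow>
     sets \<mu> = sets borel \<and>
     (\<forall>K. compact K \<longrightarrow> emeasure \<mu> K < \<infinity>) \<and>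
     (\<forall>A\<in>sets borel. emeasure \<mu> A = (INF U\<in>{U. open U \<and> A \<subseteq> U}. emeasure \<mu> U)) \<and>
     (\<forall>U. open U \<longrightarrow> emeasure \<mu> U = (SUP K\<in>{K. compact K \<and> K \<subseteq> U}. emeasure \<mu> K)) \<and>
     emeasure \<mu> UNIV \<noteq> 0 \<and>
     (\<forall>x. \<forall>A\<in>sets borel. emeasure \<mu> ((\<lambda>y. x + y) ` A) = emeasure \<mu> A)"

text \<open>
  A complex (semi)normed space is given by a carrier \<open>V\<close> of complex-valued functions, closed
  under the pointwise operations, and a seminorm \<open>p\<close> on it. Elements of its dual are total
  functions that vanish outside \<open>V\<close>, so that they are determined by their values on \<open>V\<close> and
  again form such a carrier under the pointwise operations. The dual of a seminormed space is
  the dual of its quotient by the null vectors.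
\<close>

definition cdual :: "('x \<Rightarrow> complex) set \<Rightarrow> (('x \<Rightarrow> complex) \<Rightarrow> real) \<Rightarrow> (('x \<Rightarrow> complex) \<Rightarrow> complex) set"
  where
  "cdual V p = {\<phi>.
     (\<forall>u\<in>V. \<forall>v\<in>V. \<phi> (\<lambda>x. u x + v x) = \<phi> u + \<phi> v) \<and>
     (\<forall>c. \<forall>u\<in>V. \<phi> (\<lambda>x. c * u x) = c * \<phi> u) \<and>
     (\<exists>C. \<forall>u\<in>V. cmod (\<phi> u) \<le> C * p u) \<and>
     (\<forall>u. u \<notin> V \<longrightarrow> \<phi> u = 0)}"

definition dual_norm :: "('x \<Rightarrow> complex) set \<Rightarrow> (('x \<Rightarrow> complex) \<Rightarrow> real) \<Rightarrow> (('x \<Rightarrow> complex) \<Rightarrow> complex) \<Rightarrow> real"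
  where
  "dual_norm V p \<phi> = (SUP u\<in>{u\<in>V. p u \<le> 1}. cmod (\<phi> u))"

definition weak_star :: "('x \<Rightarrow> complex) set \<Rightarrow> (('x \<Rightarrow> complex) \<Rightarrow> real) \<Rightarrow> (('x \<Rightarrow> complex) \<Rightarrow> complex) topology"
  where
  "weak_star V p =
     topology_generated_by {{\<phi>\<in>cdual V p. \<phi> u \<in> W} |u W. u \<in> V \<and> open W}"

text \<open>
  \<open>L1\<close> consists of functions rather than classes of functions; functions that agree almost
  everywhere have \<open>norm1\<close>-distance 0 and are identified by every element of the dual.
\<close>

definition L1 :: "'g measure \<Rightarrow> ('g \<Rightarrow> complex) set" where
  "L1 \<mu> = {f. integrable \<mu> f}"

definition norm1 :: "'g measure \<Rightarrow> ('g \<Rightarrow> complex) \<Rightarrow> real" where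
  "norm1 \<mu> f = (\<integral>x. cmod (f x) \<partial>\<mu>)"

definition Linf :: "'g measure \<Rightarrow> (('g \<Rightarrow> complex) \<Rightarrow> complex) set" where
  "Linf \<mu> = cdual (L1 \<mu>) (norm1 \<mu>)"

definition norm_inf :: "'g measure \<Rightarrow> (('g \<Rightarrow> complex) \<Rightarrow> complex) \<Rightarrow> real" where
  "norm_inf \<mu> = dual_norm (L1 \<mu>) (norm1 \<mu>)"

definition Linf_dual :: "'g measure \<Rightarrow> ((('g \<Rightarrow> complex) \<Rightarrow> complex) \<Rightarrow> complex) set" where
  "Linf_dual \<mu> = cdual (Linf \<mu>) (norm_inf \<mu>)"

definition canonical_embedding ::
    "'g measure \<Rightarrow> ('g \<Rightarrow> complex) \<Rightarrow> (('g \<Rightarrow> complex) \<Rightarrow> complex) \<Rightarrow> complex" where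
  "canonical_embedding \<mu> f = (\<lambda>h. if h \<in> Linf \<mu> then h f else 0)"

definition convolution ::
    "'g::group_add measure \<Rightarrow> ('g \<Rightarrow> complex) \<Rightarrow> ('g \<Rightarrow> complex) \<Rightarrow> 'g \<Rightarrow> complex" where
  "convolution \<mu> f g = (\<lambda>x. \<integral>y. f y * g (- y + x) \<partial>\<mu>)"

definition arens1_hf :: "'g::group_add measure \<Rightarrow> (('g \<Rightarrow> complex) \<Rightarrow> complex) \<Rightarrow> ('g \<Rightarrow> complex)
    \<Rightarrow> (('g \<Rightarrow> complex) \<Rightarrow> complex)" where
  "arens1_hf \<mu> h f = (\<lambda>g. if g \<in> L1 \<mu> then h (convolution \<mu> f g) else 0)"

definition arens1_nh :: "'g::group_add measure \<Rightarrow> ((('g \<Rightarrow> complex) \<Rightarrow> complex) \<Rightarrow> complex)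
    \<Rightarrow> (('g \<Rightarrow> complex) \<Rightarrow> complex) \<Rightarrow> (('g \<Rightarrow> complex) \<Rightarrow> complex)" where
  "arens1_nh \<mu> n h = (\<lambda>f. if f \<in> L1 \<mu> then n (arens1_hf \<mu> h f) else 0)"

definition arens1 :: "'g::group_add measure \<Rightarrow> ((('g \<Rightarrow> complex) \<Rightarrow> complex) \<Rightarrow> complex)
    \<Rightarrow> ((('g \<Rightarrow> complex) \<Rightarrow> complex) \<Rightarrow> complex) \<Rightarrow> ((('g \<Rightarrow> complex) \<Rightarrow> complex) \<Rightarrow> complex)" where
  "arens1 \<mu> m n = (\<lambda>h. if h \<in> Linf \<mu> then m (arens1_nh \<mu> n h) else 0)"

definition arens2_fh :: "'g::group_add measure \<Rightarrow> ('g \<Rightarrow> complex) \<Rightarrow> (('g \<Rightarrow> complex) \<Rightarrow> complex)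
    \<Rightarrow> (('g \<Rightarrow> complex) \<Rightarrow> complex)" where
  "arens2_fh \<mu> f h = (\<lambda>g. if g \<in> L1 \<mu> then h (convolution \<mu> g f) else 0)"

definition arens2_hm :: "'g::group_add measure \<Rightarrow> (('g \<Rightarrow> complex) \<Rightarrow> complex)
    \<Rightarrow> ((('g \<Rightarrow> complex) \<Rightarrow> complex) \<Rightarrow> complex) \<Rightarrow> (('g \<Rightarrow> complex) \<Rightarrow> complex)" where
  "arens2_hm \<mu> h m = (\<lambda>f. if f \<in> L1 \<mu> then m (arens2_fh \<mu> f h) else 0)"

definition arens2 :: "'g::group_add measure \<Rightarrow> ((('g \<Rightarrow> complex) \<Rightarrow> complex) \<Rightarrow> complex)
    \<Rightarrow> ((('g \<Rightarrow> complex) \<Rightarrow> complex) \<Rightarrow> complex) \<Rightarrow> ((('g \<Rightarrow> complex) \<Rightarrow> complex) \<Rightarrow> complex)" where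
  "arens2 \<mu> m n = (\<lambda>h. if h \<in> Linf \<mu> then n (arens2_hm \<mu> h m) else 0)"

text \<open>
  \<^const>\<open>bcontfun\<close> is the set of bounded continuous functions; the norm and topology used below
  are those of the sup norm on the associated library type.
\<close>

definition LUC :: "('g::topological_group_add \<Rightarrow> complex) set" where
  "LUC = {f\<in>bcontfun. continuous_on UNIV (\<lambda>x. Bcontfun (\<lambda>y. f (x + y)))}"

definition sup_norm :: "('g::topological_space \<Rightarrow> complex) \<Rightarrow> real" where
  "sup_norm f = norm (Bcontfun f)"

definition LUC_embedding :: "'g measure \<Rightarrow> ('g \<Rightarrow> complex) \<Rightarrow> ('g \<Rightarrow> complex) \<Rightarrow> complex" where
  "LUC_embedding \<mu> h = (\<lambda>f. if f \<in> L1 \<mu> then (\<integral>x. h x * f x \<partial>\<mu>) else 0)"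

definition point_evaluation :: "'g::topological_group_add \<Rightarrow> ('g \<Rightarrow> complex) \<Rightarrow> complex" where
  "point_evaluation x = (\<lambda>h. if h \<in> LUC then h x else 0)"

definition hahn_banach_extension :: "'g::topological_group_add measure
    \<Rightarrow> (('g \<Rightarrow> complex) \<Rightarrow> complex) \<Rightarrow> ((('g \<Rightarrow> complex) \<Rightarrow> complex) \<Rightarrow> complex) \<Rightarrow> bool" where
  "hahn_banach_extension \<mu> \<psi> n \<longleftrightarrow>
     n \<in> Linf_dual \<mu> \<and>
     (\<forall>h\<in>LUC. n (LUC_embedding \<mu> h) = \<psi> h) \<and>
     dual_norm (Linf \<mu>) (norm_inf \<mu>) n = dual_norm LUC sup_norm \<psi>"

end

theory Submission
  imports Defs
begin

text \<open>
  Since the points of \<open>\<delta>\<^sub>G\<close> are limits of normalised indicators of small sets, a Hahn-Banach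
  extension \<open>n\<close> of a limit \<open>\<psi>\<close> of points \<open>\<delta>\<^sub>x\<close> acts on \<open>h\<close> as a limit of right translations
  of \<open>h\<close>. Let \<open>\<kappa>\<close> be the least number of compact sets whose interiors cover \<open>G\<close>. Given at most
  \<open>\<kappa>\<close> functionals \<open>h\<^sub>k\<close> in the unit ball of \<open>L\<^sub>\<infinity>(G)\<close>, one can place translates of \<open>h\<^sub>k\<close>
  restricted to \<open>C\<close>, where \<open>C\<close> runs through a cofinal family of \<open>\<kappa>\<close> compact sets, on pairwise
  disjoint sets. Their sum \<open>T\<close> satisfies \<open>n\<^sub>k \<odot> T = h\<^sub>k\<close> for suitable extensions \<open>n\<^sub>k\<close>, so the
  hypothesis on \<open>m\<close> gives \<open>\<langle>m, h\<^sub>k\<rangle> = \<langle>n\<^sub>k, T . m\<rangle>\<close>. If \<open>h\<^sub>k \<rightarrow> 0\<close> in the weak* topology, every cluster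
  point \<open>n\<close> of the \<open>n\<^sub>k\<close> is again such an extension and \<open>n \<odot> T = 0\<close>; hence
  \<open>\<langle>n, T . m\<rangle> = \<langle>m, 0\<rangle> = 0\<close> and \<open>\<langle>m, h\<^sub>k\<rangle> \<rightarrow> 0\<close>.

  For sequences this makes \<open>m\<close> countably additive, so it is given by a density on every compact
  set by the Radon-Nikodym theorem. For the net of restrictions of \<open>h\<close> to complements of compact
  sets it shows that these densities determine \<open>m\<close>, and they converge in \<open>L\<^sub>1(G)\<close>.
\<close>

section \<open>Iterated integrals for Radon measures\<close>

text \<open>A single \<open>T\<close> has to serve all indices: then every value of \<open>m\<close>
  at some \<open>h k\<close> is a value of \<open>N k\<close> at the same argument
  \<open>arens2_hm \<mu> T m\<close>, and a cluster point of the \<open>N k\<close>, taken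
  pointwise, sees the limit of these numbers. Building a common \<open>T\<close> is a matter of room
  in \<open>G\<close>, and this fixes the cardinal \<open>\<kappa>\<close>. Fewer than
  \<open>\<kappa>\<close> compact sets never cover \<open>G\<close>, so a transfinite recursion of
  length at most \<open>\<kappa>\<close> always finds a place for the next translate; on the other
  side \<open>\<kappa>\<close> compact sets suffice for a cofinal family, so the net of all
  restrictions to them is within reach. Sequences control \<open>m\<close> on sets of finite
  measure; as \<open>G\<close> need not be sigma-compact, the passage to all of \<open>G\<close>
  takes the net. For the same reason elements of \<open>Linf \<mu>\<close> are kept as functionals
  and become bounded functions only over sets of finite measure.\<close>

text \<open>
  The measure need not be sigma-finite and the Borel sets of \<open>G \<times> G\<close> need not be generated by Borel
  rectangles, so the library's Fubini theorems do not apply. The substitute rests on the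
  additivity of a Radon measure along upward directed families of open sets, which reduces
  open subsets of the product to finite unions of rectangles.
\<close>

lemma tendsto_layer_sum:
  fixes t :: ennreal
  shows "(\<lambda>n. \<Sum>k\<in>{1..n*n}. if ennreal (real k / real n) < t then ennreal (1 / real n) else 0) \<longlonglongrightarrow> t"
    (is "?d \<longlonglongrightarrow> t")
    and "(\<Sum>k\<in>{1..n*n}. if ennreal (real k / real n) < t then ennreal (1 / real n) else 0) \<le> t"
proof -
  \<comment> \<open>The \<open>n * n\<close> levels of step \<open>1 / n\<close> reach height
    \<open>n\<close>, so the sum rounds \<open>t\<close> down to the grid and truncates at
    \<open>n\<close>. It stays below \<open>t\<close>, differs from a finite \<open>t\<close> by at
    most \<open>1 / n\<close> as soon as \<open>n \<ge> t\<close>, and equals \<open>n\<close> for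
    infinite \<open>t\<close>.\<close>
  have eq: "?d n = ennreal (real (card {k\<in>{1..n*n}. ennreal (real k / real n) < t}) / real n)" for n
  proof -
    have "?d n = (\<Sum>k\<in>{k\<in>{1..n*n}. ennreal (real k / real n) < t}. ennreal (1 / real n))"
      by (intro sum.mono_neutral_cong_right) auto
    also have "\<dots> = ennreal (\<Sum>k\<in>{k\<in>{1..n*n}. ennreal (real k / real n) < t}. 1 / real n)"
      by (subst sum_ennreal) auto
    finally show ?thesis by simp
  qed
  have up: "real (card {k\<in>{1..n*n}. ennreal (real k / real n) < ennreal r}) / real n \<le> r"
    if "r \<ge> 0" for n r
  proof (cases "n = 0 \<or> {k\<in>{1..n*n}. ennreal (real k / real n) < ennreal r} = {}")
    case True
    then show ?thesis
    proof
      assume "{k\<in>{1..n*n}. ennreal (real k / real n) < ennreal r} = {}"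
      then show ?thesis using that by (simp only: card.empty)
    qed (use that in simp)
  next
    case False
    define S where "S = {k\<in>{1..n*n}. ennreal (real k / real n) < ennreal r}"
    have "finite S" "S \<noteq> {}" using False by (auto simp: S_def)
    then have "Max S \<in> S" by simp
    have "S \<subseteq> {1..Max S}" using \<open>finite S\<close> by (auto simp: S_def)
    then have "card S \<le> Max S" using card_mono[of "{1..Max S}" S] by simp
    moreover have "real (Max S) / real n < r"
      using \<open>Max S \<in> S\<close> by (auto simp: S_def ennreal_less_iff)
    ultimately show ?thesis unfolding S_def[symmetric]
      by (smt (verit) divide_right_mono of_nat_0_le_iff of_nat_mono)
  qed
  have low: "r - 1 / real n \<le> real (card {k\<in>{1..n*n}. ennreal (real k / real n) < ennreal r}) / real n"
    if "r \<ge> 0" "n > 0" "r \<le> real n" for n r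
  proof -
    have "{1..<nat \<lceil>r * n\<rceil>} \<subseteq> {k\<in>{1..n*n}. ennreal (real k / real n) < ennreal r}"
    proof
      fix k assume "k \<in> {1..<nat \<lceil>r * n\<rceil>}"
      then have "1 \<le> k" "k < nat \<lceil>r * n\<rceil>" by auto
      then have k: "1 \<le> k" "real k < r * n" by linarith+
      have "r * n \<le> real n * real n" using that by (intro mult_right_mono) auto
      then have "real k \<le> real (n * n)" using k by simp
      then have "k \<le> n * n" by linarith
      moreover have "real k / n < r" using k that by (simp add: field_simps)
      ultimately show "k \<in> {k\<in>{1..n*n}. ennreal (real k / real n) < ennreal r}"
        using k by (simp add: ennreal_less_iff)
    qed
    moreover have "finite {k\<in>{1..n*n}. ennreal (real k / real n) < ennreal r}"
      by (rule finite_Collect_conjI) simp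
    ultimately have "card {1..<nat \<lceil>r * n\<rceil>} \<le> card {k\<in>{1..n*n}. ennreal (real k / real n) < ennreal r}"
      by (intro card_mono)
    then have "nat \<lceil>r * n\<rceil> - 1 \<le> card {k\<in>{1..n*n}. ennreal (real k / real n) < ennreal r}"
      by (simp only: card_atLeastLessThan)
    then have "r * n - 1 \<le> real (card {k\<in>{1..n*n}. ennreal (real k / real n) < ennreal r})"
      by linarith
    then have "(r * n - 1) / n \<le> real (card {k\<in>{1..n*n}. ennreal (real k / real n) < ennreal r}) / n"
      by (rule divide_right_mono) simp
    moreover have "(r * n - 1) / n = r - 1 / n" using that by (simp add: field_simps)
    ultimately show ?thesis by metis
  qed
  show "?d n \<le> t"
  proof (cases t)
    case (real r)
    show ?thesis unfolding eq unfolding real by (intro ennreal_leI up real(1))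
  qed simp
  show "?d \<longlonglongrightarrow> t"
  proof (cases t)
    case (real r)
    have "(\<lambda>n. real (card {k\<in>{1..n*n}. ennreal (real k / real n) < ennreal r}) / real n) \<longlonglongrightarrow> r"
    proof (rule tendsto_sandwich)
      show "\<forall>\<^sub>F n in sequentially. r - 1 / real n \<le> real (card {k\<in>{1..n*n}. ennreal (real k / real n) < ennreal r}) / real n"
        using eventually_ge_at_top[of "nat \<lceil>r\<rceil> + 1"] 
      proof eventually_elim
        case (elim n)
        then have "n > 0" "r \<le> real n" by linarith+
        then show ?case using low real by blast
      qed
      show "(\<lambda>n. r - 1 / real n) \<longlonglongrightarrow> r"
        using tendsto_diff[OF tendsto_const lim_1_over_n, of r] by simp
    qed (use up real in auto)
    then show ?thesis unfolding eq unfolding real by (rule tendsto_ennrealI)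
  next
    case top
    have "?d = of_nat"
    proof
      fix n
      have "{k\<in>{1..n*n}. ennreal (real k / real n) < top} = {1..n*n}" by auto
      then have "?d n = ennreal (real (n * n) / real n)" unfolding eq unfolding top by simp
      then show "?d n = of_nat n" by (simp add: ennreal_of_nat_eq_real_of_nat)
    qed
    then show ?thesis unfolding top using of_nat_tendsto_top_ennreal by metis
  qed
qed

lemma SUP_sum_directed_ennreal:
  fixes f :: "'k \<Rightarrow> 'i \<Rightarrow> ennreal"
  assumes "finite S" "I \<noteq> {}"
    and dir: "\<And>i j. i \<in> I \<Longrightarrow> j \<in> I \<Longrightarrow> \<exists>k\<in>I. \<forall>s\<in>S. f s i \<le> f s k \<and> f s j \<le> f s k"
  shows "(SUP i\<in>I. \<Sum>s\<in>S. f s i) = (\<Sum>s\<in>S. SUP i\<in>I. f s i)"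
  using assms(1) dir
proof (induction S)
  case (insert a S)
  have "(SUP i\<in>I. f a i + (\<Sum>s\<in>S. f s i)) = (SUP i\<in>I. f a i) + (SUP i\<in>I. \<Sum>s\<in>S. f s i)"
  proof (rule SUP_add_directed_ennreal)
    fix i j assume "i \<in> I" "j \<in> I"
    then obtain k where "k \<in> I" "\<forall>s\<in>insert a S. f s i \<le> f s k \<and> f s j \<le> f s k"
      using insert.prems by blast
    then show "\<exists>k\<in>I. f a i + (\<Sum>s\<in>S. f s j) \<le> f a k + (\<Sum>s\<in>S. f s k)"
      by (intro bexI[of _ k] add_mono sum_mono) auto
  qed
  moreover have "(SUP i\<in>I. \<Sum>s\<in>S. f s i) = (\<Sum>s\<in>S. SUP i\<in>I. f s i)"
    using insert.prems by (intro insert.IH) (metis insertCI)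
  ultimately show ?case using insert.hyps by simp
qed (use assms(2) in simp)

text \<open>Local finiteness is a separate assumption: the space is only Hausdorff here, so
  finiteness on compact sets yields no neighbourhoods of finite measure.\<close>

locale radon =
  fixes \<mu> :: "'a::t2_space measure"
  assumes sets_eq [measurable_cong]: "sets \<mu> = sets borel"
    and compact_finite: "compact K \<Longrightarrow> emeasure \<mu> K < \<infinity>"
    and outer: "A \<in> sets borel \<Longrightarrow> emeasure \<mu> A = (INF U\<in>{U. open U \<and> A \<subseteq> U}. emeasure \<mu> U)"
    and inner: "open U \<Longrightarrow> emeasure \<mu> U = (SUP K\<in>{K. compact K \<and> K \<subseteq> U}. emeasure \<mu> K)"
    and locally_finite: "\<exists>U. open U \<and> x \<in> U \<and> emeasure \<mu> U < \<infinity>"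
begin

lemma space_eq [simp]: "space \<mu> = UNIV"
  using sets_eq_imp_space_eq[OF sets_eq] by simp

lemma open_sets [intro]: "open U \<Longrightarrow> U \<in> sets \<mu>"
  by (simp add: sets_eq)

lemma compact_sets [intro]: "compact K \<Longrightarrow> K \<in> sets \<mu>"
  by (simp add: sets_eq compact_imp_closed)

text \<open>Inner regularity tests the union on compact subsets, and a compact subset lies in a
  single member of the family, by directedness. No countability enters, which is what replaces
  sigma-finiteness below.\<close>

lemma emeasure_Union_directed:
  assumes "\<A> \<noteq> {}" and op: "\<And>A. A \<in> \<A> \<Longrightarrow> open A"
    and dir: "\<And>A B. A \<in> \<A> \<Longrightarrow> B \<in> \<A> \<Longrightarrow> \<exists>C\<in>\<A>. A \<union> B \<subseteq> C"
  shows "emeasure \<mu> (\<Union>\<A>) = (SUP A\<in>\<A>. emeasure \<mu> A)"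
proof (rule antisym)
  have *: "\<exists>C\<in>\<A>. \<Union>\<D> \<subseteq> C" if "finite \<D>" "\<D> \<subseteq> \<A>" for \<D>
    using that
  proof induction
    case empty
    then show ?case using assms(1) by auto
  next
    case (insert D \<D>)
    then obtain C where "C \<in> \<A>" "\<Union>\<D> \<subseteq> C" by auto
    then obtain E where "E \<in> \<A>" "D \<union> C \<subseteq> E" using dir[of D C] insert.prems by auto
    then show ?case using \<open>\<Union>\<D> \<subseteq> C\<close> by (intro bexI[of _ E]) auto
  qed
  have "emeasure \<mu> K \<le> (SUP A\<in>\<A>. emeasure \<mu> A)" if K: "compact K" "K \<subseteq> \<Union>\<A>" for K
  proof -
    obtain \<D> where "\<D> \<subseteq> \<A>" "finite \<D>" "K \<subseteq> \<Union>\<D>"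
      using compactE[OF K, of thesis] op by metis
    obtain C where C: "C \<in> \<A>" "\<Union>\<D> \<subseteq> C" using *[OF \<open>finite \<D>\<close> \<open>\<D> \<subseteq> \<A>\<close>] by (elim bexE)
    from C(2) have "K \<subseteq> C" using \<open>K \<subseteq> \<Union>\<D>\<close> by (rule order_trans[rotated])
    then show ?thesis
      using op C by (intro SUP_upper2[of C] emeasure_mono) auto
  qed
  moreover have "emeasure \<mu> (\<Union>\<A>) = (SUP K\<in>{K. compact K \<and> K \<subseteq> \<Union>\<A>}. emeasure \<mu> K)"
    using op by (intro inner open_Union) blast
  ultimately show "emeasure \<mu> (\<Union>\<A>) \<le> (SUP A\<in>\<A>. emeasure \<mu> A)"
    by (metis (mono_tags, lifting) SUP_least mem_Collect_eq)
  show "(SUP A\<in>\<A>. emeasure \<mu> A) \<le> emeasure \<mu> (\<Union>\<A>)"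
    using op by (intro SUP_least emeasure_mono) auto
qed

lemma lsc_measurable:
  fixes \<phi> :: "'a \<Rightarrow> ennreal"
  assumes "\<And>t. open {y. t < \<phi> y}"
  shows "\<phi> \<in> borel_measurable borel"
  by (rule borel_measurableI_greater) (use assms in auto)

text \<open>Monotone convergence for uncountable directed families of lower semicontinuous
  functions. A layer sum involves only measures of open superlevel sets, and these commute with the
  supremum. Layer sums are not monotone in \<open>n\<close>, so the return to the function itself
  goes through Fatou's lemma.\<close>

lemma nn_integral_SUP_directed:
  fixes \<Phi> :: "'i \<Rightarrow> 'a \<Rightarrow> ennreal"
  assumes "I \<noteq> {}" and lsc: "\<And>i t. i \<in> I \<Longrightarrow> open {y. t < \<Phi> i y}"
    and dir: "\<And>i j. i \<in> I \<Longrightarrow> j \<in> I \<Longrightarrow> \<exists>k\<in>I. \<forall>y. \<Phi> i y \<le> \<Phi> k y \<and> \<Phi> j y \<le> \<Phi> k y"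
  shows "(\<integral>\<^sup>+y. (SUP i\<in>I. \<Phi> i y) \<partial>\<mu>) = (SUP i\<in>I. \<integral>\<^sup>+y. \<Phi> i y \<partial>\<mu>)"
proof (rule antisym)
  define d :: "nat \<Rightarrow> ennreal \<Rightarrow> ennreal" where
    "d n t = (\<Sum>k\<in>{1..n*n}. if ennreal (real k / real n) < t then ennreal (1 / real n) else 0)" for n t
  have dint: "(\<integral>\<^sup>+y. d n (\<phi> y) \<partial>\<mu>) = (\<Sum>k\<in>{1..n*n}. ennreal (1 / real n) * emeasure \<mu> {y. ennreal (real k / real n) < \<phi> y})"
    if o: "\<And>t. open {y. t < \<phi> y}" for n and \<phi> :: "'a \<Rightarrow> ennreal"
  proof -
    have "(\<integral>\<^sup>+y. d n (\<phi> y) \<partial>\<mu>) = (\<integral>\<^sup>+y. (\<Sum>k\<in>{1..n*n}. ennreal (1 / real n) * indicator {y. ennreal (real k / real n) < \<phi> y} y) \<partial>\<mu>)"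
      unfolding d_def by (intro nn_integral_cong sum.cong) auto
    also have "\<dots> = (\<Sum>k\<in>{1..n*n}. \<integral>\<^sup>+y. ennreal (1 / real n) * indicator {y. ennreal (real k / real n) < \<phi> y} y \<partial>\<mu>)"
      by (intro nn_integral_sum borel_measurable_times_ennreal borel_measurable_const borel_measurable_indicator open_sets o)
    also have "\<dots> = (\<Sum>k\<in>{1..n*n}. ennreal (1 / real n) * emeasure \<mu> {y. ennreal (real k / real n) < \<phi> y})"
      by (intro sum.cong nn_integral_cmult_indicator open_sets o refl)
    finally show ?thesis .
  qed
  define \<phi> where "\<phi> = (\<lambda>y. SUP i\<in>I. \<Phi> i y)"
  have lev: "{y. t < \<phi> y} = (\<Union>i\<in>I. {y. t < \<Phi> i y})" for t
    by (auto simp: \<phi>_def less_SUP_iff)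
  have o: "open {y. t < \<phi> y}" for t
    unfolding lev using lsc by auto
  have em: "emeasure \<mu> {y. t < \<phi> y} = (SUP i\<in>I. emeasure \<mu> {y. t < \<Phi> i y})" for t
  proof -
    have "emeasure \<mu> (\<Union>((\<lambda>i. {y. t < \<Phi> i y}) ` I)) = (SUP A\<in>(\<lambda>i. {y. t < \<Phi> i y}) ` I. emeasure \<mu> A)"
    proof (rule emeasure_Union_directed)
      fix A B assume "A \<in> (\<lambda>i. {y. t < \<Phi> i y}) ` I" "B \<in> (\<lambda>i. {y. t < \<Phi> i y}) ` I"
      then obtain i j where ij: "i \<in> I" "j \<in> I" "A = {y. t < \<Phi> i y}" "B = {y. t < \<Phi> j y}" by auto
      obtain k where "k \<in> I" "\<forall>y. \<Phi> i y \<le> \<Phi> k y \<and> \<Phi> j y \<le> \<Phi> k y" using dir ij by blast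
      then show "\<exists>C\<in>(\<lambda>i. {y. t < \<Phi> i y}) ` I. A \<union> B \<subseteq> C"
        using ij by (intro bexI[of _ "{y. t < \<Phi> k y}"]) (auto intro: less_le_trans)
    qed (use assms(1) lsc in auto)
    then show ?thesis unfolding lev by (simp add: image_image)
  qed
  have "(\<integral>\<^sup>+y. d n (\<phi> y) \<partial>\<mu>) \<le> (SUP i\<in>I. \<integral>\<^sup>+y. \<Phi> i y \<partial>\<mu>)" for n
  proof -
    have "(\<integral>\<^sup>+y. d n (\<phi> y) \<partial>\<mu>) = (\<Sum>k\<in>{1..n*n}. SUP i\<in>I. ennreal (1 / real n) * emeasure \<mu> {y. ennreal (real k / real n) < \<Phi> i y})"
      using assms(1) by (simp add: dint[OF o] em SUP_mult_left_ennreal)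
    also have "\<dots> = (SUP i\<in>I. \<Sum>k\<in>{1..n*n}. ennreal (1 / real n) * emeasure \<mu> {y. ennreal (real k / real n) < \<Phi> i y})"
    proof (rule SUP_sum_directed_ennreal[symmetric])
      fix i j assume "i \<in> I" "j \<in> I"
      then obtain k where k: "k \<in> I" "\<forall>y. \<Phi> i y \<le> \<Phi> k y \<and> \<Phi> j y \<le> \<Phi> k y" using dir by blast
      show "\<exists>k\<in>I. \<forall>s\<in>{1..n*n}. ennreal (1 / real n) * emeasure \<mu> {y. ennreal (real s / real n) < \<Phi> i y}
         \<le> ennreal (1 / real n) * emeasure \<mu> {y. ennreal (real s / real n) < \<Phi> k y} \<and>
         ennreal (1 / real n) * emeasure \<mu> {y. ennreal (real s / real n) < \<Phi> j y}
         \<le> ennreal (1 / real n) * emeasure \<mu> {y. ennreal (real s / real n) < \<Phi> k y}"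
        using k lsc by (intro bexI[of _ k] ballI conjI mult_left_mono emeasure_mono) (auto intro: less_le_trans)
    qed (use assms(1) in auto)
    also have "\<dots> \<le> (SUP i\<in>I. \<integral>\<^sup>+y. \<Phi> i y \<partial>\<mu>)"
    proof (intro SUP_mono bexI)
      fix i assume i: "i \<in> I"
      show "(\<Sum>k\<in>{1..n*n}. ennreal (1 / real n) * emeasure \<mu> {y. ennreal (real k / real n) < \<Phi> i y}) \<le> (\<integral>\<^sup>+y. \<Phi> i y \<partial>\<mu>)"
        unfolding dint[OF lsc[OF i], symmetric] unfolding d_def
        by (intro nn_integral_mono tendsto_layer_sum(2))
    qed
    finally show ?thesis .
  qed
  then have le: "liminf (\<lambda>n. \<integral>\<^sup>+y. d n (\<phi> y) \<partial>\<mu>) \<le> (SUP i\<in>I. \<integral>\<^sup>+y. \<Phi> i y \<partial>\<mu>)"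
    by (metis (no_types, lifting) Liminf_const Liminf_mono always_eventually trivial_limit_sequentially)
  have "(\<integral>\<^sup>+y. \<phi> y \<partial>\<mu>) = (\<integral>\<^sup>+y. liminf (\<lambda>n. d n (\<phi> y)) \<partial>\<mu>)"
    unfolding d_def
    by (intro nn_integral_cong lim_imp_Liminf[symmetric] tendsto_layer_sum(1)) simp
  also have "\<dots> \<le> liminf (\<lambda>n. \<integral>\<^sup>+y. d n (\<phi> y) \<partial>\<mu>)"
  proof (rule nn_integral_liminf)
    have [measurable]: "\<phi> \<in> borel_measurable borel" using o by (rule lsc_measurable)
    show "(\<lambda>y. d n (\<phi> y)) \<in> borel_measurable \<mu>" for n
      unfolding d_def by measurable
  qed
  finally show "(\<integral>\<^sup>+y. (SUP i\<in>I. \<Phi> i y) \<partial>\<mu>) \<le> (SUP i\<in>I. \<integral>\<^sup>+y. \<Phi> i y \<partial>\<mu>)"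
    using le unfolding \<phi>_def by simp
  show "(SUP i\<in>I. \<integral>\<^sup>+y. \<Phi> i y \<partial>\<mu>) \<le> (\<integral>\<^sup>+y. (SUP i\<in>I. \<Phi> i y) \<partial>\<mu>)"
    by (intro SUP_least nn_integral_mono SUP_upper)
qed

lemma open_section1: "open W \<Longrightarrow> open (Pair y -` W)" for W :: "('a \<times> 'a) set"
  by (intro open_vimage continuous_intros)

lemma open_section2: "open W \<Longrightarrow> open ((\<lambda>y. (y, x)) -` W)" for W :: "('a \<times> 'a) set"
  by (intro open_vimage continuous_intros)

lemma borel_section1: "E \<in> sets borel \<Longrightarrow> Pair y -` E \<in> sets borel" for E :: "('a \<times> 'a) set"
  using measurable_sets[of "Pair y" borel borel E]
  by (simp add: borel_measurable_continuous_onI continuous_intros)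

lemma borel_section2: "E \<in> sets borel \<Longrightarrow> (\<lambda>y. (y, x)) -` E \<in> sets borel" for E :: "('a \<times> 'a) set"
  using measurable_sets[of "\<lambda>y. (y, x)" borel borel E]
  by (simp add: borel_measurable_continuous_onI continuous_intros)

text \<open>Inner regularity gives a compact part \<open>K\<close> of the section whose measure
  already exceeds \<open>t\<close>; by the tube lemma \<open>K\<close> stays inside all nearby
  sections.\<close>

lemma lsc_section1:
  assumes "open (W :: ('a \<times> 'a) set)"
  shows "open {y. t < emeasure \<mu> (Pair y -` W)}"
proof (subst open_subopen, safe)
  fix y assume "t < emeasure \<mu> (Pair y -` W)"
  then obtain K where K: "compact K" "K \<subseteq> Pair y -` W" "t < emeasure \<mu> K"
    unfolding inner[OF open_section1[OF assms]] less_SUP_iff by auto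
  then have "{y} \<times> K \<subseteq> W" by auto
  from Elementary_Topology.tube_lemma[OF K(1) assms this] obtain X where X: "y \<in> X" "open X" "X \<times> K \<subseteq> W" by auto
  have "X \<subseteq> {y. t < emeasure \<mu> (Pair y -` W)}"
  proof
    fix z assume "z \<in> X"
    then have "K \<subseteq> Pair z -` W" using X by auto
    then have "emeasure \<mu> K \<le> emeasure \<mu> (Pair z -` W)"
      by (intro emeasure_mono open_sets open_section1 assms)
    then show "z \<in> {y. t < emeasure \<mu> (Pair y -` W)}" using K by auto
  qed
  then show "\<exists>T. open T \<and> y \<in> T \<and> T \<subseteq> {y. t < emeasure \<mu> (Pair y -` W)}" using X by blast
qed

lemma lsc_section2:
  assumes "open (W :: ('a \<times> 'a) set)"
  shows "open {x. t < emeasure \<mu> ((\<lambda>y. (y, x)) -` W)}"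
proof -
  have "open (prod.swap -` W)"
    by (intro open_vimage assms continuous_on_swap)
  from lsc_section1[OF this, of t] show ?thesis by (simp add: vimage_def)
qed

text \<open>All sides of the rectangles lie in one open set \<open>U\<close> of finite measure. The
  restriction of \<open>\<mu>\<close> to \<open>U\<close> is a finite measure, and both iterated
  integrals are the value of its product measure at \<open>R\<close>.\<close>

lemma nn_integral_sections_rectangles:
  fixes F :: "('a set \<times> 'a set) set"
  assumes "finite F" and F: "\<And>A B. (A, B) \<in> F \<Longrightarrow> open A \<and> open B \<and> emeasure \<mu> A < \<infinity> \<and> emeasure \<mu> B < \<infinity>"
  defines "R \<equiv> \<Union>(A, B)\<in>F. A \<times> B"
  shows "(\<integral>\<^sup>+y. emeasure \<mu> (Pair y -` R) \<partial>\<mu>) = (\<integral>\<^sup>+x. emeasure \<mu> ((\<lambda>y. (y, x)) -` R) \<partial>\<mu>)"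
proof -
  define U where "U = (\<Union>(A, B)\<in>F. A \<union> B)"
  define M where "M = density \<mu> (indicator U)"
  have "open U" using F by (auto simp: U_def intro!: open_UN)
  then have [measurable]: "U \<in> sets \<mu>" by auto
  have "open R" using F by (auto simp: R_def intro!: open_UN open_Times)
  have "emeasure \<mu> U \<le> (\<Sum>p\<in>F. emeasure \<mu> (case p of (A, B) \<Rightarrow> A \<union> B))"
    unfolding U_def using F \<open>finite F\<close> by (intro emeasure_subadditive_finite) auto
  also have "\<dots> < \<infinity>"
  proof -
    have "emeasure \<mu> (case p of (A, B) \<Rightarrow> A \<union> B) < \<infinity>" if "p \<in> F" for p
    proof -
      obtain A B where p: "p = (A, B)" by (cases p)
      have "emeasure \<mu> (A \<union> B) \<le> emeasure \<mu> A + emeasure \<mu> B"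
        using F that p by (intro emeasure_subadditive open_sets) auto
      also have "\<dots> < \<infinity>" using F[of A B] that p by simp
      finally show ?thesis by (simp add: p)
    qed
    then show ?thesis using \<open>finite F\<close> by (auto simp: less_top[symmetric])
  qed
  finally have U_fin: "emeasure \<mu> U < \<infinity>" .
  have M_em: "emeasure M S = emeasure \<mu> S" if "S \<in> sets borel" "S \<subseteq> U" for S
  proof -
    have "emeasure M S = (\<integral>\<^sup>+x. indicator U x * indicator S x \<partial>\<mu>)"
      unfolding M_def using that by (subst emeasure_density) (auto simp: sets_eq)
    also have "\<dots> = (\<integral>\<^sup>+x. indicator S x \<partial>\<mu>)"
      using that by (intro nn_integral_cong) (auto split: split_indicator)
    finally have "emeasure M S = (\<integral>\<^sup>+x. indicator S x \<partial>\<mu>)" .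
    then show ?thesis using that by (simp add: sets_eq)
  qed
  have M_int: "(\<integral>\<^sup>+x. f x \<partial>M) = (\<integral>\<^sup>+x. f x \<partial>\<mu>)"
    if [measurable]: "f \<in> borel_measurable borel" and "\<And>x. x \<notin> U \<Longrightarrow> f x = 0" for f
    unfolding M_def using that(2)
    by (subst nn_integral_density) (auto intro!: nn_integral_cong split: split_indicator)
  have [simp]: "space M = UNIV" and sM: "sets M = sets borel" by (simp_all add: M_def sets_eq)
  interpret M: finite_measure M
    by (rule finite_measureI) (use U_fin M_em[of U] \<open>open U\<close> in \<open>auto simp: M_def emeasure_density\<close>)
  interpret MM: pair_sigma_finite M M ..
  have "A \<times> B \<in> sets (M \<Otimes>\<^sub>M M)" if "(A, B) \<in> F" for A B
    using F[OF that] by (auto simp: sM)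
  then have R: "R \<in> sets (M \<Otimes>\<^sub>M M)" unfolding R_def using \<open>finite F\<close> by (auto intro!: sets.finite_UN)
  have RU: "R \<subseteq> U \<times> U" by (force simp: R_def U_def)
  have "(\<integral>\<^sup>+y. emeasure \<mu> (Pair y -` R) \<partial>\<mu>) = (\<integral>\<^sup>+y. emeasure \<mu> (Pair y -` R) \<partial>M)"
  proof (rule M_int[symmetric])
    show "emeasure \<mu> (Pair x -` R) = 0" if "x \<notin> U" for x
    proof -
      have "Pair x -` R = {}" using RU that by auto
      then show ?thesis by simp
    qed
  qed (intro lsc_measurable lsc_section1 \<open>open R\<close>)
  also have "\<dots> = (\<integral>\<^sup>+y. emeasure M (Pair y -` R) \<partial>M)"
    using RU \<open>open R\<close> by (intro nn_integral_cong M_em[symmetric]) (auto simp: open_section1)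
  also have "\<dots> = emeasure (M \<Otimes>\<^sub>M M) R"
    by (simp add: M.emeasure_pair_measure_alt R)
  also have "\<dots> = (\<integral>\<^sup>+x. emeasure M ((\<lambda>y. (y, x)) -` R) \<partial>M)"
    by (simp add: MM.emeasure_pair_measure_alt2 R)
  also have "\<dots> = (\<integral>\<^sup>+x. emeasure \<mu> ((\<lambda>y. (y, x)) -` R) \<partial>M)"
    using RU \<open>open R\<close> by (intro nn_integral_cong M_em) (auto simp: open_section2)
  also have "\<dots> = (\<integral>\<^sup>+x. emeasure \<mu> ((\<lambda>y. (y, x)) -` R) \<partial>\<mu>)"
  proof (rule M_int)
    show "emeasure \<mu> ((\<lambda>y. (y, x)) -` R) = 0" if "x \<notin> U" for x
    proof -
      have "(\<lambda>y. (y, x)) -` R = {}" using RU that by auto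
      then show ?thesis by simp
    qed
  qed (intro lsc_measurable lsc_section2 \<open>open R\<close>)
  finally show ?thesis .
qed

lemma nn_integral_sections_open:
  assumes W: "open (W :: ('a \<times> 'a) set)"
  shows "(\<integral>\<^sup>+y. emeasure \<mu> (Pair y -` W) \<partial>\<mu>) = (\<integral>\<^sup>+x. emeasure \<mu> ((\<lambda>y. (y, x)) -` W) \<partial>\<mu>)"
proof -
  define rect where "rect F \<longleftrightarrow> finite F \<and> (\<forall>(A, B)\<in>F. open A \<and> open B \<and> emeasure \<mu> A < \<infinity> \<and> emeasure \<mu> B < \<infinity>)"
    for F :: "('a set \<times> 'a set) set"
  define I where "I = {R. R \<subseteq> W \<and> (\<exists>F. rect F \<and> R = (\<Union>(A, B)\<in>F. A \<times> B))}"
  have "{} \<in> I" unfolding I_def rect_def by (auto intro!: exI[of _ "{}"])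
  then have "I \<noteq> {}" by auto
  have o: "open R" if R: "R \<in> I" for R
  proof -
    obtain F where "rect F" "R = (\<Union>(A, B)\<in>F. A \<times> B)" using R by (auto simp: I_def)
    then show ?thesis by (auto simp: rect_def intro!: open_UN open_Times)
  qed
  have un: "R \<union> S \<in> I" if RS: "R \<in> I" "S \<in> I" for R S
  proof -
    obtain F where "rect F" "R = (\<Union>(A, B)\<in>F. A \<times> B)" using RS by (auto simp: I_def)
    moreover obtain G where "rect G" "S = (\<Union>(A, B)\<in>G. A \<times> B)" using RS by (auto simp: I_def)
    ultimately have "rect (F \<union> G)" "R \<union> S = (\<Union>(A, B)\<in>F\<union>G. A \<times> B)" by (auto simp: rect_def)
    moreover have "R \<union> S \<subseteq> W" using RS by (auto simp: I_def)
    ultimately show ?thesis unfolding I_def mem_Collect_eq by (intro conjI exI[of _ "F \<union> G"])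
  qed
  \<comment> \<open>Local finiteness shrinks a basic rectangle around \<open>p\<close> until both
    sides have finite measure, as the case of finite unions of rectangles demands.\<close>
  have cover: "\<exists>R\<in>I. p \<in> R" if "p \<in> W" for p
  proof -
    obtain y x where p: "p = (y, x)" by (cases p)
    obtain A B where AB: "open A" "open B" "p \<in> A \<times> B" "A \<times> B \<subseteq> W"
      using open_prod_elim[OF W \<open>p \<in> W\<close>] by metis
    obtain U where U: "open U" "y \<in> U" "emeasure \<mu> U < \<infinity>" using locally_finite by blast
    obtain V where V: "open V" "x \<in> V" "emeasure \<mu> V < \<infinity>" using locally_finite by blast
    have "emeasure \<mu> (A \<inter> U) \<le> emeasure \<mu> U" "emeasure \<mu> (B \<inter> V) \<le> emeasure \<mu> V"
      by (intro emeasure_mono; use U V in auto)+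
    then have "rect {(A \<inter> U, B \<inter> V)}" unfolding rect_def using AB U V by (auto simp: open_Int)
    then have "(A \<inter> U) \<times> (B \<inter> V) \<in> I" unfolding I_def using AB by auto
    then show ?thesis using AB U V p by (intro bexI[of _ "(A \<inter> U) \<times> (B \<inter> V)"]) auto
  qed
  have sub: "p \<in> W" if "R \<in> I" "p \<in> R" for R p using that by (auto simp: I_def)
  have s1: "emeasure \<mu> (Pair y -` W) = (SUP R\<in>I. emeasure \<mu> (Pair y -` R))" for y
  proof -
    have "\<Union>((\<lambda>R. Pair y -` R) ` I) = Pair y -` W"
    proof (intro set_eqI iffI)
      fix x assume "x \<in> Pair y -` W"
      then have "(y, x) \<in> W" by simp
      from cover[OF this] obtain R where "R \<in> I" "(y, x) \<in> R" by (elim bexE)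
      then show "x \<in> \<Union>((\<lambda>R. Pair y -` R) ` I)" by auto
    next
      fix x assume "x \<in> \<Union>((\<lambda>R. Pair y -` R) ` I)"
      then obtain R where "R \<in> I" "(y, x) \<in> R" by auto
      then show "x \<in> Pair y -` W" using sub[of R] by simp
    qed
    moreover have "emeasure \<mu> (\<Union>((\<lambda>R. Pair y -` R) ` I)) = (SUP A\<in>(\<lambda>R. Pair y -` R) ` I. emeasure \<mu> A)"
    proof (rule emeasure_Union_directed)
      fix A B assume "A \<in> (\<lambda>R. Pair y -` R) ` I" "B \<in> (\<lambda>R. Pair y -` R) ` I"
      then obtain R S where "R \<in> I" "S \<in> I" "A = Pair y -` R" "B = Pair y -` S" by auto
      then show "\<exists>C\<in>(\<lambda>R. Pair y -` R) ` I. A \<union> B \<subseteq> C"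
        using un[of R S] by (intro bexI[of _ "Pair y -` (R \<union> S)"] imageI) simp_all
    qed (use \<open>I \<noteq> {}\<close> o open_section1 in auto)
    ultimately show ?thesis by (simp add: image_image)
  qed
  have s2: "emeasure \<mu> ((\<lambda>y. (y, x)) -` W) = (SUP R\<in>I. emeasure \<mu> ((\<lambda>y. (y, x)) -` R))" for x
  proof -
    have "\<Union>((\<lambda>R. (\<lambda>y. (y, x)) -` R) ` I) = (\<lambda>y. (y, x)) -` W"
    proof (intro set_eqI iffI)
      fix y assume "y \<in> (\<lambda>y. (y, x)) -` W"
      then have "(y, x) \<in> W" by simp
      from cover[OF this] obtain R where "R \<in> I" "(y, x) \<in> R" by (elim bexE)
      then show "y \<in> \<Union>((\<lambda>R. (\<lambda>y. (y, x)) -` R) ` I)" by auto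
    next
      fix y assume "y \<in> \<Union>((\<lambda>R. (\<lambda>y. (y, x)) -` R) ` I)"
      then obtain R where "R \<in> I" "(y, x) \<in> R" by auto
      then show "y \<in> (\<lambda>y. (y, x)) -` W" using sub[of R] by simp
    qed
    moreover have "emeasure \<mu> (\<Union>((\<lambda>R. (\<lambda>y. (y, x)) -` R) ` I)) = (SUP A\<in>(\<lambda>R. (\<lambda>y. (y, x)) -` R) ` I. emeasure \<mu> A)"
    proof (rule emeasure_Union_directed)
      fix A B assume "A \<in> (\<lambda>R. (\<lambda>y. (y, x)) -` R) ` I" "B \<in> (\<lambda>R. (\<lambda>y. (y, x)) -` R) ` I"
      then obtain R S where "R \<in> I" "S \<in> I" "A = (\<lambda>y. (y, x)) -` R" "B = (\<lambda>y. (y, x)) -` S" by auto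
      then show "\<exists>C\<in>(\<lambda>R. (\<lambda>y. (y, x)) -` R) ` I. A \<union> B \<subseteq> C"
        using un[of R S] by (intro bexI[of _ "(\<lambda>y. (y, x)) -` (R \<union> S)"] imageI) simp_all
    qed (use \<open>I \<noteq> {}\<close> o open_section2 in auto)
    ultimately show ?thesis by (simp add: image_image)
  qed
  have "(\<integral>\<^sup>+y. emeasure \<mu> (Pair y -` W) \<partial>\<mu>) = (SUP R\<in>I. \<integral>\<^sup>+y. emeasure \<mu> (Pair y -` R) \<partial>\<mu>)"
    unfolding s1
  proof (rule nn_integral_SUP_directed)
    fix R S assume RS: "R \<in> I" "S \<in> I"
    show "\<exists>k\<in>I. \<forall>y. emeasure \<mu> (Pair y -` R) \<le> emeasure \<mu> (Pair y -` k) \<and> emeasure \<mu> (Pair y -` S) \<le> emeasure \<mu> (Pair y -` k)"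
      using un[OF RS] o open_section1
      by (intro bexI[of _ "R \<union> S"] allI conjI emeasure_mono open_sets) blast+
  qed (use \<open>I \<noteq> {}\<close> o lsc_section1 in auto)
  also have "\<dots> = (SUP R\<in>I. \<integral>\<^sup>+x. emeasure \<mu> ((\<lambda>y. (y, x)) -` R) \<partial>\<mu>)"
  proof (intro SUP_cong refl)
    fix R assume "R \<in> I"
    then obtain F where F: "rect F" "R = (\<Union>(A, B)\<in>F. A \<times> B)" by (auto simp: I_def)
    then show "(\<integral>\<^sup>+y. emeasure \<mu> (Pair y -` R) \<partial>\<mu>) = (\<integral>\<^sup>+x. emeasure \<mu> ((\<lambda>y. (y, x)) -` R) \<partial>\<mu>)"
      using nn_integral_sections_rectangles[of F] unfolding rect_def by blast
  qed
  also have "\<dots> = (\<integral>\<^sup>+x. emeasure \<mu> ((\<lambda>y. (y, x)) -` W) \<partial>\<mu>)"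
    unfolding s2
  proof (rule nn_integral_SUP_directed[symmetric])
    fix R S assume RS: "R \<in> I" "S \<in> I"
    show "\<exists>k\<in>I. \<forall>x. emeasure \<mu> ((\<lambda>y. (y, x)) -` R) \<le> emeasure \<mu> ((\<lambda>y. (y, x)) -` k) \<and> emeasure \<mu> ((\<lambda>y. (y, x)) -` S) \<le> emeasure \<mu> ((\<lambda>y. (y, x)) -` k)"
      using un[OF RS] o open_section2
      by (intro bexI[of _ "R \<union> S"] allI conjI emeasure_mono open_sets) blast+
  qed (use \<open>I \<noteq> {}\<close> o lsc_section2 in auto)
  finally show ?thesis .
qed

text \<open>All these finiteness conditions serve subtraction: complements within \<open>W\<close>
  are handled by differences of section measures and by differences of their integrals.\<close>

definition finite_sections :: "('a \<times> 'a) set \<Rightarrow> bool" where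
  "finite_sections W \<longleftrightarrow> open W \<and> (\<forall>y. emeasure \<mu> (Pair y -` W) < \<infinity>) \<and>
     (\<forall>x. emeasure \<mu> ((\<lambda>y. (y, x)) -` W) < \<infinity>) \<and> (\<integral>\<^sup>+y. emeasure \<mu> (Pair y -` W) \<partial>\<mu>) < \<infinity>"

text \<open>Open sets are stable under intersection and generate the Borel sets of the product
  space, so by Dynkin's theorem it is enough to treat complements and disjoint countable unions.
  Intersecting with \<open>W\<close> keeps every measure finite.\<close>

lemma sections_borel:
  assumes W: "finite_sections W" and "E \<in> sets borel"
  shows "(\<lambda>y. emeasure \<mu> (Pair y -` (E \<inter> W))) \<in> borel_measurable borel \<and>
    (\<lambda>x. emeasure \<mu> ((\<lambda>y. (y, x)) -` (E \<inter> W))) \<in> borel_measurable borel \<and>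
    (\<integral>\<^sup>+y. emeasure \<mu> (Pair y -` (E \<inter> W)) \<partial>\<mu>) = (\<integral>\<^sup>+x. emeasure \<mu> ((\<lambda>y. (y, x)) -` (E \<inter> W)) \<partial>\<mu>)"
    (is "?P E")
proof -
  have oW: "open W" and [measurable]: "W \<in> sets borel" using W by (auto simp: finite_sections_def)
  have E: "E \<in> sigma_sets UNIV {S. open S}" using assms(2) by (simp add: borel_def)
  have m1: "Pair y -` A \<in> sets \<mu>" and m2: "(\<lambda>y. (y, x)) -` A \<in> sets \<mu>" if "A \<in> sets borel" for A y x
    using that by (simp_all add: sets_eq borel_section1 borel_section2)
  show ?thesis
  proof (rule sigma_sets_induct_disjoint[OF _ _ E])
    show "Int_stable {S :: ('a \<times> 'a) set. open S}" by (auto simp: Int_stable_def)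
  next
    fix A :: "('a \<times> 'a) set" assume "A \<in> {S. open S}"
    then have "open (A \<inter> W)" using oW by auto
    then show "?P A"
      by (intro conjI lsc_measurable lsc_section1 lsc_section2 nn_integral_sections_open)
  next
    fix A :: "('a \<times> 'a) set" assume "A \<in> sigma_sets UNIV {S. open S}"
      and A: "?P A"
    then have [measurable]: "A \<in> sets borel" by (simp add: borel_def)
    note A[THEN conjunct1, measurable] A[THEN conjunct2, THEN conjunct1, measurable]
    have [measurable]: "(\<lambda>y. emeasure \<mu> (Pair y -` W)) \<in> borel_measurable borel"
      "(\<lambda>x. emeasure \<mu> ((\<lambda>y. (y, x)) -` W)) \<in> borel_measurable borel"
      by (intro lsc_measurable lsc_section1 lsc_section2 oW)+
    have e1: "emeasure \<mu> (Pair y -` ((UNIV - A) \<inter> W)) = emeasure \<mu> (Pair y -` W) - emeasure \<mu> (Pair y -` (A \<inter> W))" for y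
    proof -
      have "Pair y -` ((UNIV - A) \<inter> W) = Pair y -` W - Pair y -` (A \<inter> W)" by auto
      moreover have "emeasure \<mu> (Pair y -` (A \<inter> W)) \<le> emeasure \<mu> (Pair y -` W)"
        by (intro emeasure_mono m1) auto
      moreover have "emeasure \<mu> (Pair y -` W) < \<infinity>" using W by (auto simp: finite_sections_def)
      ultimately show ?thesis
        by (subst emeasure_Diff[symmetric]) (auto intro!: m1)
    qed
    have e2: "emeasure \<mu> ((\<lambda>y. (y, x)) -` ((UNIV - A) \<inter> W)) = emeasure \<mu> ((\<lambda>y. (y, x)) -` W) - emeasure \<mu> ((\<lambda>y. (y, x)) -` (A \<inter> W))" for x
    proof -
      have "(\<lambda>y. (y, x)) -` ((UNIV - A) \<inter> W) = (\<lambda>y. (y, x)) -` W - (\<lambda>y. (y, x)) -` (A \<inter> W)" by auto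
      moreover have "emeasure \<mu> ((\<lambda>y. (y, x)) -` (A \<inter> W)) \<le> emeasure \<mu> ((\<lambda>y. (y, x)) -` W)"
        by (intro emeasure_mono m2) auto
      moreover have "emeasure \<mu> ((\<lambda>y. (y, x)) -` W) < \<infinity>" using W by (auto simp: finite_sections_def)
      ultimately show ?thesis
        by (subst emeasure_Diff[symmetric]) (auto intro!: m2)
    qed
    have i1: "(\<integral>\<^sup>+y. emeasure \<mu> (Pair y -` (A \<inter> W)) \<partial>\<mu>) \<le> (\<integral>\<^sup>+y. emeasure \<mu> (Pair y -` W) \<partial>\<mu>)"
      by (intro nn_integral_mono emeasure_mono m1) auto
    have i2: "(\<integral>\<^sup>+y. emeasure \<mu> (Pair y -` W) \<partial>\<mu>) < \<infinity>" using W by (auto simp: finite_sections_def)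
    have d1: "(\<integral>\<^sup>+y. emeasure \<mu> (Pair y -` ((UNIV - A) \<inter> W)) \<partial>\<mu>) = (\<integral>\<^sup>+y. emeasure \<mu> (Pair y -` W) \<partial>\<mu>) - (\<integral>\<^sup>+y. emeasure \<mu> (Pair y -` (A \<inter> W)) \<partial>\<mu>)"
      unfolding e1 using i1 i2
      by (intro nn_integral_diff AE_I2 emeasure_mono m1) (auto simp del: vimage_Int)
    have d2: "(\<integral>\<^sup>+x. emeasure \<mu> ((\<lambda>y. (y, x)) -` ((UNIV - A) \<inter> W)) \<partial>\<mu>) = (\<integral>\<^sup>+x. emeasure \<mu> ((\<lambda>y. (y, x)) -` W) \<partial>\<mu>) - (\<integral>\<^sup>+x. emeasure \<mu> ((\<lambda>y. (y, x)) -` (A \<inter> W)) \<partial>\<mu>)"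
      unfolding e2 using i1 i2 A nn_integral_sections_open[OF oW]
      by (intro nn_integral_diff AE_I2 emeasure_mono m2) (auto simp del: vimage_Int)
    show "?P (UNIV - A)"
    proof (intro conjI)
      show "(\<lambda>y. emeasure \<mu> (Pair y -` ((UNIV - A) \<inter> W))) \<in> borel_measurable borel"
        unfolding e1 by measurable
      show "(\<lambda>x. emeasure \<mu> ((\<lambda>y. (y, x)) -` ((UNIV - A) \<inter> W))) \<in> borel_measurable borel"
        unfolding e2 by measurable
      show "(\<integral>\<^sup>+y. emeasure \<mu> (Pair y -` ((UNIV - A) \<inter> W)) \<partial>\<mu>) = (\<integral>\<^sup>+x. emeasure \<mu> ((\<lambda>y. (y, x)) -` ((UNIV - A) \<inter> W)) \<partial>\<mu>)"
        unfolding d1 d2 using A nn_integral_sections_open[OF oW] by simp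
    qed
  next
    fix A :: "nat \<Rightarrow> ('a \<times> 'a) set" assume d: "disjoint_family A"
      and r: "range A \<subseteq> sigma_sets UNIV {S. open S}"
      and A: "\<And>i. (\<lambda>y. emeasure \<mu> (Pair y -` (A i \<inter> W))) \<in> borel_measurable borel \<and>
      (\<lambda>x. emeasure \<mu> ((\<lambda>y. (y, x)) -` (A i \<inter> W))) \<in> borel_measurable borel \<and>
      (\<integral>\<^sup>+y. emeasure \<mu> (Pair y -` (A i \<inter> W)) \<partial>\<mu>) = (\<integral>\<^sup>+x. emeasure \<mu> ((\<lambda>y. (y, x)) -` (A i \<inter> W)) \<partial>\<mu>)"
    have [measurable]: "A i \<in> sets borel" for i using r by (auto simp: borel_def)
    note A[THEN conjunct1, measurable] A[THEN conjunct2, THEN conjunct1, measurable]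
    have e1: "emeasure \<mu> (Pair y -` (\<Union>(range A) \<inter> W)) = (\<Sum>i. emeasure \<mu> (Pair y -` (A i \<inter> W)))" for y
    proof -
      have "Pair y -` (\<Union>(range A) \<inter> W) = (\<Union>i. Pair y -` (A i \<inter> W))" by auto
      moreover have "disjoint_family (\<lambda>i. Pair y -` (A i \<inter> W))" using d by (auto simp: disjoint_family_on_def)
      ultimately show ?thesis by (subst suminf_emeasure) (auto intro!: m1)
    qed
    have e2: "emeasure \<mu> ((\<lambda>y. (y, x)) -` (\<Union>(range A) \<inter> W)) = (\<Sum>i. emeasure \<mu> ((\<lambda>y. (y, x)) -` (A i \<inter> W)))" for x
    proof -
      have "(\<lambda>y. (y, x)) -` (\<Union>(range A) \<inter> W) = (\<Union>i. (\<lambda>y. (y, x)) -` (A i \<inter> W))" by auto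
      moreover have "disjoint_family (\<lambda>i. (\<lambda>y. (y, x)) -` (A i \<inter> W))" using d by (auto simp: disjoint_family_on_def)
      ultimately show ?thesis by (subst suminf_emeasure) (auto intro!: m2)
    qed
    show "?P (\<Union>(range A))"
    proof (intro conjI)
      show "(\<lambda>y. emeasure \<mu> (Pair y -` (\<Union>(range A) \<inter> W))) \<in> borel_measurable borel"
        unfolding e1 by measurable
      show "(\<lambda>x. emeasure \<mu> ((\<lambda>y. (y, x)) -` (\<Union>(range A) \<inter> W))) \<in> borel_measurable borel"
        unfolding e2 by measurable
      show "(\<integral>\<^sup>+y. emeasure \<mu> (Pair y -` (\<Union>(range A) \<inter> W)) \<partial>\<mu>) = (\<integral>\<^sup>+x. emeasure \<mu> ((\<lambda>y. (y, x)) -` (\<Union>(range A) \<inter> W)) \<partial>\<mu>)"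
        unfolding e1 e2 using A by (simp add: nn_integral_suminf del: vimage_Int)
    qed
  qed auto
qed

lemma section_measurable1:
  fixes \<Phi> :: "'a \<times> 'a \<Rightarrow> 'b::topological_space"
  shows "\<Phi> \<in> borel_measurable borel \<Longrightarrow> (\<lambda>x. \<Phi> (y, x)) \<in> borel_measurable borel"
  by (rule measurable_compose[of "Pair y" borel borel])
     (simp_all add: borel_measurable_continuous_onI continuous_intros)

lemma section_measurable2:
  fixes \<Phi> :: "'a \<times> 'a \<Rightarrow> 'b::topological_space"
  shows "\<Phi> \<in> borel_measurable borel \<Longrightarrow> (\<lambda>y. \<Phi> (y, x)) \<in> borel_measurable borel"
  by (rule measurable_compose[of "\<lambda>y. (y, x)" borel borel])
     (simp_all add: borel_measurable_continuous_onI continuous_intros)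

lemma tonelli_finite_sections:
  fixes \<Phi> :: "'a \<times> 'a \<Rightarrow> ennreal"
  assumes W: "finite_sections W" and "\<Phi> \<in> borel_measurable borel"
  shows "(\<lambda>y. \<integral>\<^sup>+x. \<Phi> (y, x) * indicator W (y, x) \<partial>\<mu>) \<in> borel_measurable borel \<and>
    (\<lambda>x. \<integral>\<^sup>+y. \<Phi> (y, x) * indicator W (y, x) \<partial>\<mu>) \<in> borel_measurable borel \<and>
    (\<integral>\<^sup>+y. \<integral>\<^sup>+x. \<Phi> (y, x) * indicator W (y, x) \<partial>\<mu> \<partial>\<mu>) = (\<integral>\<^sup>+x. \<integral>\<^sup>+y. \<Phi> (y, x) * indicator W (y, x) \<partial>\<mu> \<partial>\<mu>)"
    (is "?P \<Phi>")
  using assms(2)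
proof (induction \<Phi> rule: borel_measurable_induct)
  case (cong f g)
  then have "f = g" by auto
  then show ?case using cong by simp
next
  case (set A)
  have W': "W \<in> sets borel" using W by (auto simp: finite_sections_def)
  have e1: "(\<integral>\<^sup>+x. indicator A (y, x) * indicator W (y, x) \<partial>\<mu>) = emeasure \<mu> (Pair y -` (A \<inter> W))" for y
  proof -
    have "(\<integral>\<^sup>+x. indicator A (y, x) * indicator W (y, x) \<partial>\<mu>) = (\<integral>\<^sup>+x. indicator (Pair y -` (A \<inter> W)) x \<partial>\<mu>)"
      by (intro nn_integral_cong) (auto split: split_indicator)
    then show ?thesis using set W' by (simp add: sets_eq borel_section1 del: vimage_Int)
  qed
  have e2: "(\<integral>\<^sup>+y. indicator A (y, x) * indicator W (y, x) \<partial>\<mu>) = emeasure \<mu> ((\<lambda>y. (y, x)) -` (A \<inter> W))" for x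
  proof -
    have "(\<integral>\<^sup>+y. indicator A (y, x) * indicator W (y, x) \<partial>\<mu>) = (\<integral>\<^sup>+y. indicator ((\<lambda>y. (y, x)) -` (A \<inter> W)) y \<partial>\<mu>)"
      by (intro nn_integral_cong) (auto split: split_indicator)
    then show ?thesis using set W' by (simp add: sets_eq borel_section2 del: vimage_Int)
  qed
  show ?case unfolding e1 e2 using sections_borel[OF W set] .
next
  case (mult u c)
  have [measurable]: "W \<in> sets borel" using W by (auto simp: finite_sections_def)
  note [measurable] = mult(2) and IH = mult.IH
  have m: "(\<lambda>p. u p * indicator W p) \<in> borel_measurable borel" by measurable
  note section_measurable1[OF m, measurable] section_measurable2[OF m, measurable]
  note IH[THEN conjunct1, measurable] IH[THEN conjunct2, THEN conjunct1, measurable]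
  show ?case using IH
    by (simp add: mult.assoc nn_integral_cmult borel_measurable_times_ennreal)
next
  case (add u v)
  have [measurable]: "W \<in> sets borel" using W by (auto simp: finite_sections_def)
  note [measurable] = add(1,3) 
  have m: "(\<lambda>p. u p * indicator W p) \<in> borel_measurable borel" "(\<lambda>p. v p * indicator W p) \<in> borel_measurable borel"
    by measurable
  note m[THEN section_measurable1, measurable] m[THEN section_measurable2, measurable]
  note add.IH(1)[THEN conjunct1, measurable] add.IH(1)[THEN conjunct2, THEN conjunct1, measurable]
  note add.IH(2)[THEN conjunct1, measurable] add.IH(2)[THEN conjunct2, THEN conjunct1, measurable]
  show ?case using add.IH
    by (simp add: distrib_right nn_integral_add)
next
  case (seq U)
  have [measurable]: "W \<in> sets borel" using W by (auto simp: finite_sections_def)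
  note [measurable] = seq(1)
  have m: "(\<lambda>p. U i p * indicator W p) \<in> borel_measurable borel" for i by measurable
  note m[THEN section_measurable1, measurable] m[THEN section_measurable2, measurable]
  note IH = seq.IH
  note IH[THEN conjunct1, measurable] IH[THEN conjunct2, THEN conjunct1, measurable]
  have inc: "U i p \<le> U j p" if "i \<le> j" for i j p by (rule le_funD[OF incseqD[OF seq(3) that]])
  have e1: "(\<integral>\<^sup>+x. (SUP i. U i) (y, x) * indicator W (y, x) \<partial>\<mu>) = (SUP i. \<integral>\<^sup>+x. U i (y, x) * indicator W (y, x) \<partial>\<mu>)" for y
    unfolding SUP_apply SUP_mult_right_ennreal
    by (intro nn_integral_monotone_convergence_SUP) (auto simp: incseq_def le_fun_def inc intro!: mult_right_mono)
  have e2: "(\<integral>\<^sup>+y. (SUP i. U i) (y, x) * indicator W (y, x) \<partial>\<mu>) = (SUP i. \<integral>\<^sup>+y. U i (y, x) * indicator W (y, x) \<partial>\<mu>)" for x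
    unfolding SUP_apply SUP_mult_right_ennreal
    by (intro nn_integral_monotone_convergence_SUP) (auto simp: incseq_def le_fun_def inc intro!: mult_right_mono)
  show ?case unfolding e1 e2
  proof (intro conjI)
    have "(\<integral>\<^sup>+y. (SUP i. \<integral>\<^sup>+x. U i (y, x) * indicator W (y, x) \<partial>\<mu>) \<partial>\<mu>) = (SUP i. \<integral>\<^sup>+y. \<integral>\<^sup>+x. U i (y, x) * indicator W (y, x) \<partial>\<mu> \<partial>\<mu>)"
      by (intro nn_integral_monotone_convergence_SUP) (auto simp: incseq_def le_fun_def inc intro!: mult_right_mono nn_integral_mono)
    also have "\<dots> = (SUP i. \<integral>\<^sup>+x. \<integral>\<^sup>+y. U i (y, x) * indicator W (y, x) \<partial>\<mu> \<partial>\<mu>)" using IH by simp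
    also have "\<dots> = (\<integral>\<^sup>+x. (SUP i. \<integral>\<^sup>+y. U i (y, x) * indicator W (y, x) \<partial>\<mu>) \<partial>\<mu>)"
      by (intro nn_integral_monotone_convergence_SUP[symmetric]) (auto simp: incseq_def le_fun_def inc intro!: mult_right_mono nn_integral_mono)
    finally show "(\<integral>\<^sup>+y. (SUP i. \<integral>\<^sup>+x. U i (y, x) * indicator W (y, x) \<partial>\<mu>) \<partial>\<mu>) = (\<integral>\<^sup>+x. (SUP i. \<integral>\<^sup>+y. U i (y, x) * indicator W (y, x) \<partial>\<mu>) \<partial>\<mu>)" .
  qed measurable
qed

text \<open>A condition on the integrand stands in for sigma-finiteness of \<open>\<mu>\<close>: it
  vanishes outside countably many increasing sets with finite sections, and monotone convergence
  exhausts them.\<close>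

lemma
  fixes \<Phi> :: "'a \<times> 'a \<Rightarrow> ennreal" and W :: "nat \<Rightarrow> ('a \<times> 'a) set"
  assumes W: "\<And>n. finite_sections (W n)" "incseq W" and [measurable]: "\<Phi> \<in> borel_measurable borel"
    and sub: "\<And>p. p \<notin> (\<Union>n. W n) \<Longrightarrow> \<Phi> p = 0"
  shows tonelli_measurable: "(\<lambda>x. \<integral>\<^sup>+y. \<Phi> (y, x) \<partial>\<mu>) \<in> borel_measurable borel"
    and tonelli: "(\<integral>\<^sup>+y. \<integral>\<^sup>+x. \<Phi> (y, x) \<partial>\<mu> \<partial>\<mu>) = (\<integral>\<^sup>+x. \<integral>\<^sup>+y. \<Phi> (y, x) \<partial>\<mu> \<partial>\<mu>)"
proof -
  note T = tonelli_finite_sections[OF W(1) assms(3)]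
  note T[THEN conjunct1, measurable] T[THEN conjunct2, THEN conjunct1, measurable]
  have [measurable]: "W n \<in> sets borel" for n using W by (auto simp: finite_sections_def)
  have m: "(\<lambda>p. \<Phi> p * indicator (W i) p) \<in> borel_measurable borel" for i by measurable
  note m[THEN section_measurable1, measurable] m[THEN section_measurable2, measurable]
  have ind: "indicator (W i) p \<le> (indicator (W j) p :: ennreal)" if "i \<le> j" for i j p
    using W(2) that by (auto simp: incseq_def split: split_indicator)
  have Wm: "p \<in> W j" if "p \<in> W i" "i \<le> j" for i j p
    using W(2) that by (auto simp: incseq_def)
  have S: "\<Phi> p = (SUP n. \<Phi> p * indicator (W n) p)" for p
  proof (cases "\<exists>n. p \<in> W n")
    case True
    then obtain n where n: "p \<in> W n" by auto
    show ?thesis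
    proof (rule antisym)
      show "\<Phi> p \<le> (SUP n. \<Phi> p * indicator (W n) p)" using n by (intro SUP_upper2[of n]) auto
    qed (auto intro!: SUP_least split: split_indicator)
  qed (use sub in auto)
  have e1: "(\<integral>\<^sup>+x. \<Phi> (y, x) \<partial>\<mu>) = (SUP i. \<integral>\<^sup>+x. \<Phi> (y, x) * indicator (W i) (y, x) \<partial>\<mu>)" for y
    by (subst S, intro nn_integral_monotone_convergence_SUP)
       (auto simp: incseq_def le_fun_def intro!: mult_left_mono intro: Wm)
  have e2: "(\<integral>\<^sup>+y. \<Phi> (y, x) \<partial>\<mu>) = (SUP i. \<integral>\<^sup>+y. \<Phi> (y, x) * indicator (W i) (y, x) \<partial>\<mu>)" for x
    by (subst S, intro nn_integral_monotone_convergence_SUP)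
       (auto simp: incseq_def le_fun_def intro!: mult_left_mono intro: Wm)
  show "(\<lambda>x. \<integral>\<^sup>+y. \<Phi> (y, x) \<partial>\<mu>) \<in> borel_measurable borel" unfolding e2 by measurable
  have "(\<integral>\<^sup>+y. \<integral>\<^sup>+x. \<Phi> (y, x) \<partial>\<mu> \<partial>\<mu>) = (SUP i. \<integral>\<^sup>+y. \<integral>\<^sup>+x. \<Phi> (y, x) * indicator (W i) (y, x) \<partial>\<mu> \<partial>\<mu>)"
    unfolding e1 by (intro nn_integral_monotone_convergence_SUP)
      (auto simp: incseq_def le_fun_def intro!: mult_left_mono nn_integral_mono intro: Wm)
  also have "\<dots> = (SUP i. \<integral>\<^sup>+x. \<integral>\<^sup>+y. \<Phi> (y, x) * indicator (W i) (y, x) \<partial>\<mu> \<partial>\<mu>)"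
    using T by simp
  also have "\<dots> = (\<integral>\<^sup>+x. \<integral>\<^sup>+y. \<Phi> (y, x) \<partial>\<mu> \<partial>\<mu>)"
    unfolding e2 by (intro nn_integral_monotone_convergence_SUP[symmetric])
      (auto simp: incseq_def le_fun_def intro!: mult_left_mono nn_integral_mono intro: Wm)
  finally show "(\<integral>\<^sup>+y. \<integral>\<^sup>+x. \<Phi> (y, x) \<partial>\<mu> \<partial>\<mu>) = (\<integral>\<^sup>+x. \<integral>\<^sup>+y. \<Phi> (y, x) \<partial>\<mu> \<partial>\<mu>)" .
qed

lemma finite_sectionsI_compact:
  assumes "open W" "W \<subseteq> K \<times> L" "compact K" "compact L"
  shows "finite_sections W"
proof -
  have 1: "emeasure \<mu> (Pair y -` W) \<le> emeasure \<mu> L" for y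
    using assms by (intro emeasure_mono) auto
  have 2: "emeasure \<mu> ((\<lambda>y. (y, x)) -` W) \<le> emeasure \<mu> K" for x
    using assms by (intro emeasure_mono) auto
  have "(\<integral>\<^sup>+y. emeasure \<mu> (Pair y -` W) \<partial>\<mu>) \<le> (\<integral>\<^sup>+y. emeasure \<mu> L * indicator K y \<partial>\<mu>)"
  proof (rule nn_integral_mono)
    fix y
    show "emeasure \<mu> (Pair y -` W) \<le> emeasure \<mu> L * indicator K y"
    proof (cases "y \<in> K")
      case False
      then have "Pair y -` W = {}" using assms(2) by auto
      then show ?thesis by simp
    qed (simp add: 1)
  qed
  also have "\<dots> = emeasure \<mu> L * emeasure \<mu> K"
    using assms by (intro nn_integral_cmult_indicator) auto
  also have "\<dots> < \<infinity>" using compact_finite assms by (simp add: ennreal_mult_less_top)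
  finally have 3: "(\<integral>\<^sup>+y. emeasure \<mu> (Pair y -` W) \<partial>\<mu>) < \<infinity>" .
  show ?thesis unfolding finite_sections_def
    using assms(1) 3 le_less_trans[OF 1 compact_finite[OF assms(4)]] le_less_trans[OF 2 compact_finite[OF assms(3)]]
    by auto
qed

text \<open>By Markov's inequality the sets where \<open>cmod (f x)\<close> is at least
  \<open>1 / (n + 1)\<close> have finite measure, and outer regularity enlarges each to an open set
  of finite measure. Thus an integrable function lives on a sigma-finite open set even if
  \<open>\<mu>\<close> is not sigma-finite.\<close>

lemma integrable_open_support:
  fixes f :: "'a \<Rightarrow> complex"
  assumes f: "integrable \<mu> f"
  shows "\<exists>U :: nat \<Rightarrow> 'a set. (\<forall>n. open (U n) \<and> emeasure \<mu> (U n) < \<infinity>) \<and> incseq U \<and> (\<forall>x. x \<notin> (\<Union>n. U n) \<longrightarrow> f x = 0)"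
proof -
  have [measurable]: "f \<in> borel_measurable borel" using borel_measurable_integrable[OF f] by measurable
  define A where "A n = {x. 1 \<le> of_nat (Suc n) * ennreal (cmod (f x))}" for n
  have Ab: "A n \<in> sets borel" for n unfolding A_def by measurable
  have "\<exists>Q. open Q \<and> A n \<subseteq> Q \<and> emeasure \<mu> Q < \<infinity>" for n
  proof -
    have "emeasure \<mu> (A n) \<le> of_nat (Suc n) * (\<integral>\<^sup>+x. ennreal (cmod (f x)) * indicator UNIV x \<partial>\<mu>)"
      using nn_integral_Markov_inequality[of "\<lambda>x. ennreal (cmod (f x))" UNIV \<mu> "of_nat (Suc n)"]
      by (simp add: A_def sets_eq)
    also have "\<dots> < \<infinity>" using f by (auto simp: integrable_iff_bounded ennreal_mult_less_top of_nat_less_top simp del: of_nat_Suc)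
    finally have "(INF U\<in>{U. open U \<and> A n \<subseteq> U}. emeasure \<mu> U) < \<infinity>" by (simp add: outer[OF Ab])
    then show ?thesis unfolding INF_less_iff by auto
  qed
  then obtain Q where Q: "\<And>n. open (Q n) \<and> A n \<subseteq> Q n \<and> emeasure \<mu> (Q n) < \<infinity>" by metis
  show ?thesis
  proof (intro exI[of _ "\<lambda>n. \<Union>k\<le>n. Q k"] conjI allI impI)
    fix n
    show "open (\<Union>k\<le>n. Q k)" using Q by auto
    have "emeasure \<mu> (\<Union>k\<le>n. Q k) \<le> (\<Sum>k\<le>n. emeasure \<mu> (Q k))"
      using Q by (intro emeasure_subadditive_finite) auto
    also have "\<dots> < \<infinity>" using Q by (auto simp: less_top[symmetric])
    finally show "emeasure \<mu> (\<Union>k\<le>n. Q k) < \<infinity>" .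
  next
    show "incseq (\<lambda>n. \<Union>k\<le>n. Q k)" by (force simp: incseq_def)
  next
    fix x assume x: "x \<notin> (\<Union>n. \<Union>k\<le>n. Q k)"
    show "f x = 0"
    proof (rule ccontr)
      assume "f x \<noteq> 0"
      then obtain n where n: "inverse (real (Suc n)) < cmod (f x)" using reals_Archimedean[of "cmod (f x)"] by auto
      then have "1 \<le> real (Suc n) * cmod (f x)" by (simp add: field_simps del: of_nat_Suc)
      then have "ennreal 1 \<le> ennreal (real (Suc n)) * ennreal (cmod (f x))"
        unfolding ennreal_mult''[OF norm_ge_zero, symmetric] by (rule ennreal_leI)
      then have "x \<in> A n" by (simp add: A_def ennreal_of_nat_eq_real_of_nat del: of_nat_Suc)
      then show False using x Q by blast
    qed
  qed
qed

end

lemma compact_minus_image: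
  fixes S T :: "'g::topological_group_add set"
  assumes "compact S" "compact T"
  shows "compact ((\<lambda>(x, y). x - y) ` (S \<times> T))"
  unfolding case_prod_beta
  by (intro compact_continuous_image compact_Times assms continuous_intros)

lemma compact_plus_image:
  fixes S T :: "'g::topological_group_add set"
  assumes "compact S" "compact T"
  shows "compact ((\<lambda>(x, y). x + y) ` (S \<times> T))"
  unfolding case_prod_beta
  by (intro compact_continuous_image compact_Times assms continuous_intros)

section \<open>Haar measure\<close>

locale haar = radon \<mu> for \<mu> :: "'g::{topological_group_add, t2_space} measure" +
  assumes nonzero: "emeasure \<mu> UNIV \<noteq> 0"
    and left_invariant: "A \<in> sets borel \<Longrightarrow> emeasure \<mu> ((\<lambda>y. x + y) ` A) = emeasure \<mu> A"
    and locally_compact: "\<exists>V K. open V \<and> compact K \<and> (0::'g) \<in> V \<and> V \<subseteq> K"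
begin

lemma cont_left: "continuous_on S (\<lambda>y::'g. a + y)"
  by (intro continuous_intros)

lemma cont_right: "continuous_on S (\<lambda>y::'g. y + a)"
  by (intro continuous_intros)

lemma borel_left: "(\<lambda>y::'g. a + y) \<in> borel_measurable borel"
  by (intro borel_measurable_continuous_onI cont_left)

lemma borel_right: "(\<lambda>y::'g. y + a) \<in> borel_measurable borel"
  by (intro borel_measurable_continuous_onI cont_right)

lemma vimage_left_borel: "A \<in> sets borel \<Longrightarrow> (\<lambda>y::'g. a + y) -` A \<in> sets borel"
  using measurable_sets[OF borel_left] by simp

lemma vimage_right_borel: "A \<in> sets borel \<Longrightarrow> (\<lambda>y::'g. y + a) -` A \<in> sets borel"
  using measurable_sets[OF borel_right] by simp

lemma emeasure_left:
  assumes "A \<in> sets borel"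
  shows "emeasure \<mu> ((\<lambda>y. a + y) -` A) = emeasure \<mu> A"
proof -
  have "(\<lambda>y. a + y) -` A = (\<lambda>y. - a + y) ` A"
  proof (intro set_eqI iffI)
    fix x assume "x \<in> (\<lambda>y. a + y) -` A"
    then show "x \<in> (\<lambda>y. - a + y) ` A" by (intro image_eqI[of _ _ "a + x"]) (auto simp: add.assoc[symmetric])
  qed (auto simp: add.assoc[symmetric])
  then show ?thesis by (simp add: left_invariant assms)
qed

lemma distr_left: "distr \<mu> borel (\<lambda>y. a + y) = \<mu>"
  using borel_left
  by (intro measure_eqI) (auto simp: sets_eq emeasure_left emeasure_distr measurable_cong_sets[OF sets_eq refl])

lemma nn_integral_left:
  assumes [measurable]: "f \<in> borel_measurable borel"
  shows "(\<integral>\<^sup>+y. f (a + y) \<partial>\<mu>) = (\<integral>\<^sup>+y. f y \<partial>\<mu>)"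
proof -
  have "(\<integral>\<^sup>+y. f y \<partial>distr \<mu> borel (\<lambda>y. a + y)) = (\<integral>\<^sup>+y. f (a + y) \<partial>\<mu>)"
    using borel_left by (intro nn_integral_distr) (auto simp: measurable_cong_sets[OF sets_eq refl])
  then show ?thesis by (simp add: distr_left)
qed

text \<open>Finitely many left translates of \<open>U\<close> cover any compact set. If
  \<open>U\<close> were null, all compact sets would be null and, by inner regularity, so would the
  whole group.\<close>

lemma open_positive:
  assumes "open U" "U \<noteq> {}"
  shows "emeasure \<mu> U > 0"
proof (rule ccontr)
  assume "\<not> 0 < emeasure \<mu> U"
  then have U0: "emeasure \<mu> U = 0" by (simp add: zero_less_iff_neq_zero)
  obtain u where u: "u \<in> U" using assms by auto
  have "emeasure \<mu> K = 0" if K: "compact K" for K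
  proof -
    define W where "W k = (\<lambda>y. u - k + y) -` U" for k
    have W: "open (W k)" for k unfolding W_def by (intro open_vimage assms cont_left)
    have "K \<subseteq> (\<Union>k\<in>K. W k)" using u by (auto simp: W_def)
    then obtain F where F: "F \<subseteq> K" "finite F" "K \<subseteq> (\<Union>k\<in>F. W k)"
      using compactE_image[OF K, of K W] W by metis
    have "emeasure \<mu> K \<le> emeasure \<mu> (\<Union>k\<in>F. W k)" using F W by (intro emeasure_mono) auto
    also have "\<dots> \<le> (\<Sum>k\<in>F. emeasure \<mu> (W k))" using F W by (intro emeasure_subadditive_finite) auto
    also have "\<dots> = 0" unfolding W_def using U0 assms by (simp add: emeasure_left)
    finally show ?thesis by simp
  qed
  then have "emeasure \<mu> UNIV = 0"
    unfolding inner[OF open_UNIV] by (intro antisym SUP_least) auto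
  then show False using nonzero by simp
qed

lemma relatively_compact_nbhd:
  assumes "compact (A :: 'g set)"
  shows "\<exists>Q K. open Q \<and> compact K \<and> A \<subseteq> Q \<and> Q \<subseteq> K"
proof -
  obtain V K where V: "open V" "compact K" "(0::'g) \<in> V" "V \<subseteq> K" using locally_compact by auto
  define Q where "Q = (\<Union>a\<in>A. (\<lambda>y. - a + y) -` V)"
  have "open Q" unfolding Q_def by (intro open_UN ballI open_vimage V cont_left)
  moreover have "A \<subseteq> Q" using V by (auto simp: Q_def)
  moreover have "Q \<subseteq> (\<lambda>(x, y). x + y) ` (A \<times> K)"
  proof
    fix x assume "x \<in> Q"
    then obtain a where "a \<in> A" "- a + x \<in> V" by (auto simp: Q_def)
    then show "x \<in> (\<lambda>(x, y). x + y) ` (A \<times> K)"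
      using V by (intro image_eqI[of _ _ "(a, - a + x)"]) (auto simp: add.assoc[symmetric])
  qed
  ultimately show ?thesis using compact_plus_image[OF assms V(2)] by blast
qed

text \<open>
  Weil's uniqueness argument: \<open>J\<close> does not depend on \<open>a\<close>, so the right translate of \<open>\<mu>\<close> by \<open>a\<close> is a
  multiple of \<open>\<mu>\<close> on compact sets. Two changes of variables in the double integral of
  \<open>\<phi> (z + a) * g (y + z + a) / w (z + a)\<close>, with \<open>\<phi>\<close> and \<open>g\<close> the indicators of \<open>A\<close> and \<open>V\<close>, separate the
  variables.
\<close>
lemma right_translate_compact:
  assumes V: "open V" "V \<subseteq> K" "compact K" and A: "compact A" and "0 \<in> V"
  defines "w \<equiv> \<lambda>x. emeasure \<mu> ((\<lambda>y. y + x) -` V)"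
  defines "J \<equiv> (\<integral>\<^sup>+y. indicator A (- y) / w (- y) \<partial>\<mu>)"
  shows "emeasure \<mu> ((\<lambda>z. z + a) -` A) = emeasure \<mu> ((\<lambda>z. z + a) -` V) * J"
proof -
  have wpos: "w x > 0" for x
  proof -
    have "- x \<in> (\<lambda>y. y + x) -` V" using assms by simp
    then show ?thesis unfolding w_def by (intro open_positive open_vimage V cont_right) blast
  qed
  have wfin: "w x < \<infinity>" for x
  proof -
    have c: "compact ((\<lambda>y. y - x) ` K)" by (intro compact_continuous_image V continuous_intros)
    have "(\<lambda>y. y + x) -` V \<subseteq> (\<lambda>y. y - x) ` K"
    proof
      fix y assume "y \<in> (\<lambda>y. y + x) -` V"
      then show "y \<in> (\<lambda>y. y - x) ` K" using V by (intro image_eqI[of _ _ "y + x"]) auto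
    qed
    then have "w x \<le> emeasure \<mu> ((\<lambda>y. y - x) ` K)"
      unfolding w_def using c by (intro emeasure_mono) auto
    then show ?thesis using compact_finite[OF c] by (rule le_less_trans)
  qed
  have "open ((\<lambda>(x, y). y + x) -` V)"
    unfolding case_prod_beta by (intro open_vimage V continuous_intros)
  then have wm[measurable]: "w \<in> borel_measurable borel"
    using lsc_measurable[OF lsc_section1[of "(\<lambda>(x, y). y + x) -` V"]] unfolding w_def by (simp add: vimage_def)
  obtain Q K' where Q: "open Q" "compact K'" "A \<subseteq> Q" "Q \<subseteq> K'" using relatively_compact_nbhd[OF A] by auto
  define g :: "'g \<Rightarrow> ennreal" where "g = indicator V"
  define \<phi> :: "'g \<Rightarrow> ennreal" where "\<phi> = indicator A"
  have [measurable]: "V \<in> sets borel" "A \<in> sets borel" using V A by (auto simp: compact_imp_closed)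
  have [measurable]: "g \<in> borel_measurable borel" "\<phi> \<in> borel_measurable borel" by (auto simp: g_def \<phi>_def)
  note [measurable] = borel_left borel_right
  have bc: "\<psi> \<in> borel_measurable borel" if "continuous_on UNIV \<psi>" for \<psi> :: "'g \<times> 'g \<Rightarrow> 'g"
    using that by (rule borel_measurable_continuous_onI)
  \<comment> \<open>On the support of either integrand below, \<open>y\<close> is the difference of
    a point of \<open>K\<close> and a point of \<open>K'\<close>; compactness of \<open>KK\<close>
    provides the finite sections for Tonelli.\<close>
  define KK where "KK = (\<lambda>(x, y). x - y) ` (K \<times> K')"
  have KK: "compact KK" unfolding KK_def using V Q by (intro compact_minus_image)
  have T1: "(\<integral>\<^sup>+y. \<integral>\<^sup>+z. (\<lambda>(y, z). \<phi> (z + a) * g (y + (z + a)) / w (z + a)) (y, z) \<partial>\<mu> \<partial>\<mu>) =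
        (\<integral>\<^sup>+z. \<integral>\<^sup>+y. (\<lambda>(y, z). \<phi> (z + a) * g (y + (z + a)) / w (z + a)) (y, z) \<partial>\<mu> \<partial>\<mu>)"
  proof (rule tonelli)
    let ?W = "{p. snd p + a \<in> Q \<and> fst p + (snd p + a) \<in> V}"
    have "?W = (\<lambda>p. snd p + a) -` Q \<inter> (\<lambda>p. fst p + (snd p + a)) -` V" by auto
    also have "open \<dots>" by (intro open_Int open_vimage V Q continuous_intros)
    finally have "open ?W" .
    moreover have "?W \<subseteq> KK \<times> (\<lambda>y. y - a) ` K'"
    proof
      fix p assume "p \<in> ?W"
      then have p: "snd p + a \<in> K'" "fst p + (snd p + a) \<in> K" using V Q by auto
      have "fst p \<in> KK" unfolding KK_def
        using p by (intro image_eqI[of _ _ "(fst p + (snd p + a), snd p + a)"]) (auto simp: add_diff_eq[symmetric] simp del: add_diff_eq)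
      moreover have "snd p \<in> (\<lambda>y. y - a) ` K'" using p by (intro image_eqI[of _ _ "snd p + a"]) auto
      ultimately show "p \<in> KK \<times> (\<lambda>y. y - a) ` K'" by (cases p) auto
    qed
    moreover have "compact ((\<lambda>y. y - a) ` K')" by (intro compact_continuous_image Q continuous_intros)
    ultimately show "finite_sections ?W" using KK by (intro finite_sectionsI_compact)
    show "incseq (\<lambda>n::nat. ?W)" by simp
    show "(\<lambda>(y, z). \<phi> (z + a) * g (y + (z + a)) / w (z + a)) \<in> borel_measurable borel"
      unfolding case_prod_beta
      by (intro borel_measurable_times_ennreal borel_measurable_divide_ennreal
          measurable_compose[OF bc, of _ w] measurable_compose[OF bc, of _ g] measurable_compose[OF bc, of _ \<phi>] continuous_intros wm) measurable
    show "(\<lambda>(y, z). \<phi> (z + a) * g (y + (z + a)) / w (z + a)) p = 0" if "p \<notin> (\<Union>n::nat. ?W)" for p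
      using that Q by (cases p) (auto simp: \<phi>_def g_def split: split_indicator)
  qed
  have T2: "(\<integral>\<^sup>+y. \<integral>\<^sup>+z. (\<lambda>(y, z). \<phi> (- y + (z + a)) * g (z + a) / w (- y + (z + a))) (y, z) \<partial>\<mu> \<partial>\<mu>) =
        (\<integral>\<^sup>+z. \<integral>\<^sup>+y. (\<lambda>(y, z). \<phi> (- y + (z + a)) * g (z + a) / w (- y + (z + a))) (y, z) \<partial>\<mu> \<partial>\<mu>)"
  proof (rule tonelli)
    let ?W = "{p. - fst p + (snd p + a) \<in> Q \<and> (snd p + a) \<in> V}"
    have "?W = (\<lambda>p. - fst p + (snd p + a)) -` Q \<inter> (\<lambda>p. snd p + a) -` V" by auto
    also have "open \<dots>" by (intro open_Int open_vimage V Q continuous_intros)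
    finally have "open ?W" .
    moreover have "?W \<subseteq> KK \<times> (\<lambda>y. y - a) ` K"
    proof
      fix p assume "p \<in> ?W"
      then have p: "- fst p + (snd p + a) \<in> K'" "snd p + a \<in> K" using V Q by auto
      have "fst p \<in> KK" unfolding KK_def
        using p by (intro image_eqI[of _ _ "(snd p + a, - fst p + (snd p + a))"]) (auto simp: diff_conv_add_uminus minus_add add.assoc simp del: add_uminus_conv_diff)
      moreover have "snd p \<in> (\<lambda>y. y - a) ` K" using p by (intro image_eqI[of _ _ "snd p + a"]) auto
      ultimately show "p \<in> KK \<times> (\<lambda>y. y - a) ` K" by (cases p) auto
    qed
    moreover have "compact ((\<lambda>y. y - a) ` K)" by (intro compact_continuous_image V continuous_intros)
    ultimately show "finite_sections ?W" using KK by (intro finite_sectionsI_compact)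
    show "incseq (\<lambda>n::nat. ?W)" by simp
    show "(\<lambda>(y, z). \<phi> (- y + (z + a)) * g (z + a) / w (- y + (z + a))) \<in> borel_measurable borel"
      unfolding case_prod_beta
      by (intro borel_measurable_times_ennreal borel_measurable_divide_ennreal
          measurable_compose[OF bc, of _ w] measurable_compose[OF bc, of _ g] measurable_compose[OF bc, of _ \<phi>] continuous_intros wm) measurable
    show "(\<lambda>(y, z). \<phi> (- y + (z + a)) * g (z + a) / w (- y + (z + a))) p = 0" if "p \<notin> (\<Union>n::nat. ?W)" for p
      using that Q by (cases p) (auto simp: \<phi>_def g_def split: split_indicator)
  qed
  have gint: "(\<integral>\<^sup>+y. g (y + x) \<partial>\<mu>) = w x" for x
  proof -
    have "(\<integral>\<^sup>+y. g (y + x) \<partial>\<mu>) = (\<integral>\<^sup>+y. indicator ((\<lambda>y. y + x) -` V) y \<partial>\<mu>)"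
      by (intro nn_integral_cong) (auto simp: g_def split: split_indicator)
    also have "\<dots> = w x" unfolding w_def
      by (intro nn_integral_indicator open_sets open_vimage V cont_right)
    finally show ?thesis .
  qed
  have "emeasure \<mu> ((\<lambda>z. z + a) -` A) = (\<integral>\<^sup>+z. indicator ((\<lambda>z. z + a) -` A) z \<partial>\<mu>)"
    by (intro nn_integral_indicator[symmetric]) (auto simp: sets_eq vimage_right_borel)
  also have "\<dots> = (\<integral>\<^sup>+z. \<integral>\<^sup>+y. \<phi> (z + a) * g (y + (z + a)) / w (z + a) \<partial>\<mu> \<partial>\<mu>)"
  proof (rule nn_integral_cong)
    fix z
    have "(\<integral>\<^sup>+y. \<phi> (z + a) * g (y + (z + a)) / w (z + a) \<partial>\<mu>) = (\<integral>\<^sup>+y. \<phi> (z + a) / w (z + a) * g (y + (z + a)) \<partial>\<mu>)"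
      by (simp add: divide_ennreal_def mult_ac)
    also have "\<dots> = \<phi> (z + a) / w (z + a) * w (z + a)"
      by (subst nn_integral_cmult) (simp_all add: gint)
    also have "\<dots> = \<phi> (z + a)"
      using wpos[of "z + a"] wfin[of "z + a"] by (simp add: ennreal_divide_times ennreal_mult_divide_eq)
    finally show "indicator ((\<lambda>z. z + a) -` A) z = (\<integral>\<^sup>+y. \<phi> (z + a) * g (y + (z + a)) / w (z + a) \<partial>\<mu>)"
      by (simp add: \<phi>_def indicator_def)
  qed
  also have "\<dots> = (\<integral>\<^sup>+y. \<integral>\<^sup>+z. \<phi> (z + a) * g (y + (z + a)) / w (z + a) \<partial>\<mu> \<partial>\<mu>)"
    using T1 by simp
  also have "\<dots> = (\<integral>\<^sup>+y. \<integral>\<^sup>+z. \<phi> (- y + (z + a)) * g (z + a) / w (- y + (z + a)) \<partial>\<mu> \<partial>\<mu>)"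
  proof (rule nn_integral_cong)
    fix y
    have "(\<integral>\<^sup>+z. (\<lambda>z. \<phi> (z + a) * g (y + (z + a)) / w (z + a)) (- y + z) \<partial>\<mu>) = (\<integral>\<^sup>+z. \<phi> (z + a) * g (y + (z + a)) / w (z + a) \<partial>\<mu>)"
      by (rule nn_integral_left) measurable
    then show "(\<integral>\<^sup>+z. \<phi> (z + a) * g (y + (z + a)) / w (z + a) \<partial>\<mu>) = (\<integral>\<^sup>+z. \<phi> (- y + (z + a)) * g (z + a) / w (- y + (z + a)) \<partial>\<mu>)"
      by (simp add: add.assoc[symmetric])
  qed
  also have "\<dots> = (\<integral>\<^sup>+z. \<integral>\<^sup>+y. \<phi> (- y + (z + a)) * g (z + a) / w (- y + (z + a)) \<partial>\<mu> \<partial>\<mu>)"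
    using T2 by simp
  also have "\<dots> = (\<integral>\<^sup>+z. g (z + a) * J \<partial>\<mu>)"
  proof (rule nn_integral_cong)
    fix z
    have m[measurable]: "(\<lambda>y::'g. - y) \<in> borel_measurable borel" by (intro borel_measurable_continuous_onI continuous_intros)
    have "(\<integral>\<^sup>+y. \<phi> (- y + (z + a)) * g (z + a) / w (- y + (z + a)) \<partial>\<mu>) = (\<integral>\<^sup>+y. \<phi> (- ((z + a) + y) + (z + a)) * g (z + a) / w (- ((z + a) + y) + (z + a)) \<partial>\<mu>)"
      by (rule nn_integral_left[symmetric]) measurable
    also have "\<dots> = (\<integral>\<^sup>+y. g (z + a) * (\<phi> (- y) / w (- y)) \<partial>\<mu>)"
      by (simp add: minus_add add.assoc divide_ennreal_def mult_ac del: add_uminus_conv_diff)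
    also have "\<dots> = g (z + a) * J" unfolding J_def \<phi>_def[symmetric]
      by (subst nn_integral_cmult) simp_all
    finally show "(\<integral>\<^sup>+y. \<phi> (- y + (z + a)) * g (z + a) / w (- y + (z + a)) \<partial>\<mu>) = g (z + a) * J" .
  qed
  also have "\<dots> = emeasure \<mu> ((\<lambda>z. z + a) -` V) * J"
    by (subst nn_integral_multc) (simp_all add: gint w_def)
  finally show ?thesis .
qed

text \<open>The factor \<open>J\<close> in \<open>right_translate_compact\<close> does not see
  \<open>a\<close>, so comparing \<open>a\<close> with \<open>0\<close> eliminates it and leaves the
  ratio \<open>e\<close>, read off one fixed neighbourhood \<open>V\<close>. Inner regularity
  carries the identity from compact to open sets, outer regularity from open to Borel sets.\<close>

lemma modular_exists:
  "\<exists>d>0. \<forall>A\<in>sets borel. emeasure \<mu> ((\<lambda>z. z + a) -` A) = ennreal d * emeasure \<mu> A"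
proof -
  obtain V K where V: "open V" "compact K" "(0::'g) \<in> V" "V \<subseteq> K" using locally_compact by auto
  define e where "e = emeasure \<mu> ((\<lambda>z. z + a) -` V) / emeasure \<mu> V"
  have "- a \<in> (\<lambda>z. z + a) -` V" using V by simp
  then have p1: "emeasure \<mu> ((\<lambda>z. z + a) -` V) > 0"
    by (intro open_positive open_vimage V cont_right) blast
  have p2: "emeasure \<mu> V > 0" using V by (intro open_positive) auto
  have "emeasure \<mu> V \<le> emeasure \<mu> K" using V by (intro emeasure_mono) auto
  then have f2: "emeasure \<mu> V < \<infinity>" using compact_finite[OF V(2)] by (rule le_less_trans)
  have c: "compact ((\<lambda>y. y - a) ` K)" by (intro compact_continuous_image V continuous_intros)
  have "(\<lambda>y. y + a) -` V \<subseteq> (\<lambda>y. y - a) ` K"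
  proof
    fix y assume "y \<in> (\<lambda>y. y + a) -` V"
    then show "y \<in> (\<lambda>y. y - a) ` K" using V by (intro image_eqI[of _ _ "y + a"]) auto
  qed
  then have "emeasure \<mu> ((\<lambda>z. z + a) -` V) \<le> emeasure \<mu> ((\<lambda>y. y - a) ` K)"
    using c by (intro emeasure_mono) auto
  then have f1: "emeasure \<mu> ((\<lambda>z. z + a) -` V) < \<infinity>" using compact_finite[OF c] by (rule le_less_trans)
  have e: "e > 0" "e < \<infinity>" unfolding e_def using p1 p2 f1 f2
    by (auto simp: ennreal_zero_less_divide ennreal_divide_eq_top_iff less_top[symmetric])
  have C: "emeasure \<mu> ((\<lambda>z. z + a) -` A) = e * emeasure \<mu> A" if "compact A" for A
  proof -
    obtain J where J: "\<And>b. emeasure \<mu> ((\<lambda>z. z + b) -` A) = emeasure \<mu> ((\<lambda>z. z + b) -` V) * J"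
      using right_translate_compact[OF V(1) V(4) V(2) \<open>compact A\<close> V(3)] by blast
    have "emeasure \<mu> A = emeasure \<mu> V * J" using J[of 0] by simp
    then have "e * emeasure \<mu> A = (e * emeasure \<mu> V) * J" by (simp add: mult.assoc)
    also have "e * emeasure \<mu> V = emeasure \<mu> ((\<lambda>z. z + a) -` V)"
      unfolding e_def using p2 f2 by (simp add: ennreal_divide_times ennreal_mult_divide_eq)
    finally show ?thesis using J[of a] by simp
  qed
  have vim: "(\<lambda>z. z + a) -` ((\<lambda>z. z + a) ` S) = S" for S by (auto simp: inj_vimage_image_eq inj_on_def)
  have vim2: "(\<lambda>z. z + a) ` ((\<lambda>z. z + a) -` S) = S" for S
  proof -
    have "x = (x - a) + a" for x by simp
    then have "surj (\<lambda>z. z + a)" unfolding surj_def by blast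
    then show ?thesis by (rule surj_image_vimage_eq)
  qed
  have oim: "open ((\<lambda>z. z + a) ` S)" if "open S" for S
  proof -
    have "(\<lambda>z. z + a) ` S = (\<lambda>z. z + (- a)) -` S"
    proof (intro set_eqI iffI)
      fix x assume "x \<in> (\<lambda>z. z + (- a)) -` S"
      then show "x \<in> (\<lambda>z. z + a) ` S" by (intro image_eqI[of _ _ "x + (- a)"]) auto
    qed auto
    then show ?thesis using that by (metis open_vimage cont_right)
  qed
  have Op: "emeasure \<mu> ((\<lambda>z. z + a) -` U) = e * emeasure \<mu> U" if "open U" for U
  proof -
    have eq: "{K. compact K \<and> K \<subseteq> (\<lambda>z. z + a) -` U} = (\<lambda>A. (\<lambda>z. z + a) -` A) ` {K. compact K \<and> K \<subseteq> U}"
    proof (intro set_eqI iffI)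
      fix L assume L: "L \<in> {K. compact K \<and> K \<subseteq> (\<lambda>z. z + a) -` U}"
      then have "compact ((\<lambda>z. z + a) ` L)" by (intro compact_continuous_image cont_right) auto
      then show "L \<in> (\<lambda>A. (\<lambda>z. z + a) -` A) ` {K. compact K \<and> K \<subseteq> U}"
        using L vim by (intro image_eqI[of _ _ "(\<lambda>z. z + a) ` L"]) auto
    next
      fix L assume "L \<in> (\<lambda>A. (\<lambda>z. z + a) -` A) ` {K. compact K \<and> K \<subseteq> U}"
      then obtain A where A: "compact A" "A \<subseteq> U" "L = (\<lambda>z. z + a) -` A" by auto
      have "L = (\<lambda>z. z - a) ` A"
      proof (intro set_eqI iffI)
        fix x assume "x \<in> L"
        then show "x \<in> (\<lambda>z. z - a) ` A" using A by (intro image_eqI[of _ _ "x + a"]) auto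
      qed (use A in auto)
      moreover have "compact ((\<lambda>z. z - a) ` A)" by (intro compact_continuous_image A continuous_intros)
      ultimately show "L \<in> {K. compact K \<and> K \<subseteq> (\<lambda>z. z + a) -` U}" using A by auto
    qed
    have "emeasure \<mu> ((\<lambda>z. z + a) -` U) = (SUP K\<in>{K. compact K \<and> K \<subseteq> (\<lambda>z. z + a) -` U}. emeasure \<mu> K)"
      by (intro inner open_vimage that cont_right)
    also have "\<dots> = (SUP K\<in>{K. compact K \<and> K \<subseteq> U}. e * emeasure \<mu> K)"
      unfolding eq image_image by (intro SUP_cong) (auto simp: C)
    also have "\<dots> = e * emeasure \<mu> U"
      unfolding inner[OF that] by (rule SUP_mult_left_ennreal[symmetric])
    finally show ?thesis .
  qed
  have "emeasure \<mu> ((\<lambda>z. z + a) -` A) = e * emeasure \<mu> A" if "A \<in> sets borel" for A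
  proof -
    have eq: "{U. open U \<and> (\<lambda>z. z + a) -` A \<subseteq> U} = (\<lambda>U. (\<lambda>z. z + a) -` U) ` {U. open U \<and> A \<subseteq> U}"
    proof (intro set_eqI iffI)
      fix L assume L: "L \<in> {U. open U \<and> (\<lambda>z. z + a) -` A \<subseteq> U}"
      moreover have "A \<subseteq> (\<lambda>z. z + a) ` L"
        using L image_mono[of "(\<lambda>z. z + a) -` A" L "\<lambda>z. z + a"] vim2[of A] by simp
      ultimately show "L \<in> (\<lambda>U. (\<lambda>z. z + a) -` U) ` {U. open U \<and> A \<subseteq> U}"
        using vim oim by (intro image_eqI[of _ _ "(\<lambda>z. z + a) ` L"]) auto
    next
      fix L assume "L \<in> (\<lambda>U. (\<lambda>z. z + a) -` U) ` {U. open U \<and> A \<subseteq> U}"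
      then show "L \<in> {U. open U \<and> (\<lambda>z. z + a) -` A \<subseteq> U}"
        by (auto intro: open_vimage cont_right)
    qed
    have "emeasure \<mu> ((\<lambda>z. z + a) -` A) = (INF U\<in>{U. open U \<and> (\<lambda>z. z + a) -` A \<subseteq> U}. emeasure \<mu> U)"
      by (intro outer vimage_right_borel that)
    also have "\<dots> = (INF U\<in>{U. open U \<and> A \<subseteq> U}. e * emeasure \<mu> U)"
      unfolding eq image_image by (intro INF_cong) (auto simp: Op)
    also have "\<dots> = e * (INF U\<in>{U. open U \<and> A \<subseteq> U}. emeasure \<mu> U)"
    proof (rule antisym)
      show "e * (INF U\<in>{U. open U \<and> A \<subseteq> U}. emeasure \<mu> U) \<le> (INF U\<in>{U. open U \<and> A \<subseteq> U}. e * emeasure \<mu> U)"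
        by (intro INF_greatest mult_left_mono INF_lower) auto
      have "(INF U\<in>{U. open U \<and> A \<subseteq> U}. e * emeasure \<mu> U) / e \<le> (INF U\<in>{U. open U \<and> A \<subseteq> U}. emeasure \<mu> U)"
      proof (rule INF_greatest)
        fix U assume U: "U \<in> {U. open U \<and> A \<subseteq> U}"
        have "(INF U\<in>{U. open U \<and> A \<subseteq> U}. e * emeasure \<mu> U) / e \<le> (e * emeasure \<mu> U) / e"
          using U by (intro divide_right_mono_ennreal INF_lower)
        also have "\<dots> = emeasure \<mu> U" using e by (simp add: mult.commute[of e] ennreal_mult_divide_eq)
        finally show "(INF U\<in>{U. open U \<and> A \<subseteq> U}. e * emeasure \<mu> U) / e \<le> emeasure \<mu> U" .
      qed
      then have "(INF U\<in>{U. open U \<and> A \<subseteq> U}. e * emeasure \<mu> U) / e * e \<le> (INF U\<in>{U. open U \<and> A \<subseteq> U}. emeasure \<mu> U) * e"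
        by (rule mult_right_mono) simp
      moreover have "x / e * e = x" for x using e by (simp add: ennreal_divide_times)
      ultimately show "(INF U\<in>{U. open U \<and> A \<subseteq> U}. e * emeasure \<mu> U) \<le> e * (INF U\<in>{U. open U \<and> A \<subseteq> U}. emeasure \<mu> U)"
        by (simp add: mult.commute)
    qed
    finally show ?thesis by (simp add: outer[OF that])
  qed
  moreover obtain d where "e = ennreal d" "d > 0" using e by (cases e) (auto simp: ennreal_eq_0_iff zero_less_iff_neq_zero not_le)
  ultimately show ?thesis by blast
qed

text \<open>With the modular function \<open>Delta\<close> normalised so that the right translate
  \<open>A + a\<close> has measure \<open>Delta a\<close> times that of \<open>A\<close>, this is
  \<open>Delta (- a)\<close>: the preimage in question is \<open>A - a\<close>.\<close>

definition modular :: "'g \<Rightarrow> real" where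
  "modular a = (SOME d. d > 0 \<and> (\<forall>A\<in>sets borel. emeasure \<mu> ((\<lambda>z. z + a) -` A) = ennreal d * emeasure \<mu> A))"

lemma modular_pos: "modular a > 0"
  and emeasure_right: "A \<in> sets borel \<Longrightarrow> emeasure \<mu> ((\<lambda>z. z + a) -` A) = ennreal (modular a) * emeasure \<mu> A"
  using someI_ex[OF modular_exists[of a]] unfolding modular_def[symmetric] by auto

lemma nn_integral_right:
  assumes [measurable]: "f \<in> borel_measurable borel"
  shows "(\<integral>\<^sup>+y. f (y + a) \<partial>\<mu>) = ennreal (modular a) * (\<integral>\<^sup>+y. f y \<partial>\<mu>)"
proof -
  have "distr \<mu> borel (\<lambda>y. y + a) = scale_measure (ennreal (modular a)) \<mu>"
    using borel_right
    by (intro measure_eqI) (auto simp: sets_eq emeasure_right emeasure_distr measurable_cong_sets[OF sets_eq refl])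
  then have "(\<integral>\<^sup>+y. f y \<partial>distr \<mu> borel (\<lambda>y. y + a)) = ennreal (modular a) * (\<integral>\<^sup>+y. f y \<partial>\<mu>)"
    by (simp add: nn_integral_scale_measure)
  moreover have "(\<integral>\<^sup>+y. f y \<partial>distr \<mu> borel (\<lambda>y. y + a)) = (\<integral>\<^sup>+y. f (y + a) \<partial>\<mu>)"
    using borel_right by (intro nn_integral_distr) (auto simp: measurable_cong_sets[OF sets_eq refl])
  ultimately show ?thesis by simp
qed

end

section \<open>Duals and convolution\<close>

lemma cdual_add: "\<phi> \<in> cdual V p \<Longrightarrow> u \<in> V \<Longrightarrow> v \<in> V \<Longrightarrow> \<phi> (\<lambda>x. u x + v x) = \<phi> u + \<phi> v"
  and cdual_scale: "\<phi> \<in> cdual V p \<Longrightarrow> u \<in> V \<Longrightarrow> \<phi> (\<lambda>x. c * u x) = c * \<phi> u"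
  and cdual_outside: "\<phi> \<in> cdual V p \<Longrightarrow> u \<notin> V \<Longrightarrow> \<phi> u = 0"
  by (auto simp: cdual_def)

lemma cdualI:
  assumes "\<And>u v. u \<in> V \<Longrightarrow> v \<in> V \<Longrightarrow> \<phi> (\<lambda>x. u x + v x) = \<phi> u + \<phi> v"
    and "\<And>c u. u \<in> V \<Longrightarrow> \<phi> (\<lambda>x. c * u x) = c * \<phi> u"
    and "\<And>u. u \<in> V \<Longrightarrow> cmod (\<phi> u) \<le> C * p u"
    and "\<And>u. u \<notin> V \<Longrightarrow> \<phi> u = 0"
  shows "\<phi> \<in> cdual V p"
  using assms unfolding cdual_def by blast

lemma cdual_bound_ex: "\<phi> \<in> cdual V p \<Longrightarrow> \<exists>C. \<forall>u\<in>V. cmod (\<phi> u) \<le> C * p u"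
  by (simp add: cdual_def)

lemma cdual_bdd_above:
  assumes "\<phi> \<in> cdual V p" "\<And>u. u \<in> V \<Longrightarrow> p u \<ge> 0"
  shows "bdd_above ((\<lambda>u. cmod (\<phi> u)) ` {u \<in> V. p u \<le> 1})"
proof -
  obtain C where "\<forall>u\<in>V. cmod (\<phi> u) \<le> C * p u" using cdual_bound_ex[OF assms(1)] by (elim exE)
  then have C: "\<And>u. u \<in> V \<Longrightarrow> cmod (\<phi> u) \<le> C * p u" by simp
  have "cmod (\<phi> u) \<le> \<bar>C\<bar>" if "u \<in> V" "p u \<le> 1" for u
  proof -
    have "C * p u \<le> \<bar>C\<bar> * 1" using assms(2)[OF that(1)] that(2) by (intro mult_mono) auto
    then show ?thesis using C[OF that(1)] by simp
  qed
  then show ?thesis by (auto simp: bdd_above_def)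
qed

lemma cdual_norm_bound:
  assumes \<phi>: "\<phi> \<in> cdual V p" and nonneg: "\<And>u. u \<in> V \<Longrightarrow> p u \<ge> 0"
    and V: "\<And>c u. u \<in> V \<Longrightarrow> (\<lambda>x. c * u x) \<in> V"
    and p: "\<And>c u. u \<in> V \<Longrightarrow> p (\<lambda>x. c * u x) = cmod c * p u" and u: "u \<in> V"
  shows "cmod (\<phi> u) \<le> dual_norm V p \<phi> * p u"
proof (cases "p u = 0")
  \<comment> \<open>Null vectors of the seminorm cannot be normalised; the unspecified constant in
    \<open>cdual\<close> already forces \<open>\<phi> u\<close> to be 0.\<close>
  case True
  obtain C where "\<forall>u\<in>V. cmod (\<phi> u) \<le> C * p u" using cdual_bound_ex[OF assms(1)] by (elim exE)
  then have C: "\<And>u. u \<in> V \<Longrightarrow> cmod (\<phi> u) \<le> C * p u" by simp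
  show ?thesis using C[OF u] True by simp
next
  case False
  then have pos: "p u > 0" using nonneg[OF u] by simp
  define c where "c = complex_of_real (1 / p u)"
  have "p (\<lambda>x. c * u x) \<le> 1" using p[OF u, of c] pos by (simp add: c_def norm_divide)
  then have "cmod (\<phi> (\<lambda>x. c * u x)) \<le> dual_norm V p \<phi>"
    unfolding dual_norm_def using V[OF u, of c] cdual_bdd_above[OF \<phi> nonneg]
    by (intro cSUP_upper) auto
  then have "cmod (c * \<phi> u) \<le> dual_norm V p \<phi>"
    by (simp only: cdual_scale[OF \<phi> u])
  then show ?thesis using pos by (simp add: c_def norm_mult norm_divide field_simps)
qed

text \<open>\<open>v\<close> witnesses that the unit ball is non-empty; a supremum of reals over the
  empty set would carry no information.\<close>

lemma dual_norm_least:
  assumes "\<And>u. u \<in> V \<Longrightarrow> cmod (\<phi> u) \<le> B * p u" "B \<ge> 0" "v \<in> V" "p v \<le> 1"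
  shows "dual_norm V p \<phi> \<le> B"
  unfolding dual_norm_def
proof (rule cSUP_least)
  show "{u \<in> V. p u \<le> 1} \<noteq> {}" using assms by auto
  fix u assume "u \<in> {u \<in> V. p u \<le> 1}"
  then show "cmod (\<phi> u) \<le> B" using assms(1)[of u] assms(2) mult_left_mono[of "p u" 1 B] by simp
qed

lemma cdual_closed_add:
  assumes "\<phi> \<in> cdual V p" "\<psi> \<in> cdual V p"
  shows "(\<lambda>u. \<phi> u + \<psi> u) \<in> cdual V p"
proof -
  obtain C where "\<forall>u\<in>V. cmod (\<phi> u) \<le> C * p u" using cdual_bound_ex[OF assms(1)] by (elim exE)
  then have C: "\<And>u. u \<in> V \<Longrightarrow> cmod (\<phi> u) \<le> C * p u" by simp
  obtain D where "\<forall>u\<in>V. cmod (\<psi> u) \<le> D * p u" using cdual_bound_ex[OF assms(2)] by (elim exE)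
  then have D: "\<And>u. u \<in> V \<Longrightarrow> cmod (\<psi> u) \<le> D * p u" by simp
  show ?thesis
  proof (rule cdualI)
    fix u assume "u \<in> V"
    then show "cmod (\<phi> u + \<psi> u) \<le> (C + D) * p u"
      using C[of u] D[of u] norm_triangle_ineq[of "\<phi> u" "\<psi> u"] by (simp add: distrib_right)
  qed (use assms in \<open>auto simp: cdual_add cdual_scale cdual_outside algebra_simps\<close>)
qed

lemma cdual_closed_scale:
  assumes "\<phi> \<in> cdual V p"
  shows "(\<lambda>u. c * \<phi> u) \<in> cdual V p"
proof -
  obtain C where "\<forall>u\<in>V. cmod (\<phi> u) \<le> C * p u" using cdual_bound_ex[OF assms(1)] by (elim exE)
  then have C: "\<And>u. u \<in> V \<Longrightarrow> cmod (\<phi> u) \<le> C * p u" by simp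
  show ?thesis
  proof (rule cdualI)
    fix u assume "u \<in> V"
    then show "cmod (c * \<phi> u) \<le> (cmod c * C) * p u"
      using C[of u] mult_left_mono[of "cmod (\<phi> u)" "C * p u" "cmod c"] by (simp add: norm_mult mult.assoc)
  qed (use assms in \<open>auto simp: cdual_add cdual_scale cdual_outside algebra_simps\<close>)
qed

lemma dual_norm_nonneg:
  assumes "\<phi> \<in> cdual V p" "\<And>u. u \<in> V \<Longrightarrow> p u \<ge> 0" "v \<in> V" "p v \<le> 1"
  shows "dual_norm V p \<phi> \<ge> 0"
  unfolding dual_norm_def using assms(3,4)
  by (intro cSUP_upper2[OF cdual_bdd_above[OF assms(1,2)], of v]) auto

lemma L1I: "integrable \<mu> f \<Longrightarrow> f \<in> L1 \<mu>" and L1D: "f \<in> L1 \<mu> \<Longrightarrow> integrable \<mu> f"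
  by (auto simp: L1_def)

lemma norm1_nonneg [simp]: "norm1 \<mu> f \<ge> 0"
  by (simp add: norm1_def)

lemma norm1_scale: "norm1 \<mu> (\<lambda>x. c * f x) = cmod c * norm1 \<mu> f"
  by (simp add: norm1_def norm_mult)

lemma norm1_zero [simp]: "norm1 \<mu> (\<lambda>x. 0) = 0"
  by (simp add: norm1_def)

lemma norm1_cong_AE: "f \<in> L1 \<mu> \<Longrightarrow> g \<in> L1 \<mu> \<Longrightarrow> AE x in \<mu>. f x = g x \<Longrightarrow> norm1 \<mu> f = norm1 \<mu> g"
  unfolding norm1_def L1_def by (intro integral_cong_AE) auto

lemma norm1_mono: "f \<in> L1 \<mu> \<Longrightarrow> g \<in> L1 \<mu> \<Longrightarrow> (\<And>x. cmod (f x) \<le> cmod (g x)) \<Longrightarrow> norm1 \<mu> f \<le> norm1 \<mu> g"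
  unfolding norm1_def L1_def by (intro integral_mono) auto

lemma L1_add: "f \<in> L1 \<mu> \<Longrightarrow> g \<in> L1 \<mu> \<Longrightarrow> (\<lambda>x. f x + g x) \<in> L1 \<mu>"
  and L1_diff: "f \<in> L1 \<mu> \<Longrightarrow> g \<in> L1 \<mu> \<Longrightarrow> (\<lambda>x. f x - g x) \<in> L1 \<mu>"
  and L1_scale: "f \<in> L1 \<mu> \<Longrightarrow> (\<lambda>x. c * f x) \<in> L1 \<mu>"
  and L1_zero: "(\<lambda>x. 0) \<in> L1 \<mu>"
  by (auto simp: L1_def)

lemma norm1_triangle: "f \<in> L1 \<mu> \<Longrightarrow> g \<in> L1 \<mu> \<Longrightarrow> norm1 \<mu> (\<lambda>x. f x + g x) \<le> norm1 \<mu> f + norm1 \<mu> g"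
proof -
  assume fg: "f \<in> L1 \<mu>" "g \<in> L1 \<mu>"
  then have "norm1 \<mu> (\<lambda>x. f x + g x) \<le> (\<integral>x. cmod (f x) + cmod (g x) \<partial>\<mu>)"
    unfolding norm1_def L1_def by (intro integral_mono norm_triangle_ineq) auto
  then show ?thesis using fg by (simp add: norm1_def L1_def)
qed

lemma norm1_minus_commute: "norm1 \<mu> (\<lambda>x. f x - g x) = norm1 \<mu> (\<lambda>x. g x - f x)"
  by (simp add: norm1_def norm_minus_commute)

lemma norm1_triangle_diff:
  assumes "f \<in> L1 \<mu>" "g \<in> L1 \<mu>" "k \<in> L1 \<mu>"
  shows "norm1 \<mu> (\<lambda>x. f x - k x) \<le> norm1 \<mu> (\<lambda>x. f x - g x) + norm1 \<mu> (\<lambda>x. g x - k x)"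
  using norm1_triangle[OF L1_diff[OF assms(1,2)] L1_diff[OF assms(2,3)]] by simp

lemma nn_integral_norm1: "f \<in> L1 \<mu> \<Longrightarrow> (\<integral>\<^sup>+x. ennreal (cmod (f x)) \<partial>\<mu>) = ennreal (norm1 \<mu> f)"
  unfolding norm1_def L1_def by (intro nn_integral_eq_integral) auto

lemma norm1_le_nn_integral:
  assumes "f \<in> L1 \<mu>" "(\<integral>\<^sup>+x. ennreal (cmod (f x)) \<partial>\<mu>) \<le> ennreal r" "r \<ge> 0"
  shows "norm1 \<mu> f \<le> r"
  using assms nn_integral_norm1[OF assms(1)] by simp

lemma Linf_bound:
  assumes "h \<in> Linf \<mu>" "f \<in> L1 \<mu>"
  shows "cmod (h f) \<le> norm_inf \<mu> h * norm1 \<mu> f"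
  unfolding norm_inf_def using assms unfolding Linf_def
  by (intro cdual_norm_bound) (auto simp: norm1_scale L1_scale)

lemma norm_inf_nonneg: "h \<in> Linf \<mu> \<Longrightarrow> norm_inf \<mu> h \<ge> 0"
  unfolding norm_inf_def Linf_def by (rule dual_norm_nonneg[where v = "\<lambda>x. 0"]) (auto simp: L1_zero)

lemma norm_inf_least:
  "(\<And>f. f \<in> L1 \<mu> \<Longrightarrow> cmod (h f) \<le> B * norm1 \<mu> f) \<Longrightarrow> B \<ge> 0 \<Longrightarrow> norm_inf \<mu> h \<le> B"
  unfolding norm_inf_def by (rule dual_norm_least[where v = "\<lambda>x. 0"]) (auto simp: L1_zero)

lemma Linf_add: "h \<in> Linf \<mu> \<Longrightarrow> k \<in> Linf \<mu> \<Longrightarrow> (\<lambda>f. h f + k f) \<in> Linf \<mu>"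
  and Linf_scale: "h \<in> Linf \<mu> \<Longrightarrow> (\<lambda>f. c * h f) \<in> Linf \<mu>"
  unfolding Linf_def by (auto intro: cdual_closed_add cdual_closed_scale)

lemma Linf_diff: "h \<in> Linf \<mu> \<Longrightarrow> k \<in> Linf \<mu> \<Longrightarrow> (\<lambda>f. h f - k f) \<in> Linf \<mu>"
  using Linf_add[OF _ Linf_scale[of k \<mu> "-1"], of h] by simp

lemma Linf_zero: "(\<lambda>f. 0) \<in> Linf \<mu>"
  unfolding Linf_def by (rule cdualI[where C = 0]) auto

lemma Linf_plus: "h \<in> Linf \<mu> \<Longrightarrow> f \<in> L1 \<mu> \<Longrightarrow> g \<in> L1 \<mu> \<Longrightarrow> h (\<lambda>x. f x + g x) = h f + h g"
  and Linf_times: "h \<in> Linf \<mu> \<Longrightarrow> f \<in> L1 \<mu> \<Longrightarrow> h (\<lambda>x. c * f x) = c * h f"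
  unfolding Linf_def by (auto intro: cdual_add cdual_scale)

lemma Linf_minus:
  assumes "h \<in> Linf \<mu>" "f \<in> L1 \<mu>" "g \<in> L1 \<mu>"
  shows "h (\<lambda>x. f x - g x) = h f - h g"
  using Linf_plus[OF assms(1,2) L1_scale[OF assms(3), of "-1"]] Linf_times[OF assms(1,3), of "-1"] by simp

lemma Linf_outside: "h \<in> Linf \<mu> \<Longrightarrow> f \<notin> L1 \<mu> \<Longrightarrow> h f = 0"
  unfolding Linf_def by (rule cdual_outside)

lemma Linf_cong_AE:
  assumes "h \<in> Linf \<mu>" "f \<in> L1 \<mu>" "g \<in> L1 \<mu>" "AE x in \<mu>. f x = g x"
  shows "h f = h g"
proof -
  have "norm1 \<mu> (\<lambda>x. f x - g x) = norm1 \<mu> (\<lambda>x. 0)"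
    using assms by (intro norm1_cong_AE L1_diff L1_zero) auto
  then have "cmod (h (\<lambda>x. f x - g x)) \<le> 0" using Linf_bound[OF assms(1) L1_diff[OF assms(2,3)]] by simp
  then show ?thesis by (simp add: Linf_minus[OF assms(1-3)])
qed

lemma LinfI:
  assumes "\<And>f g. f \<in> L1 \<mu> \<Longrightarrow> g \<in> L1 \<mu> \<Longrightarrow> h (\<lambda>x. f x + g x) = h f + h g"
    and "\<And>c f. f \<in> L1 \<mu> \<Longrightarrow> h (\<lambda>x. c * f x) = c * h f"
    and "\<And>f. f \<in> L1 \<mu> \<Longrightarrow> cmod (h f) \<le> C * norm1 \<mu> f"
    and "\<And>f. f \<notin> L1 \<mu> \<Longrightarrow> h f = 0"
  shows "h \<in> Linf \<mu>"
  unfolding Linf_def using assms by (rule cdualI)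

text \<open>The factor 2 in the domination is the one that \<open>integrable_induct\<close> supplies
  for its approximating functions.\<close>

lemma norm1_dominated_convergence:
  assumes f: "f \<in> L1 \<mu>" and s: "\<And>i. s i \<in> L1 \<mu>"
    and lim: "AE x in \<mu>. (\<lambda>i. s i x) \<longlonglongrightarrow> f x" and dom: "\<And>i x. x \<in> space \<mu> \<Longrightarrow> cmod (s i x) \<le> 2 * cmod (f x)"
  shows "(\<lambda>i. norm1 \<mu> (\<lambda>x. f x - s i x)) \<longlonglongrightarrow> 0"
proof -
  have "(\<lambda>i. \<integral>x. cmod (f x - s i x) \<partial>\<mu>) \<longlonglongrightarrow> (\<integral>x. 0 \<partial>\<mu>)"
  proof (rule integral_dominated_convergence[where w = "\<lambda>x. 3 * cmod (f x)"])
    show "AE x in \<mu>. (\<lambda>i. cmod (f x - s i x)) \<longlonglongrightarrow> 0"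
      using lim
    proof eventually_elim
      case (elim x)
      from tendsto_norm[OF tendsto_diff[OF tendsto_const elim, of "f x"]] show ?case by simp
    qed
    show "AE x in \<mu>. norm (cmod (f x - s i x)) \<le> 3 * cmod (f x)" for i
    proof (rule AE_I2)
      fix x assume "x \<in> space \<mu>"
      then show "norm (cmod (f x - s i x)) \<le> 3 * cmod (f x)"
        using dom[of x i] norm_triangle_ineq4[of "f x" "s i x"] by simp
    qed
  qed (use f s in \<open>auto simp: L1_def\<close>)
  then show ?thesis by (simp add: norm1_def)
qed

section \<open>Convolution, right translation and normalised indicators\<close>

context haar
begin

lemma L1_borel: "f \<in> L1 \<mu> \<Longrightarrow> f \<in> borel_measurable borel"
  using borel_measurable_integrable[of \<mu> f] by (simp add: L1_def measurable_cong_sets[OF sets_eq refl])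

lemma L1_iff: "f \<in> L1 \<mu> \<longleftrightarrow> f \<in> borel_measurable borel \<and> (\<integral>\<^sup>+x. ennreal (cmod (f x)) \<partial>\<mu>) < \<infinity>"
  by (simp add: L1_def integrable_iff_bounded measurable_cong_sets[OF sets_eq refl])

lemma convolution_integrand_borel:
  fixes f g :: "'g \<Rightarrow> complex"
  assumes "f \<in> borel_measurable borel" "g \<in> borel_measurable borel"
  shows "(\<lambda>p. f (fst p) * g (- fst p + snd p)) \<in> borel_measurable borel"
proof -
  have bc: "\<psi> \<in> borel_measurable borel" if "continuous_on UNIV \<psi>" for \<psi> :: "'g \<times> 'g \<Rightarrow> 'g"
    using that by (rule borel_measurable_continuous_onI)
  show ?thesis
    by (intro borel_measurable_times measurable_compose[OF bc assms(1)] measurable_compose[OF bc assms(2)] continuous_intros)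
qed

text \<open>\<open>W n\<close> is the preimage of \<open>U n \<times> V n\<close> under the shear
  \<open>(y, x) \<mapsto> (y, - y + x)\<close>. Left invariance gives each section over
  \<open>y \<in> U n\<close> the measure of \<open>V n\<close>; the sections in the other direction
  lie in \<open>U n\<close>.\<close>

lemma convolution_support:
  assumes "f \<in> L1 \<mu>" "g \<in> L1 \<mu>"
  shows "\<exists>W :: nat \<Rightarrow> ('g \<times> 'g) set. (\<forall>n. finite_sections (W n)) \<and> incseq W \<and>
    (\<forall>p. p \<notin> (\<Union>n. W n) \<longrightarrow> f (fst p) * g (- fst p + snd p) = 0)"
proof -
  obtain U :: "nat \<Rightarrow> 'g set" where U: "\<And>n. open (U n)" "\<And>n. emeasure \<mu> (U n) < \<infinity>" "incseq U" "\<And>x. x \<notin> (\<Union>n. U n) \<Longrightarrow> f x = 0"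
    using integrable_open_support[OF L1D[OF assms(1)]] by blast
  obtain V :: "nat \<Rightarrow> 'g set" where V: "\<And>n. open (V n)" "\<And>n. emeasure \<mu> (V n) < \<infinity>" "incseq V" "\<And>x. x \<notin> (\<Union>n. V n) \<Longrightarrow> g x = 0"
    using integrable_open_support[OF L1D[OF assms(2)]] by blast
  define W where "W n = {p. fst p \<in> U n \<and> - fst p + snd p \<in> V n}" for n
  have "finite_sections (W n)" for n
    unfolding finite_sections_def
  proof (intro conjI allI)
    have "W n = fst -` U n \<inter> (\<lambda>p. - fst p + snd p) -` V n" by (auto simp: W_def)
    also have "open \<dots>" by (intro open_Int open_vimage U V continuous_intros)
    finally show "open (W n)" .
    have s: "emeasure \<mu> (Pair y -` W n) = emeasure \<mu> (V n) * indicator (U n) y" for y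
    proof (cases "y \<in> U n")
      case True
      then have "Pair y -` W n = (\<lambda>x. - y + x) -` V n" by (auto simp: W_def)
      then show ?thesis using True V by (simp add: emeasure_left)
    next
      case False
      then have "Pair y -` W n = {}" by (auto simp: W_def)
      then show ?thesis using False by simp
    qed
    show "emeasure \<mu> (Pair y -` W n) < \<infinity>" for y
      unfolding s using V by (auto simp: indicator_def)
    have "(\<integral>\<^sup>+y. emeasure \<mu> (Pair y -` W n) \<partial>\<mu>) = emeasure \<mu> (V n) * emeasure \<mu> (U n)"
      unfolding s using U by (intro nn_integral_cmult_indicator) auto
    then show "(\<integral>\<^sup>+y. emeasure \<mu> (Pair y -` W n) \<partial>\<mu>) < \<infinity>"
      using U(2)[of n] V(2)[of n] by (simp add: ennreal_mult_less_top)
    fix x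
    have "emeasure \<mu> ((\<lambda>y. (y, x)) -` W n) \<le> emeasure \<mu> (U n)"
      using U by (intro emeasure_mono) (auto simp: W_def)
    then show "emeasure \<mu> ((\<lambda>y. (y, x)) -` W n) < \<infinity>" using U(2)[of n] by (rule le_less_trans)
  qed
  moreover have "incseq W" using U(3) V(3) by (fastforce simp: incseq_def W_def)
  moreover have "f (fst p) * g (- fst p + snd p) = 0" if "p \<notin> (\<Union>n. W n)" for p
  proof (rule ccontr)
    assume "f (fst p) * g (- fst p + snd p) \<noteq> 0"
    then have "fst p \<in> (\<Union>n. U n)" "- fst p + snd p \<in> (\<Union>n. V n)" using U(4)[of "fst p"] V(4)[of "- fst p + snd p"] by auto
    then obtain i j where ij: "fst p \<in> U i" "- fst p + snd p \<in> V j" by auto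
    have "U i \<subseteq> U (max i j)" "V j \<subseteq> V (max i j)" using U(3) V(3) by (auto simp: incseq_def)
    then have "p \<in> W (max i j)" using ij by (auto simp: W_def)
    then show False using that by blast
  qed
  ultimately show ?thesis by blast
qed

lemma
  assumes f: "f \<in> L1 \<mu>" and g: "g \<in> L1 \<mu>"
  shows convolution_nn_borel: "(\<lambda>x. \<integral>\<^sup>+y. ennreal (cmod (f y * g (- y + x))) \<partial>\<mu>) \<in> borel_measurable borel" (is ?m)
    and convolution_nn_integral: "(\<integral>\<^sup>+x. \<integral>\<^sup>+y. ennreal (cmod (f y * g (- y + x))) \<partial>\<mu> \<partial>\<mu>) = ennreal (norm1 \<mu> f * norm1 \<mu> g)" (is ?i)
    and convolution_borel: "convolution \<mu> f g \<in> borel_measurable borel" (is ?b)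
proof -
  obtain W :: "nat \<Rightarrow> ('g \<times> 'g) set" where W: "\<And>n. finite_sections (W n)" "incseq W"
    and W0: "\<And>p. p \<notin> (\<Union>n. W n) \<Longrightarrow> f (fst p) * g (- fst p + snd p) = 0"
    using convolution_support[OF f g] by blast
  define F where "F p = f (fst p) * g (- fst p + snd p)" for p :: "'g \<times> 'g"
  have Fm[measurable]: "F \<in> borel_measurable borel" unfolding F_def by (intro convolution_integrand_borel L1_borel f g)
  note [measurable] = L1_borel[OF f] L1_borel[OF g] borel_left
  have m: "(\<lambda>p. ennreal (cmod (F p))) \<in> borel_measurable borel" by measurable
  have z: "ennreal (cmod (F p)) = 0" if "p \<notin> (\<Union>n. W n)" for p using W0[OF that] by (simp add: F_def)
  show M: ?m using tonelli_measurable[OF W m z] by (simp add: F_def)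
  have "(\<integral>\<^sup>+x. \<integral>\<^sup>+y. ennreal (cmod (f y * g (- y + x))) \<partial>\<mu> \<partial>\<mu>) = (\<integral>\<^sup>+y. \<integral>\<^sup>+x. ennreal (cmod (f y * g (- y + x))) \<partial>\<mu> \<partial>\<mu>)"
    using tonelli[OF W m z] by (simp add: F_def)
  also have "\<dots> = (\<integral>\<^sup>+y. ennreal (cmod (f y)) * ennreal (norm1 \<mu> g) \<partial>\<mu>)"
  proof (rule nn_integral_cong)
    fix y
    have "(\<integral>\<^sup>+x. ennreal (cmod (f y * g (- y + x))) \<partial>\<mu>) = (\<integral>\<^sup>+x. ennreal (cmod (f y)) * ennreal (cmod (g (- y + x))) \<partial>\<mu>)"
      by (simp add: norm_mult ennreal_mult)
    also have "\<dots> = ennreal (cmod (f y)) * (\<integral>\<^sup>+x. ennreal (cmod (g (- y + x))) \<partial>\<mu>)"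
      by (rule nn_integral_cmult) measurable
    also have "(\<integral>\<^sup>+x. ennreal (cmod (g (- y + x))) \<partial>\<mu>) = (\<integral>\<^sup>+x. ennreal (cmod (g x)) \<partial>\<mu>)"
      by (rule nn_integral_left[where f = "\<lambda>x. ennreal (cmod (g x))"]) measurable
    finally show "(\<integral>\<^sup>+x. ennreal (cmod (f y * g (- y + x))) \<partial>\<mu>) = ennreal (cmod (f y)) * ennreal (norm1 \<mu> g)"
      by (simp add: nn_integral_norm1[OF g])
  qed
  also have "\<dots> = (\<integral>\<^sup>+y. ennreal (cmod (f y)) \<partial>\<mu>) * ennreal (norm1 \<mu> g)"
    by (rule nn_integral_multc) measurable
  finally show ?i by (simp add: nn_integral_norm1[OF f] ennreal_mult)
  have m1: "(\<lambda>p. ennreal (Re (F p))) \<in> borel_measurable borel" "(\<lambda>p. ennreal (- Re (F p))) \<in> borel_measurable borel"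
      "(\<lambda>p. ennreal (Im (F p))) \<in> borel_measurable borel" "(\<lambda>p. ennreal (- Im (F p))) \<in> borel_measurable borel"
    by measurable
  have z1: "ennreal (Re (F p)) = 0" "ennreal (- Re (F p)) = 0" "ennreal (Im (F p)) = 0" "ennreal (- Im (F p)) = 0"
    if "p \<notin> (\<Union>n. W n)" for p using W0[OF that, folded F_def] by simp_all
  note [measurable] = tonelli_measurable[OF W m z] tonelli_measurable[OF W m1(1) z1(1)] tonelli_measurable[OF W m1(2) z1(2)]
     tonelli_measurable[OF W m1(3) z1(3)] tonelli_measurable[OF W m1(4) z1(4)]
  define N where "N x = (\<integral>\<^sup>+y. ennreal (cmod (F (y, x))) \<partial>\<mu>)" for x
  define R where "R x = enn2real (\<integral>\<^sup>+y. ennreal (Re (F (y, x))) \<partial>\<mu>) - enn2real (\<integral>\<^sup>+y. ennreal (- Re (F (y, x))) \<partial>\<mu>)" for x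
  define I where "I x = enn2real (\<integral>\<^sup>+y. ennreal (Im (F (y, x))) \<partial>\<mu>) - enn2real (\<integral>\<^sup>+y. ennreal (- Im (F (y, x))) \<partial>\<mu>)" for x
  have Nm: "N \<in> borel_measurable borel" and [measurable]: "R \<in> borel_measurable borel" "I \<in> borel_measurable borel"
    unfolding N_def R_def I_def by measurable
  \<comment> \<open>The Bochner integral is 0 by default where the integrand is not integrable.
    Writing the convolution through four nonnegative integrals where \<open>N x\<close> is finite,
    and as 0 elsewhere, reduces its measurability to that of the section integrals in Tonelli's
    theorem.\<close>
  have "convolution \<mu> f g = (\<lambda>x. if N x < \<infinity> then complex_of_real (R x) + \<i> * complex_of_real (I x) else 0)"
  proof
    fix x
    have mx: "(\<lambda>y. F (y, x)) \<in> borel_measurable \<mu>"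
      using section_measurable2[OF Fm] by (simp add: measurable_cong_sets[OF sets_eq refl])
    have c: "convolution \<mu> f g x = (\<integral>y. F (y, x) \<partial>\<mu>)" by (simp add: convolution_def F_def)
    show "convolution \<mu> f g x = (if N x < \<infinity> then complex_of_real (R x) + \<i> * complex_of_real (I x) else 0)"
    proof (cases "N x < \<infinity>")
      case True
      then have int: "integrable \<mu> (\<lambda>y. F (y, x))" using mx by (simp add: integrable_iff_bounded N_def)
      have "(\<integral>y. Re (F (y, x)) \<partial>\<mu>) = R x" "(\<integral>y. Im (F (y, x)) \<partial>\<mu>) = I x"
        unfolding R_def I_def
        by (rule real_lebesgue_integral_def[OF integrable_Re[OF int]], rule real_lebesgue_integral_def[OF integrable_Im[OF int]])
      then have "Re (\<integral>y. F (y, x) \<partial>\<mu>) = R x" "Im (\<integral>y. F (y, x) \<partial>\<mu>) = I x"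
        using int by simp_all
      then show ?thesis using True unfolding c by (simp add: complex_eq_iff)
    next
      case False
      then have "\<not> integrable \<mu> (\<lambda>y. F (y, x))" using mx by (simp add: integrable_iff_bounded N_def)
      then show ?thesis unfolding c using False by (simp add: not_integrable_integral_eq)
    qed
  qed
  then show ?b using Nm by simp
qed

lemma convolution_norm_le:
  assumes f: "f \<in> L1 \<mu>" and g: "g \<in> L1 \<mu>"
  shows "ennreal (cmod (convolution \<mu> f g x)) \<le> (\<integral>\<^sup>+y. ennreal (cmod (f y * g (- y + x))) \<partial>\<mu>)"
proof (cases "integrable \<mu> (\<lambda>y. f y * g (- y + x))")
  case True
  then show ?thesis unfolding convolution_def by (rule integral_norm_bound_ennreal)
qed (simp add: convolution_def not_integrable_integral_eq)

lemma convolution_L1: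
  assumes f: "f \<in> L1 \<mu>" and g: "g \<in> L1 \<mu>"
  shows "convolution \<mu> f g \<in> L1 \<mu>"
    and "norm1 \<mu> (convolution \<mu> f g) \<le> norm1 \<mu> f * norm1 \<mu> g"
proof -
  have le: "(\<integral>\<^sup>+x. ennreal (cmod (convolution \<mu> f g x)) \<partial>\<mu>) \<le> ennreal (norm1 \<mu> f * norm1 \<mu> g)"
    unfolding convolution_nn_integral[OF f g, symmetric] by (intro nn_integral_mono convolution_norm_le f g)
  then show *: "convolution \<mu> f g \<in> L1 \<mu>"
    unfolding L1_iff using convolution_borel[OF f g] le_less_trans[OF le ennreal_less_top] by simp
  show "norm1 \<mu> (convolution \<mu> f g) \<le> norm1 \<mu> f * norm1 \<mu> g"
    by (rule norm1_le_nn_integral[OF * le]) simp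
qed

lemma convolution_AE_integrable:
  assumes f: "f \<in> L1 \<mu>" and g: "g \<in> L1 \<mu>"
  shows "AE x in \<mu>. integrable \<mu> (\<lambda>y. f y * g (- y + x))"
proof -
  have "AE x in \<mu>. (\<integral>\<^sup>+y. ennreal (cmod (f y * g (- y + x))) \<partial>\<mu>) \<noteq> \<infinity>"
    using convolution_nn_integral[OF f g] convolution_nn_borel[OF f g]
    by (intro nn_integral_noteq_infinite) (auto simp: measurable_cong_sets[OF sets_eq refl])
  then show ?thesis
  proof eventually_elim
    case (elim x)
    have "(\<lambda>y. f y * g (- y + x)) \<in> borel_measurable \<mu>"
      using section_measurable2[OF convolution_integrand_borel[OF L1_borel[OF f] L1_borel[OF g]], of x]
      by (simp add: measurable_cong_sets[OF sets_eq refl])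
    then show ?case using elim by (simp add: integrable_iff_bounded less_top)
  qed
qed

lemma convolution_add_right:
  assumes "f \<in> L1 \<mu>" "g \<in> L1 \<mu>" "k \<in> L1 \<mu>"
  shows "AE x in \<mu>. convolution \<mu> f (\<lambda>y. g y + k y) x = convolution \<mu> f g x + convolution \<mu> f k x"
  using convolution_AE_integrable[OF assms(1,2)] convolution_AE_integrable[OF assms(1,3)]
  by eventually_elim (simp add: convolution_def distrib_left)

lemma convolution_add_left:
  assumes "f \<in> L1 \<mu>" "g \<in> L1 \<mu>" "k \<in> L1 \<mu>"
  shows "AE x in \<mu>. convolution \<mu> (\<lambda>y. f y + g y) k x = convolution \<mu> f k x + convolution \<mu> g k x"
  using convolution_AE_integrable[OF assms(1,3)] convolution_AE_integrable[OF assms(2,3)]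
  by eventually_elim (simp add: convolution_def distrib_right)

lemma convolution_scale_right: "convolution \<mu> f (\<lambda>y. c * g y) = (\<lambda>x. c * convolution \<mu> f g x)"
  unfolding convolution_def by (simp add: mult.left_commute[of _ c])

lemma convolution_scale_left: "convolution \<mu> (\<lambda>y. c * f y) g = (\<lambda>x. c * convolution \<mu> f g x)"
  unfolding convolution_def by (simp add: mult.assoc)

lemma arens1_hf_Linf:
  assumes h: "h \<in> Linf \<mu>" and f: "f \<in> L1 \<mu>"
  shows "arens1_hf \<mu> h f \<in> Linf \<mu>"
proof (rule LinfI)
  fix g k assume gk: "g \<in> L1 \<mu>" "k \<in> L1 \<mu>"
  \<comment> \<open>Because of the default value of non-existing integrals, convolution is additive
    only almost everywhere; \<open>h\<close> does not see null sets.\<close>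
  have "h (convolution \<mu> f (\<lambda>x. g x + k x)) = h (\<lambda>x. convolution \<mu> f g x + convolution \<mu> f k x)"
    using convolution_add_right[OF f gk] by (intro Linf_cong_AE[OF h] convolution_L1 L1_add f gk)
  also have "\<dots> = h (convolution \<mu> f g) + h (convolution \<mu> f k)"
    by (intro Linf_plus[OF h] convolution_L1 f gk)
  finally show "arens1_hf \<mu> h f (\<lambda>x. g x + k x) = arens1_hf \<mu> h f g + arens1_hf \<mu> h f k"
    using gk by (simp add: arens1_hf_def L1_add)
next
  fix c g assume g: "g \<in> L1 \<mu>"
  then show "arens1_hf \<mu> h f (\<lambda>x. c * g x) = c * arens1_hf \<mu> h f g"
    by (simp add: arens1_hf_def L1_scale convolution_scale_right Linf_times[OF h convolution_L1(1)[OF f g]])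
next
  fix g assume g: "g \<in> L1 \<mu>"
  have "cmod (h (convolution \<mu> f g)) \<le> norm_inf \<mu> h * norm1 \<mu> (convolution \<mu> f g)"
    by (intro Linf_bound h convolution_L1 f g)
  also have "\<dots> \<le> norm_inf \<mu> h * (norm1 \<mu> f * norm1 \<mu> g)"
    by (intro mult_left_mono convolution_L1 f g norm_inf_nonneg h)
  finally show "cmod (arens1_hf \<mu> h f g) \<le> (norm_inf \<mu> h * norm1 \<mu> f) * norm1 \<mu> g"
    using g by (simp add: arens1_hf_def mult.assoc)
qed (simp add: arens1_hf_def)

text \<open>Dividing by the modular factor makes right translation isometric for
  \<open>norm1\<close>.\<close>

definition rtrans :: "'g \<Rightarrow> ('g \<Rightarrow> complex) \<Rightarrow> 'g \<Rightarrow> complex" where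
  "rtrans a f = (\<lambda>y. f (y + a) / of_real (modular a))"

lemma rtrans_L1:
  assumes "f \<in> L1 \<mu>"
  shows "rtrans a f \<in> L1 \<mu>" and "norm1 \<mu> (rtrans a f) = norm1 \<mu> f"
proof -
  note [measurable] = L1_borel[OF assms] borel_right
  have "(\<integral>\<^sup>+y. ennreal (cmod (rtrans a f y)) \<partial>\<mu>) = (\<integral>\<^sup>+y. ennreal (cmod (f (y + a)) / modular a) \<partial>\<mu>)"
    using modular_pos[of a] by (simp add: rtrans_def norm_divide)
  also have "\<dots> = ennreal (modular a) * (\<integral>\<^sup>+y. ennreal (cmod (f y) / modular a) \<partial>\<mu>)"
    by (rule nn_integral_right[where f = "\<lambda>y. ennreal (cmod (f y) / modular a)"]) measurable
  also have "\<dots> = (\<integral>\<^sup>+y. ennreal (modular a) * ennreal (cmod (f y) / modular a) \<partial>\<mu>)"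
    by (rule nn_integral_cmult[symmetric]) measurable
  also have "\<dots> = (\<integral>\<^sup>+y. ennreal (cmod (f y)) \<partial>\<mu>)"
    using modular_pos[of a] by (intro nn_integral_cong) (simp add: ennreal_mult[symmetric])
  finally have e: "(\<integral>\<^sup>+y. ennreal (cmod (rtrans a f y)) \<partial>\<mu>) = (\<integral>\<^sup>+y. ennreal (cmod (f y)) \<partial>\<mu>)" .
  have "rtrans a f \<in> borel_measurable borel" unfolding rtrans_def by measurable
  then show *: "rtrans a f \<in> L1 \<mu>" using e assms unfolding L1_iff by simp
  show "norm1 \<mu> (rtrans a f) = norm1 \<mu> f"
    using e unfolding nn_integral_norm1[OF *] nn_integral_norm1[OF assms] by simp
qed

lemma modular_inverse: "modular a * modular (- a) = 1"
proof -
  obtain V K where V: "open V" "compact K" "(0::'g) \<in> V" "V \<subseteq> K" using locally_compact by auto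
  have p: "emeasure \<mu> V > 0" using V by (intro open_positive) auto
  have "emeasure \<mu> V \<le> emeasure \<mu> K" using V by (intro emeasure_mono) auto
  then have f: "emeasure \<mu> V < \<infinity>" using compact_finite[OF V(2)] by (rule le_less_trans)
  have "(\<lambda>z. z + (- a)) -` ((\<lambda>z. z + a) -` V) = V" by (auto simp: add.assoc)
  then have "emeasure \<mu> V = ennreal (modular (- a)) * (ennreal (modular a) * emeasure \<mu> V)"
    using emeasure_right[OF vimage_right_borel[of V a], of "- a"] emeasure_right[of V a] V(1) by simp
  then have "ennreal 1 * emeasure \<mu> V = ennreal (modular a * modular (- a)) * emeasure \<mu> V"
    using modular_pos[of a] modular_pos[of "- a"] by (simp add: ennreal_mult mult_ac)
  then have "ennreal 1 = ennreal (modular a * modular (- a))"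
    using p f by (metis ennreal_mult_divide_eq infinity_ennreal_def less_irrefl)
  then show ?thesis using modular_pos[of a] modular_pos[of "- a"] by (simp add: ennreal_1[symmetric] del: ennreal_1)
qed

lemma convolution_rtrans: "convolution \<mu> f (rtrans a g) = rtrans a (convolution \<mu> f g)"
  unfolding convolution_def rtrans_def by (simp add: add.assoc)

text \<open>Symmetry turns \<open>- y + x \<in> V\<close> into \<open>- x + y \<in> V\<close>, a
  left translate of \<open>V\<close> as a condition on \<open>y\<close>, so that left invariance
  bounds convolutions with the normalised indicator. Lying in a compact set gives finite
  measure.\<close>

definition nbhd :: "'g set \<Rightarrow> bool" where
  "nbhd V \<longleftrightarrow> open V \<and> 0 \<in> V \<and> (\<forall>v\<in>V. - v \<in> V) \<and> (\<exists>K. compact K \<and> V \<subseteq> K)"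

definition bump :: "'g set \<Rightarrow> 'g \<Rightarrow> complex" where
  "bump V = (\<lambda>x. of_real (indicator V x / measure \<mu> V))"

lemma nbhd_exists:
  assumes "open U" "0 \<in> U"
  shows "\<exists>V. nbhd V \<and> V \<subseteq> U"
proof -
  obtain V K where V: "open V" "compact K" "(0::'g) \<in> V" "V \<subseteq> K" using locally_compact by auto
  define W where "W = (V \<inter> U) \<inter> uminus -` (V \<inter> U)"
  have "open W" unfolding W_def by (intro open_Int open_vimage V assms continuous_intros)
  then have "nbhd W" unfolding nbhd_def using V assms by (auto simp: W_def)
  then show ?thesis by (intro exI[of _ W]) (auto simp: W_def)
qed

lemma nbhd_measure:
  assumes "nbhd V"
  shows "emeasure \<mu> V = ennreal (measure \<mu> V)" and "measure \<mu> V > 0"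
proof -
  obtain K where K: "compact K" "V \<subseteq> K" and V: "open V" "0 \<in> V" using assms by (auto simp: nbhd_def)
  have "emeasure \<mu> V \<le> emeasure \<mu> K" using K by (intro emeasure_mono) auto
  then have f: "emeasure \<mu> V < \<infinity>" using compact_finite[OF K(1)] by (rule le_less_trans)
  then show e: "emeasure \<mu> V = ennreal (measure \<mu> V)" by (simp add: emeasure_eq_ennreal_measure)
  have "emeasure \<mu> V > 0" using V by (intro open_positive) auto
  then show "measure \<mu> V > 0" using e by simp
qed

lemma indicator_L1: "A \<in> sets borel \<Longrightarrow> emeasure \<mu> A < \<infinity> \<Longrightarrow> (\<lambda>x. of_real (indicator A x)) \<in> L1 \<mu>"
  and norm1_indicator: "A \<in> sets borel \<Longrightarrow> norm1 \<mu> (\<lambda>x. of_real (indicator A x)) = measure \<mu> A"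
  by (auto simp: L1_def norm1_def sets_eq)

lemma bump_L1:
  assumes "nbhd V"
  shows "bump V \<in> L1 \<mu>" and "norm1 \<mu> (bump V) = 1"
proof -
  have "open V" using assms by (auto simp: nbhd_def)
  have b: "bump V = (\<lambda>x. of_real (1 / measure \<mu> V) * of_real (indicator V x))" by (auto simp: bump_def)
  have *: "(\<lambda>x. of_real (indicator V x)) \<in> L1 \<mu>" using nbhd_measure[OF assms] \<open>open V\<close> by (intro indicator_L1) auto
  show "bump V \<in> L1 \<mu>" unfolding b by (intro L1_scale *)
  show "norm1 \<mu> (bump V) = 1" unfolding b norm1_scale
    using \<open>open V\<close> nbhd_measure[OF assms] by (simp add: norm1_indicator norm_divide)
qed

lemma compact_plus_nbhd:
  assumes "compact K" "open U" "K \<subseteq> (U :: 'g set)"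
  shows "\<exists>W. open W \<and> 0 \<in> W \<and> (\<forall>k\<in>K. \<forall>w\<in>W. k + w \<in> U)"
proof -
  have "open ((\<lambda>p. snd p + fst p) -` U)" by (intro open_vimage assms continuous_intros)
  moreover have "{0} \<times> K \<subseteq> (\<lambda>p. snd p + fst p) -` U" using assms(3) by auto
  ultimately obtain W where
    "0 \<in> W" "open W" "W \<times> K \<subseteq> (\<lambda>p. snd p + fst p) -` U"
    using Elementary_Topology.tube_lemma[OF assms(1), of "(\<lambda>p. snd p + fst p) -` U" 0] by auto
  then show ?thesis by (intro exI[of _ W]) auto
qed

text \<open>
  The convolution has the same integral as the indicator of \<open>K\<close> and lies between \<open>0\<close> and the
  indicator of \<open>U\<close>, which makes the distance computable without uniform continuity.
\<close>
lemma bump_convolution_indicator: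
  assumes K: "compact K" and U: "open U" "K \<subseteq> U" "emeasure \<mu> U < \<infinity>"
    and V: "nbhd V" "\<forall>k\<in>K. \<forall>w\<in>V. k + w \<in> U"
  shows "norm1 \<mu> (\<lambda>x. of_real (indicator U x) - convolution \<mu> (\<lambda>x. of_real (indicator K x)) (bump V) x) = measure \<mu> U - measure \<mu> K"
proof -
  define f :: "'g \<Rightarrow> complex" where "f = (\<lambda>x. of_real (indicator K x))"
  have f: "f \<in> L1 \<mu>" unfolding f_def using K compact_finite[OF K] by (intro indicator_L1) (auto simp: compact_imp_closed)
  define r where "r x = (\<integral>y. indicator K y * (indicator V (- y + x) / measure \<mu> V) \<partial>\<mu>)" for x
  have c: "convolution \<mu> f (bump V) x = of_real (r x)" for x
    unfolding convolution_def f_def bump_def r_def by (simp flip: integral_of_real of_real_mult)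
  have Vo: "open V" and Vs: "\<And>v. v \<in> V \<Longrightarrow> - v \<in> V" using V by (auto simp: nbhd_def)
  have mV: "measure \<mu> V > 0" "emeasure \<mu> V = ennreal (measure \<mu> V)" using nbhd_measure[OF V(1)] by auto
  have r0: "r x \<ge> 0" for x unfolding r_def by (intro Bochner_Integration.integral_nonneg) auto
  have r1: "r x \<le> 1" for x
  proof -
    have i: "integrable \<mu> (\<lambda>y. indicator ((\<lambda>y. - x + y) -` V) y / measure \<mu> V)"
      using Vo mV vimage_left_borel[of V "- x"] emeasure_left[of V "- x"]
      by (intro integrable_divide integrable_real_indicator) (simp_all add: sets_eq)
    have le: "indicator K y * (indicator V (- y + x) / measure \<mu> V) \<le> indicator ((\<lambda>y. - x + y) -` V) y / measure \<mu> V" for y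
    proof (cases "- y + x \<in> V")
      case True
      then have "- x + y \<in> V" using Vs[OF True] by (simp add: minus_add)
      then show ?thesis using mV by (simp add: indicator_def)
    qed (use mV in simp)
    have "r x \<le> (\<integral>y. indicator ((\<lambda>y. - x + y) -` V) y / measure \<mu> V \<partial>\<mu>)"
      unfolding r_def by (rule Bochner_Integration.integral_mono'[OF i le]) (use mV in auto)
    also have "\<dots> = measure \<mu> ((\<lambda>y. - x + y) -` V) / measure \<mu> V" by simp
    also have "measure \<mu> ((\<lambda>y. - x + y) -` V) = measure \<mu> V"
      using Vo by (simp add: measure_def emeasure_left)
    also have "measure \<mu> V / measure \<mu> V = 1" using mV by simp
    finally show ?thesis .
  qed
  have rU: "r x = 0" if "x \<notin> U" for x
  proof -
    have z: "indicator K y * (indicator V (- y + x) / measure \<mu> V) = 0" for y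
    proof (rule ccontr)
      assume "indicator K y * (indicator V (- y + x) / measure \<mu> V) \<noteq> 0"
      then have "y \<in> K" "- y + x \<in> V" by (auto simp: indicator_def split: if_splits)
      then have "y + (- y + x) \<in> U" using V by blast
      then show False using that by (simp add: add.assoc[symmetric])
    qed
    show ?thesis unfolding r_def z by simp
  qed
  have cL: "convolution \<mu> f (bump V) \<in> L1 \<mu>" by (intro convolution_L1 f bump_L1 V)
  then have rint: "integrable \<mu> r"
    using integrable_Re[OF L1D[OF cL]] by (simp add: c)
  have "(\<integral>\<^sup>+x. ennreal (r x) \<partial>\<mu>) = (\<integral>\<^sup>+x. \<integral>\<^sup>+y. ennreal (cmod (f y * bump V (- y + x))) \<partial>\<mu> \<partial>\<mu>)"
  proof (intro nn_integral_cong_AE)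
    show "AE x in \<mu>. ennreal (r x) = (\<integral>\<^sup>+y. ennreal (cmod (f y * bump V (- y + x))) \<partial>\<mu>)"
      using convolution_AE_integrable[OF f bump_L1(1)[OF V(1)]]
    proof eventually_elim
      case (elim x)
      have e: "cmod (f y * bump V (- y + x)) = indicator K y * (indicator V (- y + x) / measure \<mu> V)" for y
        using mV by (simp add: f_def bump_def norm_mult norm_divide)
      have "integrable \<mu> (\<lambda>y. cmod (f y * bump V (- y + x)))" using elim by (rule integrable_norm)
      then show ?case unfolding r_def e[symmetric] by (intro nn_integral_eq_integral[symmetric]) auto
    qed
  qed
  also have "\<dots> = ennreal (measure \<mu> K)"
    unfolding convolution_nn_integral[OF f bump_L1(1)[OF V(1)]] bump_L1(2)[OF V(1)]
    unfolding f_def using K by (subst norm1_indicator) (auto simp: compact_imp_closed)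
  finally have "(\<integral>x. r x \<partial>\<mu>) = measure \<mu> K"
    using r0 rint by (simp add: nn_integral_eq_integral Bochner_Integration.integral_nonneg)
  moreover have "norm1 \<mu> (\<lambda>x. of_real (indicator U x) - convolution \<mu> f (bump V) x) = (\<integral>x. indicator U x - r x \<partial>\<mu>)"
    unfolding norm1_def c
  proof (rule Bochner_Integration.integral_cong)
    fix x
    show "cmod (of_real (indicator U x) - of_real (r x)) = indicator U x - r x"
      unfolding of_real_diff[symmetric] norm_of_real using r0[of x] r1[of x] rU[of x] by (auto simp: indicator_def)
  qed simp
  moreover have "(\<integral>x. indicator U x - r x \<partial>\<mu>) = measure \<mu> U - (\<integral>x. r x \<partial>\<mu>)"
    using U rint by (subst Bochner_Integration.integral_diff) auto
  ultimately show ?thesis unfolding f_def by simp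
qed

end

text \<open>Tychonoff's theorem: the functionals lie in a product of closed discs, compact for
  pointwise convergence. The finer filter \<open>H\<close> plays the role of a subnet, and it gives
  convergence at every argument at once.\<close>

lemma cluster_functional:
  fixes \<phi> :: "'i \<Rightarrow> 'u \<Rightarrow> complex"
  assumes "F \<noteq> bot" and B: "\<And>i u. cmod (\<phi> i u) \<le> B u"
  obtains H n where "H \<noteq> bot" "H \<le> F" "\<And>u. ((\<lambda>i. \<phi> i u) \<longlongrightarrow> n u) H"
proof -
  define K where "K = PiE UNIV (\<lambda>u. cball (0::complex) (B u))"
  have "compactin (product_topology (\<lambda>u. euclidean) UNIV) K"
    unfolding K_def compactin_PiE by (simp add: compactin_euclidean_iff)
  then have "compact K" by (simp add: euclidean_product_topology compactin_euclidean_iff)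
  moreover have "filtermap \<phi> F \<noteq> bot" using assms(1) by (simp add: filtermap_bot_iff)
  moreover have "eventually (\<lambda>x. x \<in> K) (filtermap \<phi> F)"
    unfolding eventually_filtermap K_def by (intro always_eventually allI PiE_I) (simp_all add: B)
  ultimately obtain n where n: "inf (nhds n) (filtermap \<phi> F) \<noteq> bot"
    unfolding compact_filter by blast
  define H where "H = inf F (filtercomap \<phi> (nhds n))"
  have "H \<noteq> bot"
  proof
    assume "H = bot"
    then have "eventually (\<lambda>_. False) (inf F (filtercomap \<phi> (nhds n)))" by (simp add: H_def)
    then obtain P Q where P: "eventually P F" and Q: "eventually Q (filtercomap \<phi> (nhds n))" and PQ: "\<And>x. P x \<Longrightarrow> Q x \<Longrightarrow> False"
      unfolding eventually_inf by blast
    obtain R where R: "eventually R (nhds n)" "\<And>x. R (\<phi> x) \<Longrightarrow> Q x"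
      using Q unfolding eventually_filtercomap by blast
    have "eventually (\<lambda>y. \<not> R y) (filtermap \<phi> F)"
      unfolding eventually_filtermap using P by (rule eventually_mono) (use R PQ in blast)
    with R(1) have "eventually (\<lambda>_. False) (inf (nhds n) (filtermap \<phi> F))"
      unfolding eventually_inf by blast
    then show False using n by (simp add: eventually_False)
  qed
  moreover have "H \<le> F" by (simp add: H_def)
  moreover have "((\<lambda>i. \<phi> i u) \<longlongrightarrow> n u) H" for u
  proof -
    have lim: "filterlim \<phi> (nhds n) H"
      by (rule filterlim_mono[OF filterlim_filtercomap order_refl]) (simp add: H_def)
    show ?thesis
    proof (intro topological_tendstoI)
      fix W :: "complex set" assume "open W" "n u \<in> W"
      then have "open ((\<lambda>x. x u) -` W)" by (intro open_vimage continuous_on_product_coordinates)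
      from topological_tendstoD[OF lim this] show "\<forall>\<^sub>F i in H. \<phi> i u \<in> W" using \<open>n u \<in> W\<close> by simp
    qed
  qed
  ultimately show thesis using that by blast
qed

lemma topspace_weak_star: "V \<noteq> {} \<Longrightarrow> topspace (weak_star V p) = cdual V p"
  unfolding weak_star_def topspace_def
  by (auto simp: openin_topology_generated_by_iff[symmetric] topology_generated_by_topspace[unfolded topspace_def])

text \<open>Induction on the generation of open sets: a subbasic set expresses convergence at one
  argument, and containing the \<open>\<theta> i\<close> eventually passes on to finite
  intersections and to unions.\<close>

lemma weak_star_closure_limit:
  assumes V: "V \<noteq> {}" and \<psi>: "\<psi> \<in> cdual V p" and "F \<noteq> bot"
    and lim: "\<And>u. u \<in> V \<Longrightarrow> ((\<lambda>i. \<theta> i u) \<longlongrightarrow> \<psi> u) F"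
    and \<theta>: "\<And>i. \<theta> i \<in> weak_star V p closure_of S"
  shows "\<psi> \<in> weak_star V p closure_of S"
proof -
  have \<theta>d: "\<theta> i \<in> cdual V p" for i
    using \<theta>[of i] closure_of_subset_topspace[of "weak_star V p" S] topspace_weak_star[OF V, of p] by auto
  have ev: "\<psi> \<in> T \<longrightarrow> eventually (\<lambda>i. \<theta> i \<in> T) F" if "openin (weak_star V p) T" for T
  proof -
    have "generate_topology_on {{\<phi> \<in> cdual V p. \<phi> u \<in> W} |u W. u \<in> V \<and> open W} T"
      using that unfolding weak_star_def by (simp add: openin_topology_generated_by_iff)
    then show ?thesis
    proof induction
      case (Int a b)
      then show ?case by (auto intro: eventually_conj)
    next
      case (UN K)
      show ?case
      proof
        assume "\<psi> \<in> \<Union>K"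
        then obtain k where "k \<in> K" "\<psi> \<in> k" by auto
        then have "eventually (\<lambda>i. \<theta> i \<in> k) F" using UN by auto
        then show "eventually (\<lambda>i. \<theta> i \<in> \<Union>K) F" by (rule eventually_mono) (use \<open>k \<in> K\<close> in auto)
      qed
    next
      case (Basis s)
      then obtain u W where s: "s = {\<phi> \<in> cdual V p. \<phi> u \<in> W}" "u \<in> V" "open W" by auto
      show ?case
      proof
        assume "\<psi> \<in> s"
        then have "eventually (\<lambda>i. \<theta> i u \<in> W) F" using s by (intro topological_tendstoD[OF lim]) auto
        then show "eventually (\<lambda>i. \<theta> i \<in> s) F" by (rule eventually_mono) (use s \<theta>d in auto)
      qed
    qed simp
  qed
  show ?thesis
    unfolding in_closure_of topspace_weak_star[OF V]
  proof (intro conjI allI impI \<psi>)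
    fix T assume T: "\<psi> \<in> T \<and> openin (weak_star V p) T"
    then have "eventually (\<lambda>i. \<theta> i \<in> T) F" using ev by blast
    then obtain i where "\<theta> i \<in> T" using \<open>F \<noteq> bot\<close> eventually_happens' by blast
    then show "\<exists>y. y \<in> S \<and> y \<in> T" using \<theta>[of i] T unfolding in_closure_of by blast
  qed
qed

section \<open>The right approximate identity and smeared point masses\<close>

context haar
begin

lemma convolution_diff_norm:
  assumes "f \<in> L1 \<mu>" "g \<in> L1 \<mu>" "k \<in> L1 \<mu>"
  shows "norm1 \<mu> (\<lambda>x. convolution \<mu> f k x - convolution \<mu> g k x) \<le> norm1 \<mu> (\<lambda>x. f x - g x) * norm1 \<mu> k"
proof -
  have d: "(\<lambda>x. f x - g x) \<in> L1 \<mu>" by (intro L1_diff assms)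
  have "AE x in \<mu>. convolution \<mu> f k x = convolution \<mu> (\<lambda>x. f x - g x) k x + convolution \<mu> g k x"
    using convolution_add_left[OF d assms(2,3)] by simp
  then have "norm1 \<mu> (\<lambda>x. convolution \<mu> f k x - convolution \<mu> g k x) = norm1 \<mu> (convolution \<mu> (\<lambda>x. f x - g x) k)"
    by (intro norm1_cong_AE L1_diff convolution_L1 assms) auto
  then show ?thesis using convolution_L1(2)[OF d assms(3)] by simp
qed

text \<open>Convolution with \<open>bump V\<close> is a contraction of L1, so exchanging
  \<open>f\<close> for \<open>g\<close> costs their distance twice, once under the convolution and
  once outside it.\<close>

lemma bump_approx_step:
  assumes f: "f \<in> L1 \<mu>" and g: "g \<in> L1 \<mu>" and V: "nbhd V"
  shows "norm1 \<mu> (\<lambda>x. convolution \<mu> f (bump V) x - f x) \<le>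
    2 * norm1 \<mu> (\<lambda>x. f x - g x) + norm1 \<mu> (\<lambda>x. convolution \<mu> g (bump V) x - g x)"
proof -
  have c: "convolution \<mu> f (bump V) \<in> L1 \<mu>" "convolution \<mu> g (bump V) \<in> L1 \<mu>"
    by (intro convolution_L1 f g bump_L1 V)+
  have "norm1 \<mu> (\<lambda>x. convolution \<mu> f (bump V) x - f x) \<le>
     norm1 \<mu> (\<lambda>x. convolution \<mu> f (bump V) x - convolution \<mu> g (bump V) x) +
     (norm1 \<mu> (\<lambda>x. convolution \<mu> g (bump V) x - g x) + norm1 \<mu> (\<lambda>x. g x - f x))"
    using norm1_triangle_diff[OF c f] norm1_triangle_diff[OF c(2) g f] by linarith
  moreover have "norm1 \<mu> (\<lambda>x. convolution \<mu> f (bump V) x - convolution \<mu> g (bump V) x) \<le> norm1 \<mu> (\<lambda>x. f x - g x)"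
    using convolution_diff_norm[OF f g bump_L1(1)[OF V]] by (simp add: bump_L1(2)[OF V])
  ultimately show ?thesis by (simp add: norm1_minus_commute[of \<mu> g f])
qed

text \<open>\<open>K\<close> is chosen inside \<open>U\<close> and not inside \<open>A\<close>,
  because inner regularity is given for open sets; the indicators of \<open>K\<close> and
  \<open>U\<close> are both close to that of \<open>A\<close> in L1.\<close>

lemma indicator_approx:
  assumes A: "A \<in> sets borel" "emeasure \<mu> A < \<infinity>" and e: "e > 0"
  obtains K U where "compact K" "open U" "K \<subseteq> U" "emeasure \<mu> U < \<infinity>" "measure \<mu> U - measure \<mu> K < e"
    "norm1 \<mu> (\<lambda>x. of_real (indicator U x) - of_real (indicator A x)) < e"
proof -
  have eA: "emeasure \<mu> A = ennreal (measure \<mu> A)" using A by (auto simp: emeasure_eq_ennreal_measure)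
  have "emeasure \<mu> A < emeasure \<mu> A + ennreal e"
    unfolding eA using e by (simp add: ennreal_plus[symmetric] ennreal_less_iff del: ennreal_plus)
  then have "(INF U\<in>{U. open U \<and> A \<subseteq> U}. emeasure \<mu> U) < emeasure \<mu> A + ennreal e"
    using outer[OF A(1)] by simp
  then obtain U where U: "open U" "A \<subseteq> U" "emeasure \<mu> U < emeasure \<mu> A + ennreal e"
    unfolding INF_less_iff by auto
  have "emeasure \<mu> A + ennreal e < \<infinity>" using A by simp
  then have Uf: "emeasure \<mu> U < \<infinity>" using U(3) by (rule less_trans[rotated])
  have eU: "emeasure \<mu> U = ennreal (measure \<mu> U)" using Uf by (auto simp: emeasure_eq_ennreal_measure)
  have mUA: "measure \<mu> U < measure \<mu> A + e"
    using U(3) e unfolding eU eA by (simp add: ennreal_plus[symmetric] ennreal_less_iff del: ennreal_plus)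
  have UA: "norm1 \<mu> (\<lambda>x. of_real (indicator U x) - of_real (indicator A x)) < e"
  proof -
    have "norm1 \<mu> (\<lambda>x. of_real (indicator U x) - of_real (indicator A x)) = (\<integral>x. indicator U x - indicator A x \<partial>\<mu>)"
      unfolding norm1_def using U(2)
      by (intro Bochner_Integration.integral_cong refl) (auto simp: indicator_def)
    also have "\<dots> = measure \<mu> U - measure \<mu> A"
      using U Uf A by (subst Bochner_Integration.integral_diff) (auto simp: sets_eq)
    finally show ?thesis using mUA by simp
  qed
  have "\<exists>K. compact K \<and> K \<subseteq> U \<and> measure \<mu> U - measure \<mu> K < e"
  proof (cases "measure \<mu> U < e")
    case True
    then show ?thesis by (intro exI[of _ "{}"]) auto
  next
    case False
    then have "ennreal (measure \<mu> U - e) < emeasure \<mu> U" unfolding eU using e by (intro ennreal_lessI) auto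
    then obtain K where K: "compact K" "K \<subseteq> U" "ennreal (measure \<mu> U - e) < emeasure \<mu> K"
      unfolding inner[OF U(1)] less_SUP_iff by auto
    have "emeasure \<mu> K = ennreal (measure \<mu> K)"
      using compact_finite[OF K(1)] by (simp add: emeasure_eq_ennreal_measure)
    then have "measure \<mu> U - e < measure \<mu> K"
      using K(3) False by (simp add: ennreal_less_iff)
    then show ?thesis using K by (intro exI[of _ K]) auto
  qed
  then show thesis using that U Uf UA by blast
qed

text \<open>Neighbourhoods and not sequences appear in the statement, since \<open>0\<close> need
  not have a countable base. The class of good \<open>f\<close> is closed in L1 by
  \<open>bump_approx_step\<close>, which leaves indicators of sets of finite measure.\<close>

lemma bump_approx_identity:
  assumes "f \<in> L1 \<mu>"
  shows "\<forall>e>0. \<exists>U. open U \<and> 0 \<in> U \<and>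
    (\<forall>V. nbhd V \<longrightarrow> V \<subseteq> U \<longrightarrow> norm1 \<mu> (\<lambda>x. convolution \<mu> f (bump V) x - f x) < e)"
    (is "?P f")
  using L1D[OF assms]
proof (induction rule: integrable_induct)
  case (base A c)
  have A: "A \<in> sets borel" "emeasure \<mu> A < \<infinity>" using base by (auto simp: sets_eq)
  define a :: "'g \<Rightarrow> complex" where "a = (\<lambda>x. of_real (indicator A x))"
  have aL: "a \<in> L1 \<mu>" unfolding a_def by (intro indicator_L1 A)
  have ac: "indicator A x *\<^sub>R c = c * a x" for x by (auto simp: a_def scaleR_conv_of_real mult.commute)
  show ?case unfolding ac
  proof (intro allI impI)
    fix e :: real assume "e > 0"
    \<comment> \<open>The indicator \<open>a\<close> is within \<open>2 * d\<close> of
      \<open>k\<close>, and \<open>k\<close> moves by less than \<open>2 * d\<close> under the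
      convolution, so \<open>bump_approx_step\<close> yields \<open>6 * d\<close>. The 7 makes the
      final inequality strict, and the added 1 covers \<open>c = 0\<close>.\<close>
    define d where "d = e / (7 * (cmod c + 1))"
    have d: "d > 0" unfolding d_def using \<open>e > 0\<close> by (intro divide_pos_pos) (auto intro: add_nonneg_pos)
    obtain K U where K: "compact K" "open U" "K \<subseteq> U" "emeasure \<mu> U < \<infinity>" "measure \<mu> U - measure \<mu> K < d"
      and UA: "norm1 \<mu> (\<lambda>x. of_real (indicator U x) - a x) < d"
      by (rule indicator_approx[OF A d]) (rule that, simp_all add: a_def)
    obtain W where W: "open W" "0 \<in> W" "\<forall>k\<in>K. \<forall>w\<in>W. k + w \<in> U"
      using compact_plus_nbhd[OF K(1-3)] by auto
    define k u :: "'g \<Rightarrow> complex" where "k = (\<lambda>x. of_real (indicator K x))" and "u = (\<lambda>x. of_real (indicator U x))"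
    have kL: "k \<in> L1 \<mu>" and uL: "u \<in> L1 \<mu>" unfolding k_def u_def
      using K compact_finite[OF K(1)] by (auto intro!: indicator_L1 simp: compact_imp_closed)
    have uk: "norm1 \<mu> (\<lambda>x. u x - k x) = measure \<mu> U - measure \<mu> K"
    proof -
      have "norm1 \<mu> (\<lambda>x. u x - k x) = (\<integral>x. indicator U x - indicator K x \<partial>\<mu>)"
        unfolding norm1_def u_def k_def using K(3)
        by (intro Bochner_Integration.integral_cong refl) (auto simp: indicator_def)
      also have "\<dots> = measure \<mu> U - measure \<mu> K"
        using K compact_finite[OF K(1)] by (subst Bochner_Integration.integral_diff) (auto simp: sets_eq)
      finally show ?thesis .
    qed
    have ak: "norm1 \<mu> (\<lambda>x. a x - k x) < 2 * d"
      using norm1_triangle_diff[OF aL uL kL] UA uk K(5) norm1_minus_commute[of \<mu> a u] by (simp add: u_def)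
    show "\<exists>U. open U \<and> 0 \<in> U \<and>
      (\<forall>V. nbhd V \<longrightarrow> V \<subseteq> U \<longrightarrow> norm1 \<mu> (\<lambda>x. convolution \<mu> (\<lambda>x. c * a x) (bump V) x - c * a x) < e)"
    proof (intro exI[of _ W] conjI allI impI W)
      fix V assume V: "nbhd V" "V \<subseteq> W"
      have cL: "convolution \<mu> k (bump V) \<in> L1 \<mu>" by (intro convolution_L1 kL bump_L1 V)
      have "norm1 \<mu> (\<lambda>x. u x - convolution \<mu> k (bump V) x) = measure \<mu> U - measure \<mu> K"
        unfolding u_def k_def using K W V by (intro bump_convolution_indicator) auto
      then have "norm1 \<mu> (\<lambda>x. convolution \<mu> k (bump V) x - k x) < 2 * d"
        using norm1_triangle_diff[OF cL uL kL] uk K(5) norm1_minus_commute[of \<mu> "convolution \<mu> k (bump V)" u] by simp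
      then have "norm1 \<mu> (\<lambda>x. convolution \<mu> a (bump V) x - a x) < 6 * d"
        using bump_approx_step[OF aL kL V(1)] ak by linarith
      then have "cmod c * norm1 \<mu> (\<lambda>x. convolution \<mu> a (bump V) x - a x) \<le> (cmod c + 1) * (6 * d)"
        by (intro mult_mono) auto
      also have "\<dots> < e"
      proof -
        have "cmod c + 1 > 0" by (simp add: add_nonneg_pos)
        have "q * (e / (7 * q)) = e / 7" if "q > 0" for q :: real using that by (simp add: field_simps)
        then have "(cmod c + 1) * d = e / 7" using \<open>cmod c + 1 > 0\<close> by (simp only: d_def)
        moreover have "(cmod c + 1) * (6 * d) = 6 * ((cmod c + 1) * d)" by simp
        ultimately show ?thesis using \<open>e > 0\<close> by linarith
      qed
      finally show "norm1 \<mu> (\<lambda>x. convolution \<mu> (\<lambda>x. c * a x) (bump V) x - c * a x) < e"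
        unfolding convolution_scale_left right_diff_distrib[symmetric] norm1_scale .
    qed
  qed
next
  case (add f g)
  then have fg: "f \<in> L1 \<mu>" "g \<in> L1 \<mu>" by (auto intro: L1I)
  show ?case
  proof (intro allI impI)
    fix e :: real assume "e > 0"
    then have "e / 2 > 0" by simp
    obtain U where U: "open U" "0 \<in> U" "\<And>V. nbhd V \<Longrightarrow> V \<subseteq> U \<Longrightarrow> norm1 \<mu> (\<lambda>x. convolution \<mu> f (bump V) x - f x) < e / 2"
      using add.IH(1) \<open>e / 2 > 0\<close> by blast
    obtain U' where U': "open U'" "0 \<in> U'" "\<And>V. nbhd V \<Longrightarrow> V \<subseteq> U' \<Longrightarrow> norm1 \<mu> (\<lambda>x. convolution \<mu> g (bump V) x - g x) < e / 2"
      using add.IH(2) \<open>e / 2 > 0\<close> by blast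
    show "\<exists>U. open U \<and> 0 \<in> U \<and>
      (\<forall>V. nbhd V \<longrightarrow> V \<subseteq> U \<longrightarrow> norm1 \<mu> (\<lambda>x. convolution \<mu> (\<lambda>x. f x + g x) (bump V) x - (f x + g x)) < e)"
    proof (intro exI[of _ "U \<inter> U'"] conjI allI impI)
      fix V assume V: "nbhd V" "V \<subseteq> U \<inter> U'"
      have b: "bump V \<in> L1 \<mu>" using bump_L1 V by auto
      have "norm1 \<mu> (\<lambda>x. convolution \<mu> (\<lambda>x. f x + g x) (bump V) x - (f x + g x)) =
         norm1 \<mu> (\<lambda>x. (convolution \<mu> f (bump V) x - f x) + (convolution \<mu> g (bump V) x - g x))"
        using convolution_add_left[OF fg b]
        by (intro norm1_cong_AE L1_add L1_diff convolution_L1 fg b) auto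
      also have "\<dots> \<le> norm1 \<mu> (\<lambda>x. convolution \<mu> f (bump V) x - f x) + norm1 \<mu> (\<lambda>x. convolution \<mu> g (bump V) x - g x)"
        by (intro norm1_triangle L1_diff convolution_L1 fg b)
      also have "\<dots> < e" using U(3)[OF V(1)] U'(3)[OF V(1)] V(2) by simp
      finally show "norm1 \<mu> (\<lambda>x. convolution \<mu> (\<lambda>x. f x + g x) (bump V) x - (f x + g x)) < e" .
    qed (use U U' in auto)
  qed
next
  case (lim f s)
  then have f: "f \<in> L1 \<mu>" and s: "\<And>i. s i \<in> L1 \<mu>" by (auto intro: L1I)
  have conv: "(\<lambda>i. norm1 \<mu> (\<lambda>x. f x - s i x)) \<longlonglongrightarrow> 0"
    using lim by (intro norm1_dominated_convergence f s) auto
  show ?case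
  proof (intro allI impI)
    fix e :: real assume "e > 0"
    then obtain i where i: "norm1 \<mu> (\<lambda>x. f x - s i x) < e / 4"
      using order_tendstoD(2)[OF conv, of "e / 4"] by (auto simp: eventually_sequentially)
    have "e / 2 > 0" using \<open>e > 0\<close> by simp
    then obtain U where U: "open U" "0 \<in> U" "\<And>V. nbhd V \<Longrightarrow> V \<subseteq> U \<Longrightarrow> norm1 \<mu> (\<lambda>x. convolution \<mu> (s i) (bump V) x - s i x) < e / 2"
      using lim.IH by blast
    show "\<exists>U. open U \<and> 0 \<in> U \<and>
      (\<forall>V. nbhd V \<longrightarrow> V \<subseteq> U \<longrightarrow> norm1 \<mu> (\<lambda>x. convolution \<mu> f (bump V) x - f x) < e)"
    proof (intro exI[of _ U] conjI allI impI)
      fix V assume V: "nbhd V" "V \<subseteq> U"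
      show "norm1 \<mu> (\<lambda>x. convolution \<mu> f (bump V) x - f x) < e"
        using bump_approx_step[OF f s[of i] V(1)] U(3)[OF V] i by linarith
    qed (use U in auto)
  qed
qed

text \<open>A smeared point mass: total mass 1, carried by \<open>V + x\<close>. The small set
  stands on the left of \<open>x\<close>, the side on which functions in \<open>LUC\<close> are
  uniformly continuous; the translation acts on the right, where it commutes with
  convolution.\<close>

definition approx_point :: "'g set \<Rightarrow> 'g \<Rightarrow> 'g \<Rightarrow> complex" where
  "approx_point V x = rtrans (- x) (bump V)"

lemma approx_point_L1:
  assumes "nbhd V"
  shows "approx_point V x \<in> L1 \<mu>" and "norm1 \<mu> (approx_point V x) = 1"
  using rtrans_L1[OF bump_L1(1)[OF assms]] bump_L1(2)[OF assms] by (simp_all add: approx_point_def)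

lemma approx_point_integral:
  assumes "nbhd V"
  shows "(\<integral>y. approx_point V x y \<partial>\<mu>) = 1"
proof -
  have "approx_point V x y = of_real (cmod (approx_point V x y))" for y
  proof -
    define r where "r = indicator V (y - x) / measure \<mu> V / modular (- x)"
    have "r \<ge> 0" unfolding r_def using modular_pos[of "- x"] by simp
    moreover have "approx_point V x y = of_real r" by (simp add: approx_point_def rtrans_def bump_def r_def)
    ultimately show ?thesis by simp
  qed
  then have "(\<integral>y. approx_point V x y \<partial>\<mu>) = (\<integral>y. of_real (cmod (approx_point V x y)) \<partial>\<mu>)"
    by (rule Bochner_Integration.integral_cong[OF refl])
  also have "\<dots> = of_real (norm1 \<mu> (approx_point V x))" by (simp add: norm1_def)
  finally show ?thesis by (simp add: approx_point_L1[OF assms])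
qed

lemma approx_point_support: "approx_point V x y \<noteq> 0 \<Longrightarrow> y - x \<in> V"
  by (auto simp: approx_point_def rtrans_def bump_def indicator_def split: if_splits)

end

section \<open>Left uniformly continuous functions\<close>

lemma LUC_bcontfun: "F \<in> LUC \<Longrightarrow> F \<in> bcontfun"
  by (simp add: LUC_def)

lemma LUC_bound: "F \<in> LUC \<Longrightarrow> cmod (F x) \<le> sup_norm F"
  unfolding sup_norm_def using norm_bounded[of "Bcontfun F" x] by (simp add: Bcontfun_inverse LUC_bcontfun)

lemma LUC_continuous: "F \<in> LUC \<Longrightarrow> continuous_on UNIV F"
  using LUC_bcontfun[of F] by (simp add: bcontfun_def)

lemma sup_norm_nonneg: "sup_norm F \<ge> 0"
  by (simp add: sup_norm_def)

lemma left_translate_bcontfun: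
  fixes F :: "'g::topological_group_add \<Rightarrow> complex"
  assumes "F \<in> bcontfun"
  shows "(\<lambda>y. F (x + y)) \<in> bcontfun"
proof -
  have c: "continuous_on UNIV F" and b: "bounded (range F)" using assms by (auto simp: bcontfun_def)
  have "continuous_on UNIV (\<lambda>y. F (x + y))"
    by (rule continuous_on_compose2[OF c]) (auto intro!: continuous_intros)
  moreover have "bounded (range (\<lambda>y. F (x + y)))" by (rule bounded_subset[OF b]) auto
  ultimately show ?thesis by (simp add: bcontfun_def)
qed

lemma const_LUC: "(\<lambda>x. c) \<in> LUC"
  by (simp add: LUC_def const_bcontfun continuous_on_const)

lemma LUC_add:
  assumes "F \<in> LUC" "G \<in> LUC"
  shows "(\<lambda>x. F x + G x) \<in> LUC"
proof -
  have b: "F \<in> bcontfun" "G \<in> bcontfun" using assms by (auto simp: LUC_bcontfun)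
  have "Bcontfun (\<lambda>y. F (x + y) + G (x + y)) = Bcontfun (\<lambda>y. F (x + y)) + Bcontfun (\<lambda>y. G (x + y))" for x
    using left_translate_bcontfun[OF b(1), of x] left_translate_bcontfun[OF b(2), of x]
    by (simp add: plus_bcontfun_def Bcontfun_inverse)
  then show ?thesis
    using assms b by (auto simp: LUC_def intro: plus_cont continuous_on_add)
qed

lemma LUC_scale:
  assumes "F \<in> LUC"
  shows "(\<lambda>x. c * F x) \<in> LUC"
proof -
  have b: "F \<in> bcontfun" using assms by (auto simp: LUC_bcontfun)
  have cb: "(\<lambda>x. c * G x) \<in> bcontfun" if "G \<in> bcontfun" for G :: "'a \<Rightarrow> complex"
  proof -
    have "bounded (range G)" "continuous_on UNIV G" using that by (auto simp: bcontfun_def)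
    then have "bounded ((\<lambda>z. c * z) ` range G)" by (intro bounded_linear_image bounded_linear_mult_right)
    then show ?thesis using \<open>continuous_on UNIV G\<close>
      by (auto simp: bcontfun_def image_image intro: continuous_on_mult continuous_on_const)
  qed
  define T where "T x = Bcontfun (\<lambda>y. F (x + y))" for x
  have T: "apply_bcontfun (T x) y = F (x + y)" for x y
    unfolding T_def by (simp add: Bcontfun_inverse left_translate_bcontfun[OF b])
  have d: "dist (Bcontfun (\<lambda>y. c * F (x + y))) (Bcontfun (\<lambda>y. c * F (z + y))) \<le> cmod c * dist (T x) (T z)" for x z
  proof (rule dist_bound)
    fix y
    have "dist (F (x + y)) (F (z + y)) \<le> dist (T x) (T z)"
      using dist_bounded[of "T x" y "T z"] by (simp add: T)
    then show "dist (apply_bcontfun (Bcontfun (\<lambda>y. c * F (x + y))) y) (apply_bcontfun (Bcontfun (\<lambda>y. c * F (z + y))) y) \<le> cmod c * dist (T x) (T z)"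
      by (simp add: Bcontfun_inverse cb left_translate_bcontfun[OF b] dist_norm right_diff_distrib[symmetric] norm_mult mult_left_mono)
  qed
  have "continuous_on UNIV T" using assms by (simp add: LUC_def T_def)
  have "continuous_on UNIV (\<lambda>x. Bcontfun (\<lambda>y. c * F (x + y)))"
    unfolding continuous_on_def
  proof
    fix x
    have "(T \<longlongrightarrow> T x) (at x)" using \<open>continuous_on UNIV T\<close> by (simp add: continuous_on_def)
    then have "((\<lambda>z. dist (T z) (T x)) \<longlongrightarrow> 0) (at x)" by (rule tendsto_dist_iff[THEN iffD1])
    then have lim: "((\<lambda>z. cmod c * dist (T z) (T x)) \<longlongrightarrow> 0) (at x)" by (rule tendsto_mult_right_zero)
    have "((\<lambda>z. dist (Bcontfun (\<lambda>y. c * F (z + y))) (Bcontfun (\<lambda>y. c * F (x + y)))) \<longlongrightarrow> 0) (at x)"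
    proof (rule tendsto_sandwich[OF _ _ tendsto_const lim])
      show "\<forall>\<^sub>F z in at x. dist (Bcontfun (\<lambda>y. c * F (z + y))) (Bcontfun (\<lambda>y. c * F (x + y))) \<le> cmod c * dist (T z) (T x)"
        by (intro always_eventually allI d)
    qed simp
    then show "((\<lambda>x. Bcontfun (\<lambda>y. c * F (x + y))) \<longlongrightarrow> Bcontfun (\<lambda>y. c * F (x + y))) (at x within UNIV)"
      by (simp add: tendsto_dist_iff[symmetric])
  qed
  then show ?thesis using cb[OF b] by (simp add: LUC_def)
qed

lemma LUC_uniform:
  assumes F: "F \<in> LUC" and e: "e > 0"
  shows "\<exists>U. open U \<and> 0 \<in> U \<and> (\<forall>v\<in>U. \<forall>x. cmod (F (v + x) - F x) \<le> e)"
proof -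
  define T where "T x = Bcontfun (\<lambda>y. F (x + y))" for x
  have T: "apply_bcontfun (T x) y = F (x + y)" for x y
    unfolding T_def by (simp add: Bcontfun_inverse left_translate_bcontfun[OF LUC_bcontfun[OF F]])
  have "continuous_on UNIV T" using F by (simp add: LUC_def T_def)
  then have "open (T -` ball (T 0) e)" by (intro open_vimage open_ball)
  moreover have "cmod (F (v + x) - F x) \<le> e" if "v \<in> T -` ball (T 0) e" for v x
  proof -
    have "dist (T 0) (T v) < e" using that by simp
    then show ?thesis using dist_bounded[of "T 0" x "T v"] by (simp add: T dist_norm norm_minus_commute)
  qed
  ultimately show ?thesis using e by (intro exI[of _ "T -` ball (T 0) e"]) auto
qed

lemma point_evaluation_cdual: "point_evaluation x \<in> cdual LUC sup_norm"
  by (rule cdualI[where C = 1]) (auto simp: point_evaluation_def LUC_add LUC_scale LUC_bound)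

lemma point_evaluation_closure: "point_evaluation x \<in> weak_star LUC sup_norm closure_of range point_evaluation"
proof -
  have "range point_evaluation \<subseteq> topspace (weak_star LUC sup_norm)"
    using const_LUC point_evaluation_cdual by (subst topspace_weak_star) auto
  then show ?thesis using closure_of_subset by blast
qed

section \<open>Bounded Borel functions as elements of the dual of L1\<close>

context haar
begin

text \<open>
  \<^const>\<open>LUC_embedding\<close> makes sense for bounded Borel functions and is used for them throughout.
\<close>
definition bmult :: "('g \<Rightarrow> complex) \<Rightarrow> real \<Rightarrow> bool" where
  "bmult \<phi> B \<longleftrightarrow> \<phi> \<in> borel_measurable borel \<and> (\<forall>x. cmod (\<phi> x) \<le> B)"

lemma bmult_nonneg: "bmult \<phi> B \<Longrightarrow> B \<ge> 0"
  using norm_ge_zero order_trans unfolding bmult_def by blast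

lemma bmult_integrable:
  assumes \<phi>: "bmult \<phi> B" and f: "f \<in> L1 \<mu>"
  shows "integrable \<mu> (\<lambda>x. \<phi> x * f x)"
proof (rule Bochner_Integration.integrable_bound[where f = "\<lambda>x. of_real B * f x"])
  show "integrable \<mu> (\<lambda>x. of_real B * f x)" using f by (auto simp: L1_def)
  have [measurable]: "\<phi> \<in> borel_measurable borel" using \<phi> by (simp add: bmult_def)
  note [measurable] = L1_borel[OF f]
  show "(\<lambda>x. \<phi> x * f x) \<in> borel_measurable \<mu>" by measurable
  show "AE x in \<mu>. cmod (\<phi> x * f x) \<le> cmod (of_real B * f x)"
    using \<phi> bmult_nonneg[OF \<phi>] by (simp add: norm_mult mult_right_mono bmult_def)
qed

lemma bmult_Linf:
  assumes \<phi>: "bmult \<phi> B"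
  shows "LUC_embedding \<mu> \<phi> \<in> Linf \<mu>" and "norm_inf \<mu> (LUC_embedding \<mu> \<phi>) \<le> B"
proof -
  have b: "cmod (LUC_embedding \<mu> \<phi> f) \<le> B * norm1 \<mu> f" if f: "f \<in> L1 \<mu>" for f
  proof -
    have "cmod (\<integral>x. \<phi> x * f x \<partial>\<mu>) \<le> (\<integral>x. cmod (\<phi> x * f x) \<partial>\<mu>)" by (rule integral_norm_bound)
    also have "\<dots> \<le> (\<integral>x. B * cmod (f x) \<partial>\<mu>)"
    proof (rule integral_mono)
      show "integrable \<mu> (\<lambda>x. cmod (\<phi> x * f x))" by (intro integrable_norm bmult_integrable[OF \<phi>] f)
      show "integrable \<mu> (\<lambda>x. B * cmod (f x))" using f by (simp add: L1_def)
    qed (use \<phi> in \<open>simp add: norm_mult mult_right_mono bmult_def\<close>)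
    finally show ?thesis using f by (simp add: LUC_embedding_def norm1_def)
  qed
  show "LUC_embedding \<mu> \<phi> \<in> Linf \<mu>"
    by (rule LinfI[OF _ _ b])
       (auto simp: LUC_embedding_def L1_add L1_scale distrib_left bmult_integrable[OF \<phi>] mult.left_commute)
  show "norm_inf \<mu> (LUC_embedding \<mu> \<phi>) \<le> B"
    by (rule norm_inf_least[OF b bmult_nonneg[OF \<phi>]])
qed

lemma bmult_add:
  assumes "bmult \<phi> B" "bmult \<psi> C"
  shows "LUC_embedding \<mu> (\<lambda>x. \<phi> x + \<psi> x) = (\<lambda>f. LUC_embedding \<mu> \<phi> f + LUC_embedding \<mu> \<psi> f)"
  using bmult_integrable[OF assms(1)] bmult_integrable[OF assms(2)]
  by (auto simp: LUC_embedding_def distrib_right)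

lemma LUC_bmult: "F \<in> LUC \<Longrightarrow> bmult F (sup_norm F)"
  by (simp add: bmult_def LUC_bound LUC_continuous borel_measurable_continuous_onI)

lemmas LUC_embedding_integrable = bmult_integrable[OF LUC_bmult]
  and LUC_embedding_Linf = bmult_Linf[OF LUC_bmult]
  and LUC_embedding_add = bmult_add[OF LUC_bmult LUC_bmult]

text \<open>One neighbourhood serves all \<open>x\<close>; this matters because the point will move
  with the filter when limits are taken.\<close>

lemma LUC_embedding_approx_point:
  assumes F: "F \<in> LUC" and e: "e > 0"
  shows "\<exists>U. open U \<and> 0 \<in> U \<and> (\<forall>V x. nbhd V \<longrightarrow> V \<subseteq> U \<longrightarrow> cmod (LUC_embedding \<mu> F (approx_point V x) - F x) \<le> e)"
proof -
  obtain U where U: "open U" "0 \<in> U" "\<And>v x. v \<in> U \<Longrightarrow> cmod (F (v + x) - F x) \<le> e"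
    using LUC_uniform[OF F e] by blast
  show ?thesis
  proof (intro exI[of _ U] conjI allI impI U)
    fix V x assume V: "nbhd V" "V \<subseteq> U"
    let ?p = "approx_point V x"
    have p: "?p \<in> L1 \<mu>" using approx_point_L1[OF V(1)] by simp
    have i: "integrable \<mu> (\<lambda>y. F y * ?p y)" "integrable \<mu> (\<lambda>y. F x * ?p y)"
      using LUC_embedding_integrable[OF F p] p by (auto simp: L1_def)
    have "LUC_embedding \<mu> F ?p - F x = (\<integral>y. F y * ?p y \<partial>\<mu>) - (\<integral>y. F x * ?p y \<partial>\<mu>)"
      using p by (simp add: LUC_embedding_def approx_point_integral[OF V(1)])
    also have "\<dots> = (\<integral>y. (F y - F x) * ?p y \<partial>\<mu>)"
      using i by (simp add: left_diff_distrib)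
    finally have "cmod (LUC_embedding \<mu> F ?p - F x) \<le> (\<integral>y. cmod ((F y - F x) * ?p y) \<partial>\<mu>)"
      by (simp add: integral_norm_bound)
    also have "\<dots> \<le> (\<integral>y. e * cmod (?p y) \<partial>\<mu>)"
    proof (rule integral_mono)
      show "integrable \<mu> (\<lambda>y. cmod ((F y - F x) * ?p y))"
        using i by (simp add: left_diff_distrib)
      show "integrable \<mu> (\<lambda>y. e * cmod (?p y))" using p by (simp add: L1_def)
      fix y
      show "cmod ((F y - F x) * ?p y) \<le> e * cmod (?p y)"
      proof (cases "?p y = 0")
        case False
        then have "y - x \<in> U" using approx_point_support V by blast
        from U(3)[OF this, of x] show ?thesis by (simp add: norm_mult mult_right_mono)
      qed simp
    qed
    also have "\<dots> = e" using approx_point_L1(2)[OF V(1)] by (simp add: norm1_def)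
    finally show "cmod (LUC_embedding \<mu> F ?p - F x) \<le> e" .
  qed
qed

section \<open>Compact covers of minimal cardinality\<close>

definition compact_cover :: "'g set set \<Rightarrow> bool" where
  "compact_cover \<F> \<longleftrightarrow> (\<forall>C\<in>\<F>. compact C) \<and> (\<Union>C\<in>\<F>. interior C) = UNIV"

lemma interior_plus_compact:
  assumes "compact (D :: 'g set)" "open V" "compact K" "0 \<in> V" "V \<subseteq> K"
  shows "D \<subseteq> interior ((\<lambda>(x, y). x + y) ` (D \<times> K))"
proof -
  define Q where "Q = (\<Union>a\<in>D. (\<lambda>y. - a + y) -` V)"
  have "open Q" unfolding Q_def by (intro open_UN ballI open_vimage assms cont_left)
  moreover have "Q \<subseteq> (\<lambda>(x, y). x + y) ` (D \<times> K)"
  proof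
    fix x assume "x \<in> Q"
    then obtain a where "a \<in> D" "- a + x \<in> V" by (auto simp: Q_def)
    then show "x \<in> (\<lambda>(x, y). x + y) ` (D \<times> K)"
      using assms by (intro image_eqI[of _ _ "(a, - a + x)"]) (auto simp: add.assoc[symmetric])
  qed
  moreover have "D \<subseteq> Q" using assms by (auto simp: Q_def)
  ultimately show ?thesis by (meson interior_maximal order_trans)
qed

lemma min_cover_exists:
  "\<exists>\<C>. compact_cover \<C> \<and> (\<forall>\<F>. compact_cover \<F> \<longrightarrow> (card_of \<C>, card_of \<F>) \<in> ordLeq)"
proof -
  obtain V K where V: "open V" "compact K" "(0::'g) \<in> V" "V \<subseteq> K" using locally_compact by auto
  have "compact_cover (range (\<lambda>x. (\<lambda>(x, y). x + y) ` ({x} \<times> K)))"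
    unfolding compact_cover_def
  proof (intro conjI ballI)
    fix C assume "C \<in> range (\<lambda>x. (\<lambda>(x, y). x + y) ` ({x} \<times> K))"
    then show "compact C" using V by (auto intro!: compact_plus_image)
  next
    have "x \<in> interior ((\<lambda>(x, y). x + y) ` ({x} \<times> K))" for x
      using interior_plus_compact[of "{x}" V K] V by auto
    then show "(\<Union>C\<in>range (\<lambda>x. (\<lambda>(x, y). x + y) ` ({x} \<times> K)). interior C) = UNIV"
      unfolding UN_simps by blast
  qed
  then have ne: "card_of ` {\<F>. compact_cover \<F>} \<noteq> {}" by blast
  have "\<forall>r\<in>card_of ` {\<F>. compact_cover \<F>}. Card_order r" by (auto intro: card_of_Card_order)
  from exists_minim_Card_order[OF ne this] show ?thesis by auto
qed

definition min_cover :: "'g set set" where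
  "min_cover = (SOME \<C>. compact_cover \<C> \<and> (\<forall>\<F>. compact_cover \<F> \<longrightarrow> (card_of \<C>, card_of \<F>) \<in> ordLeq))"

lemma min_cover: "compact_cover min_cover"
  and min_cover_least: "compact_cover \<F> \<Longrightarrow> (card_of min_cover, card_of \<F>) \<in> ordLeq"
  using someI_ex[OF min_cover_exists] unfolding min_cover_def[symmetric] by auto

text \<open>
  Enlarging each member of a cover by a fixed compact neighbourhood of \<open>0\<close> yields a cover by
  interiors without changing the cardinality; so minimality passes to covers by arbitrary
  compact sets.
\<close>
lemma small_not_cover:
  assumes "\<And>D. D \<in> \<D> \<Longrightarrow> compact D" "(card_of \<D>, card_of min_cover) \<in> ordLess"
  shows "\<Union>\<D> \<noteq> (UNIV :: 'g set)"
proof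
  assume U: "\<Union>\<D> = UNIV"
  obtain V K where V: "open V" "compact K" "(0::'g) \<in> V" "V \<subseteq> K" using locally_compact by auto
  define p where "p D = (\<lambda>(x, y). x + y) ` (D \<times> K)" for D
  have "compact_cover (p ` \<D>)" unfolding compact_cover_def
  proof (intro conjI ballI)
    fix C assume "C \<in> p ` \<D>"
    then show "compact C" using V assms by (auto simp: p_def intro!: compact_plus_image)
  next
    have "\<Union>\<D> \<subseteq> (\<Union>C\<in>p ` \<D>. interior C)"
      using interior_plus_compact[OF assms(1) V(1,2,3,4)] unfolding p_def by blast
    then show "(\<Union>C\<in>p ` \<D>. interior C) = UNIV" using U by auto
  qed
  then have "(card_of min_cover, card_of (p ` \<D>)) \<in> ordLeq" by (rule min_cover_least)
  then have "(card_of min_cover, card_of \<D>) \<in> ordLeq" using card_of_image by (rule ordLeq_transitive)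
  then show False using assms(2) not_ordLess_ordLeq by blast
qed

text \<open>Transfinite recursion along a cardinal well-order of \<open>J\<close>: each
  \<open>j\<close> has fewer than \<open>card_of min_cover\<close> predecessors. The positions
  excluded for \<open>j\<close> form one compact set per predecessor, and so few compact sets do not
  cover the group.\<close>

lemma disjoint_translates:
  fixes C :: "'j \<Rightarrow> 'g set"
  assumes C: "\<And>j. j \<in> J \<Longrightarrow> compact (C j)" and J: "(card_of J, card_of min_cover) \<in> ordLeq"
  shows "\<exists>x. \<forall>i\<in>J. \<forall>j\<in>J. i \<noteq> j \<longrightarrow> (\<lambda>c. c + x i) ` C i \<inter> (\<lambda>c. c + x j) ` C j = {}"
proof -
  define r where "r = card_of J"
  have wo: "well_order_on J r" and co: "Card_order r" and Fr: "Field r = J"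
    by (auto simp: r_def card_of_well_order_on card_of_card_order_on Field_card_of)
  have "wf (r - Id)" using wo by (simp add: well_order_on_def)
  define P where "P f j y \<longleftrightarrow> (j \<in> J \<longrightarrow> (\<forall>i. (i, j) \<in> r - Id \<longrightarrow> (\<lambda>c. c + f i) ` C i \<inter> (\<lambda>c. c + y) ` C j = {}))"
    for f j y
  have "\<exists>x. \<forall>j. P x j (x j)"
  proof (rule dependent_wf_choice[OF \<open>wf (r - Id)\<close>])
    show "P f j y = P g j y" if "\<And>i. (i, j) \<in> r - Id \<Longrightarrow> f i = g i" for f g j y
      using that unfolding P_def by auto
    fix j f
    show "\<exists>y. P f j y"
    proof (cases "j \<in> J")
      case True
      \<comment> \<open>\<open>y \<in> D i\<close> exactly when the translate of \<open>C j\<close>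
        by \<open>y\<close> meets the translate of \<open>C i\<close> by \<open>f i\<close>.\<close>
      define D where "D i = (\<lambda>(a, b). - a + (b + f i)) ` (C j \<times> C i)" for i
      have sub: "underS r j \<subseteq> J" unfolding Fr[symmetric] by (auto simp: underS_def Field_def)
      have "compact (D i)" if "i \<in> underS r j" for i
        unfolding D_def case_prod_beta using that sub C True
        by (intro compact_continuous_image compact_Times continuous_intros) auto
      moreover have "(card_of (D ` underS r j), card_of min_cover) \<in> ordLess"
      proof -
        have "(card_of (D ` underS r j), card_of (underS r j)) \<in> ordLeq" by (rule card_of_image)
        moreover have "(card_of (underS r j), r) \<in> ordLess" using co True Fr by (intro card_of_underS) auto
        ultimately show ?thesis using J unfolding r_def by (meson ordLeq_ordLess_trans ordLess_ordLeq_trans)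
      qed
      ultimately have "\<Union>(D ` underS r j) \<noteq> UNIV" by (intro small_not_cover) auto
      then obtain y where y: "y \<notin> \<Union>(D ` underS r j)" by auto
      have "P f j y" unfolding P_def
      proof (intro impI allI)
        fix i assume "(i, j) \<in> r - Id"
        then have i: "i \<in> underS r j" by (auto simp: underS_def)
        show "(\<lambda>c. c + f i) ` C i \<inter> (\<lambda>c. c + y) ` C j = {}"
        proof (rule ccontr)
          assume "(\<lambda>c. c + f i) ` C i \<inter> (\<lambda>c. c + y) ` C j \<noteq> {}"
          then obtain a b where ab: "a \<in> C j" "b \<in> C i" "b + f i = a + y" by auto
          have "y = - a + (a + y)" by (simp add: add.assoc[symmetric])
          then have "y = - a + (b + f i)" using ab by simp
          then have "y \<in> D i" using ab unfolding D_def by (intro image_eqI[of _ _ "(a, b)"]) auto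
          then show False using y i by blast
        qed
      qed
      then show ?thesis by blast
    qed (auto simp: P_def)
  qed
  then obtain x where x: "\<And>j. P x j (x j)" by blast
  show ?thesis
  proof (intro exI[of _ x] ballI impI)
    fix i j assume ij: "i \<in> J" "j \<in> J" "i \<noteq> j"
    have "(i, j) \<in> r \<or> (j, i) \<in> r"
      using wo ij by (auto simp: well_order_on_def linear_order_on_def total_on_def)
    then show "(\<lambda>c. c + x i) ` C i \<inter> (\<lambda>c. c + x j) ` C j = {}"
      using x[of i] x[of j] ij unfolding P_def by blast
  qed
qed

text \<open>Finite unions make the family directed and cofinal among compact sets, at no cost in
  cardinality once \<open>min_cover\<close> is infinite.\<close>

definition cfam :: "'g set set" where
  "cfam = {\<Union>F |F. finite F \<and> F \<subseteq> min_cover}"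

lemma cfam_compact:
  assumes "C \<in> cfam"
  shows "compact C"
proof -
  obtain F where F: "finite F" "F \<subseteq> min_cover" "C = \<Union>F" using assms by (auto simp: cfam_def)
  have "compact D" if "D \<in> F" for D using min_cover F that by (auto simp: compact_cover_def)
  then show ?thesis using F by (auto intro: compact_Union)
qed

lemma cfam_Un:
  assumes "C \<in> cfam" "D \<in> cfam"
  shows "C \<union> D \<in> cfam"
proof -
  obtain F G where FG: "finite F" "F \<subseteq> min_cover" "C = \<Union>F" "finite G" "G \<subseteq> min_cover" "D = \<Union>G"
    using assms by (auto simp: cfam_def)
  then show ?thesis unfolding cfam_def by (intro CollectI exI[of _ "F \<union> G"]) auto
qed

lemma cfam_cofinal:
  assumes "compact (K :: 'g set)"
  shows "\<exists>C\<in>cfam. K \<subseteq> C"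
proof -
  have "K \<subseteq> (\<Union>C\<in>min_cover. interior C)" using min_cover by (simp add: compact_cover_def)
  then obtain F where F: "F \<subseteq> min_cover" "finite F" "K \<subseteq> (\<Union>C\<in>F. interior C)"
    using compactE_image[OF assms, of min_cover interior] open_interior by metis
  have "K \<subseteq> \<Union>F" using F(3) interior_subset by blast
  then show ?thesis using F unfolding cfam_def by blast
qed

lemma cfam_empty: "{} \<in> cfam"
  unfolding cfam_def by (intro CollectI exI[of _ "{}"]) auto

lemma min_cover_infinite:
  assumes "\<not> compact (UNIV :: 'g set)"
  shows "infinite min_cover"
proof
  assume "finite min_cover"
  then have "compact (\<Union>min_cover)" using min_cover by (auto simp: compact_cover_def intro: compact_Union)
  moreover have "\<Union>min_cover = UNIV" using min_cover interior_subset unfolding compact_cover_def by blast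
  ultimately show False using assms by simp
qed

text \<open>The unions are counted by the number of their pieces: an infinite cardinal absorbs
  products with itself and countable unions.\<close>

lemma cfam_card:
  assumes "\<not> compact (UNIV :: 'g set)"
  shows "(card_of cfam, card_of min_cover) \<in> ordLeq"
proof -
  note inf = min_cover_infinite[OF assms]
  define B :: "nat \<Rightarrow> 'g set set" where "B = rec_nat {{}} (\<lambda>n S. (\<lambda>(C, D). C \<union> D) ` (min_cover \<times> S))"
  have B0: "B 0 = {{}}" and BS: "B (Suc n) = (\<lambda>(C, D). C \<union> D) ` (min_cover \<times> B n)" for n
    by (simp_all add: B_def)
  have "(card_of (B n), card_of min_cover) \<in> ordLeq" for n
  proof (induction n)
    case 0
    obtain c where "c \<in> min_cover" using inf by fastforce
    then show ?case unfolding B0 card_of_ordLeq[symmetric] by (intro exI[of _ "\<lambda>_. c"]) auto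
  next
    case (Suc n)
    have "(card_of (min_cover \<times> B n), card_of min_cover) \<in> ordLeq"
      using inf Suc by (intro card_of_Times_ordLeq_infinite_Field) (auto simp: Field_card_of card_of_card_order_on card_of_mono1)
    then show ?case unfolding BS using card_of_image ordLeq_transitive by blast
  qed
  then have "(card_of (\<Union>n\<in>UNIV. B n), card_of min_cover) \<in> ordLeq"
    using inf infinite_iff_card_of_nat by (intro card_of_UNION_ordLeq_infinite) auto
  moreover have "cfam \<subseteq> (\<Union>n\<in>UNIV. B n)"
  proof
    fix C assume "C \<in> cfam"
    then obtain F where F: "finite F" "F \<subseteq> min_cover" "C = \<Union>F" by (auto simp: cfam_def)
    have "\<exists>n. \<Union>F \<in> B n" using F(1,2)
    proof induction
      case empty
      then show ?case using B0 by (intro exI[of _ 0]) auto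
    next
      case (insert D F)
      then obtain n where "\<Union>F \<in> B n" by auto
      then have "\<Union>(insert D F) \<in> B (Suc n)" unfolding BS using insert.prems
        by (intro image_eqI[of _ _ "(D, \<Union>F)"]) auto
      then show ?case by blast
    qed
    then show "C \<in> (\<Union>n\<in>UNIV. B n)" using F by auto
  qed
  ultimately show ?thesis using card_of_mono1 ordLeq_transitive by blast
qed

section \<open>Filters of compact sets and of neighbourhoods of the identity\<close>

definition cfilter :: "'g set filter" where
  "cfilter = (INF C\<in>cfam. principal {D \<in> cfam. C \<subseteq> D})"

lemma eventually_cfilter: "eventually P cfilter \<longleftrightarrow> (\<exists>C\<in>cfam. \<forall>D\<in>cfam. C \<subseteq> D \<longrightarrow> P D)"
proof -
  have "eventually P cfilter \<longleftrightarrow> (\<exists>C\<in>cfam. eventually P (principal {D \<in> cfam. C \<subseteq> D}))"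
    unfolding cfilter_def
  proof (rule eventually_INF_base)
    show "cfam \<noteq> {}" using cfam_empty by auto
    fix A B assume "A \<in> cfam" "B \<in> cfam"
    then show "\<exists>x\<in>cfam. principal {D \<in> cfam. x \<subseteq> D} \<le> inf (principal {D \<in> cfam. A \<subseteq> D}) (principal {D \<in> cfam. B \<subseteq> D})"
      by (intro bexI[of _ "A \<union> B"]) (auto simp: cfam_Un)
  qed
  then show ?thesis by (simp add: eventually_principal Ball_def imp_conjL)
qed

lemma cfilter_not_bot: "cfilter \<noteq> bot"
  unfolding trivial_limit_def eventually_cfilter by blast

definition nbhd_filter :: "'g set filter" where
  "nbhd_filter = (INF U\<in>{U. open U \<and> 0 \<in> U}. principal {V. nbhd V \<and> V \<subseteq> U})"

lemma eventually_nbhd_filter: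
  "eventually P nbhd_filter \<longleftrightarrow> (\<exists>U. open U \<and> 0 \<in> U \<and> (\<forall>V. nbhd V \<longrightarrow> V \<subseteq> U \<longrightarrow> P V))"
proof -
  have "eventually P nbhd_filter \<longleftrightarrow> (\<exists>U\<in>{U. open U \<and> 0 \<in> U}. eventually P (principal {V. nbhd V \<and> V \<subseteq> U}))"
    unfolding nbhd_filter_def
  proof (rule eventually_INF_base)
    show "{U. open U \<and> (0::'g) \<in> U} \<noteq> {}" by auto
    fix A B assume "A \<in> {U. open U \<and> (0::'g) \<in> U}" "B \<in> {U. open U \<and> (0::'g) \<in> U}"
    then show "\<exists>x\<in>{U. open U \<and> 0 \<in> U}. principal {V. nbhd V \<and> V \<subseteq> x} \<le> inf (principal {V. nbhd V \<and> V \<subseteq> A}) (principal {V. nbhd V \<and> V \<subseteq> B})"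
      by (intro bexI[of _ "A \<inter> B"]) auto
  qed
  then show ?thesis by (auto simp: eventually_principal)
qed

lemma nbhd_filter_not_bot: "nbhd_filter \<noteq> bot"
  unfolding trivial_limit_def eventually_nbhd_filter using nbhd_exists by blast

section \<open>Restrictions, right translates and sums over disjoint sets\<close>

definition cut :: "'g set \<Rightarrow> ('g \<Rightarrow> complex) \<Rightarrow> 'g \<Rightarrow> complex" where
  "cut A f = (\<lambda>x. of_real (indicator A x) * f x)"

lemma cut_L1: "A \<in> sets borel \<Longrightarrow> f \<in> L1 \<mu> \<Longrightarrow> cut A f \<in> L1 \<mu>"
  unfolding cut_def L1_def
  using integrable_mult_indicator[of A \<mu> f] by (simp add: sets_eq scaleR_conv_of_real)

lemma norm1_cut_le: "A \<in> sets borel \<Longrightarrow> f \<in> L1 \<mu> \<Longrightarrow> norm1 \<mu> (cut A f) \<le> norm1 \<mu> f"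
  by (intro norm1_mono cut_L1) (auto simp: cut_def indicator_def)

lemma cut_add: "cut A (\<lambda>x. f x + g x) = (\<lambda>x. cut A f x + cut A g x)"
  and cut_scale: "cut A (\<lambda>x. c * f x) = (\<lambda>x. c * cut A f x)"
  and cut_cut: "cut A (cut B f) = cut (A \<inter> B) f"
  and cut_empty: "cut {} f = (\<lambda>x. 0)"
  by (auto simp: cut_def indicator_def distrib_left)

lemma rtrans_add: "rtrans a (\<lambda>x. f x + g x) = (\<lambda>x. rtrans a f x + rtrans a g x)"
  and rtrans_diff: "rtrans a (\<lambda>x. f x - g x) = (\<lambda>x. rtrans a f x - rtrans a g x)"
  and rtrans_scale: "rtrans a (\<lambda>x. c * f x) = (\<lambda>x. c * rtrans a f x)"
  by (auto simp: rtrans_def add_divide_distrib diff_divide_distrib)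

lemma rtrans_inverse: "rtrans a (rtrans (- a) f) = f"
proof
  fix x
  have "complex_of_real (modular (- a)) * complex_of_real (modular a) = 1"
    unfolding of_real_mult[symmetric] using modular_inverse[of a] by (simp add: mult.commute)
  then show "rtrans a (rtrans (- a) f) x = f x" by (simp add: rtrans_def add.assoc)
qed

lemma cut_rtrans: "cut C (rtrans a f) = rtrans a (cut ((\<lambda>c. c + a) ` C) f)"
  by (auto simp: cut_def rtrans_def indicator_def image_iff fun_eq_iff)

lemma rtrans_cut: "cut ((\<lambda>c. c + a) ` C) (rtrans (- a) (cut C f)) = rtrans (- a) (cut C f)"
proof
  fix y
  have "y - a \<notin> C" if "y \<notin> (\<lambda>c. c + a) ` C"
  proof
    assume "y - a \<in> C"
    then have "y \<in> (\<lambda>c. c + a) ` C" by (intro image_eqI[of _ _ "y - a"]) auto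
    then show False using that by simp
  qed
  then show "cut ((\<lambda>c. c + a) ` C) (rtrans (- a) (cut C f)) y = rtrans (- a) (cut C f) y"
    by (auto simp: cut_def rtrans_def indicator_def)
qed

lemma sum_norm1_cut_le:
  assumes f: "f \<in> L1 \<mu>" and F: "finite F" and E: "\<And>j. j \<in> F \<Longrightarrow> E j \<in> sets borel"
    and d: "\<And>i j. i \<in> F \<Longrightarrow> j \<in> F \<Longrightarrow> i \<noteq> j \<Longrightarrow> E i \<inter> E j = {}"
  shows "(\<Sum>j\<in>F. norm1 \<mu> (cut (E j) f)) \<le> norm1 \<mu> f"
proof -
  have i: "integrable \<mu> (\<lambda>x. cmod (cut (E j) f x))" if "j \<in> F" for j
    using L1D[OF cut_L1[OF E[OF that] f]] by (rule integrable_norm)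
  have "(\<Sum>j\<in>F. norm1 \<mu> (cut (E j) f)) = (\<integral>x. (\<Sum>j\<in>F. cmod (cut (E j) f x)) \<partial>\<mu>)"
    unfolding norm1_def using i by (rule Bochner_Integration.integral_sum[symmetric])
  also have "\<dots> \<le> norm1 \<mu> f" unfolding norm1_def
  proof (rule integral_mono)
    show "integrable \<mu> (\<lambda>x. \<Sum>j\<in>F. cmod (cut (E j) f x))" using i by (rule Bochner_Integration.integrable_sum)
    show "integrable \<mu> (\<lambda>x. cmod (f x))" using f by (simp add: L1_def)
    fix x
    show "(\<Sum>j\<in>F. cmod (cut (E j) f x)) \<le> cmod (f x)"
    proof (cases "\<exists>j\<in>F. x \<in> E j")
      case True
      then obtain j where j: "j \<in> F" "x \<in> E j" by auto
      have "(\<Sum>i\<in>F. cmod (cut (E i) f x)) = (\<Sum>i\<in>{j}. cmod (cut (E i) f x))"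
        using F j d[of _ j] by (intro sum.mono_neutral_right) (auto simp: cut_def indicator_def)
      then show ?thesis using j by (simp add: cut_def)
    next
      case False
      then have "(\<Sum>i\<in>F. cmod (cut (E i) f x)) = 0" by (intro sum.neutral) (auto simp: cut_def)
      then show ?thesis by simp
    qed
  qed
  finally show ?thesis .
qed

text \<open>Each summand sees \<open>f\<close> only on its own set, so the disjoint masses add up to
  at most \<open>norm1 \<mu> f\<close> and the norm does not grow with the number of summands.
  \<open>infsum\<close> copes with uncountable \<open>J\<close>. If \<open>f\<close> is carried by
  \<open>E j\<close>, the bound makes every other summand vanish.\<close>

lemma disjoint_sum_Linf:
  fixes E :: "'j \<Rightarrow> 'g set" and t :: "'j \<Rightarrow> ('g \<Rightarrow> complex) \<Rightarrow> complex"
  assumes E: "\<And>j. j \<in> J \<Longrightarrow> E j \<in> sets borel"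
    and d: "\<And>i j. i \<in> J \<Longrightarrow> j \<in> J \<Longrightarrow> i \<noteq> j \<Longrightarrow> E i \<inter> E j = {}"
    and add: "\<And>j f g. j \<in> J \<Longrightarrow> f \<in> L1 \<mu> \<Longrightarrow> g \<in> L1 \<mu> \<Longrightarrow> t j (\<lambda>x. f x + g x) = t j f + t j g"
    and scale: "\<And>j c f. j \<in> J \<Longrightarrow> f \<in> L1 \<mu> \<Longrightarrow> t j (\<lambda>x. c * f x) = c * t j f"
    and bound: "\<And>j f. j \<in> J \<Longrightarrow> f \<in> L1 \<mu> \<Longrightarrow> cmod (t j f) \<le> B * norm1 \<mu> (cut (E j) f)" and "B \<ge> 0"
  defines "T \<equiv> \<lambda>f. if f \<in> L1 \<mu> then infsum (\<lambda>j. t j f) J else 0"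
  shows "T \<in> Linf \<mu>" and "norm_inf \<mu> T \<le> B"
    and "\<And>j f. j \<in> J \<Longrightarrow> f \<in> L1 \<mu> \<Longrightarrow> cut (E j) f = f \<Longrightarrow> T f = t j f"
proof -
  have fin: "(\<Sum>j\<in>F. B * norm1 \<mu> (cut (E j) f)) \<le> B * norm1 \<mu> f" if "f \<in> L1 \<mu>" "finite F" "F \<subseteq> J" for f F
    unfolding sum_distrib_left[symmetric] using that E d \<open>B \<ge> 0\<close>
    by (intro mult_left_mono sum_norm1_cut_le) (simp_all add: subset_iff)
  have s0: "(\<lambda>j. B * norm1 \<mu> (cut (E j) f)) summable_on J" if "f \<in> L1 \<mu>" for f
    using fin[OF that] \<open>B \<ge> 0\<close> by (intro nonneg_bdd_above_summable_on bdd_aboveI2) auto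
  have s1: "(\<lambda>j. cmod (t j f)) summable_on J" if "f \<in> L1 \<mu>" for f
    using s0[OF that] bound[OF _ that] by (rule Infinite_Sum.abs_summable_on_comparison_test')
  have b: "cmod (T f) \<le> B * norm1 \<mu> f" if f: "f \<in> L1 \<mu>" for f
  proof -
    have "cmod (infsum (\<lambda>j. t j f) J) \<le> infsum (\<lambda>j. cmod (t j f)) J"
      by (rule norm_infsum_bound[OF s1[OF f]])
    also have "\<dots> \<le> infsum (\<lambda>j. B * norm1 \<mu> (cut (E j) f)) J"
      by (rule infsum_mono[OF s1[OF f] s0[OF f] bound[OF _ f]])
    also have "\<dots> \<le> B * norm1 \<mu> f"
      by (rule infsum_le_finite_sums[OF s0[OF f] fin[OF f]])
    finally show ?thesis using f by (simp add: T_def)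
  qed
  show "T \<in> Linf \<mu>"
  proof (rule LinfI[OF _ _ b])
    fix f g assume fg: "f \<in> L1 \<mu>" "g \<in> L1 \<mu>"
    have "infsum (\<lambda>j. t j (\<lambda>x. f x + g x)) J = infsum (\<lambda>j. t j f + t j g) J"
      using fg by (intro infsum_cong add) auto
    also have "\<dots> = infsum (\<lambda>j. t j f) J + infsum (\<lambda>j. t j g) J"
      by (rule infsum_add[OF Infinite_Sum.abs_summable_summable[OF s1[OF fg(1)]] Infinite_Sum.abs_summable_summable[OF s1[OF fg(2)]]])
    finally show "T (\<lambda>x. f x + g x) = T f + T g" using fg by (simp add: T_def L1_add)
  next
    fix c f assume f: "f \<in> L1 \<mu>"
    have "infsum (\<lambda>j. t j (\<lambda>x. c * f x)) J = infsum (\<lambda>j. c * t j f) J"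
      using f by (intro infsum_cong scale) auto
    then show "T (\<lambda>x. c * f x) = c * T f" using f by (simp add: T_def L1_scale infsum_cmult_right')
  next
    fix f assume "f \<notin> L1 \<mu>"
    then show "T f = 0" unfolding T_def by simp
  qed
  show "norm_inf \<mu> T \<le> B" by (rule norm_inf_least[OF b \<open>B \<ge> 0\<close>])
  fix j f assume j: "j \<in> J" and f: "f \<in> L1 \<mu>" and c: "cut (E j) f = f"
  have "t i f = 0" if "i \<in> J" "i \<noteq> j" for i
  proof -
    have "cut (E i) f = cut (E i) (cut (E j) f)" using c by simp
    also have "\<dots> = (\<lambda>x. 0)" using d[OF that(1) j that(2)] by (simp add: cut_cut cut_empty)
    finally show ?thesis using bound[OF that(1) f] by simp
  qed
  then have "infsum (\<lambda>j. t j f) J = infsum (\<lambda>j. t j f) {j}"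
    using j by (intro infsum_cong_neutral) auto
  then show "T f = t j f" using f by (simp add: T_def)
qed

text \<open>\<open>cfilter\<close> need not be countably generated, so dominated convergence runs
  along a sequence \<open>Q\<close> of compact sets that exhausts the support of \<open>f\<close> up
  to a null set. Enlarging the set only lowers the distance, which transfers the estimate to the
  filter.\<close>

lemma cut_tendsto:
  assumes f: "f \<in> L1 \<mu>"
  shows "((\<lambda>C. norm1 \<mu> (\<lambda>x. f x - cut C f x)) \<longlongrightarrow> 0) cfilter"
proof -
  obtain U :: "nat \<Rightarrow> 'g set" where U: "\<And>n. open (U n)" "\<And>n. emeasure \<mu> (U n) < \<infinity>" "\<And>x. x \<notin> (\<Union>n. U n) \<Longrightarrow> f x = 0"
    using integrable_open_support[OF L1D[OF f]] by blast
  have "\<exists>K. compact K \<and> K \<subseteq> U n \<and> emeasure \<mu> (U n - K) \<le> ennreal (1 / real (Suc k))" for n k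
  proof -
    have eU: "emeasure \<mu> (U n) = ennreal (measure \<mu> (U n))" using U(2)[of n] by (simp add: emeasure_eq_ennreal_measure)
    show ?thesis
    proof (cases "measure \<mu> (U n) \<le> 1 / real (Suc k)")
      case True
      then show ?thesis using eU by (intro exI[of _ "{}"]) (auto simp: ennreal_leI)
    next
      case False
      have "0 < 1 / real (Suc k)" by simp
      then have "ennreal (measure \<mu> (U n) - 1 / real (Suc k)) < emeasure \<mu> (U n)"
        unfolding eU using False by (intro ennreal_lessI) linarith+
      then obtain K where K: "compact K" "K \<subseteq> U n" "ennreal (measure \<mu> (U n) - 1 / real (Suc k)) < emeasure \<mu> K"
        unfolding inner[OF U(1)] less_SUP_iff by auto
      have eK: "emeasure \<mu> K = ennreal (measure \<mu> K)"
        using compact_finite[OF K(1)] by (simp add: emeasure_eq_ennreal_measure)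
      then have "measure \<mu> (U n) - 1 / real (Suc k) < measure \<mu> K"
        using K(3) False by (simp add: ennreal_less_iff del: of_nat_Suc)
      moreover have "emeasure \<mu> (U n - K) = ennreal (measure \<mu> (U n) - measure \<mu> K)"
        using K U compact_finite[OF K(1)] by (subst emeasure_Diff) (auto simp: eU eK ennreal_minus)
      ultimately show ?thesis using K by (intro exI[of _ K]) (auto intro!: ennreal_leI simp del: of_nat_Suc)
    qed
  qed
  then obtain K where K: "\<And>n k. compact (K n k)" "\<And>n k. K n k \<subseteq> U n" "\<And>n k. emeasure \<mu> (U n - K n k) \<le> ennreal (1 / real (Suc k))"
    by metis
  define Q where "Q j = (\<Union>n\<le>j. \<Union>k\<le>j. K n k)" for j
  have Qc: "compact (Q j)" for j unfolding Q_def using K by (intro compact_UN) auto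
  have Qm: "x \<in> Q j" if "x \<in> K n k" "n \<le> j" "k \<le> j" for x n k j using that unfolding Q_def by blast
  have "emeasure \<mu> (U n - (\<Union>j. Q j)) = 0" for n
  proof -
    have "emeasure \<mu> (U n - (\<Union>j. Q j)) \<le> ennreal (1 / real (Suc k))" for k
    proof -
      have "K n k \<subseteq> (\<Union>j. Q j)" using Qm[of _ n k "max n k"] by auto
      then have "emeasure \<mu> (U n - (\<Union>j. Q j)) \<le> emeasure \<mu> (U n - K n k)"
        using U K by (intro emeasure_mono sets.Diff open_sets compact_sets) auto
      then show ?thesis using K(3)[of n k] by (rule order_trans)
    qed
    moreover have "(\<lambda>k. ennreal (1 / real (Suc k))) \<longlonglongrightarrow> ennreal 0"
      by (intro tendsto_ennrealI LIMSEQ_Suc lim_1_over_n)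
    ultimately have "emeasure \<mu> (U n - (\<Union>j. Q j)) \<le> ennreal 0"
      by (intro LIMSEQ_le_const[where X = "\<lambda>k. ennreal (1 / real (Suc k))"]) auto
    then show ?thesis by simp
  qed
  then have "AE x in \<mu>. x \<notin> U n - (\<Union>j. Q j)" for n
    using U Qc by (intro AE_not_in null_setsI sets.Diff open_sets sets.countable_UN) auto
  then have "AE x in \<mu>. \<forall>n. x \<notin> U n - (\<Union>j. Q j)" unfolding AE_all_countable by blast
  then have ae: "AE x in \<mu>. f x = 0 \<or> (\<exists>j. x \<in> Q j)"
    by eventually_elim (use U(3) in blast)
  have lim: "(\<lambda>j. norm1 \<mu> (\<lambda>x. f x - cut (Q j) f x)) \<longlonglongrightarrow> 0"
  proof (rule norm1_dominated_convergence[OF f])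
    show "cut (Q j) f \<in> L1 \<mu>" for j using Qc[of j] f by (intro cut_L1) (auto simp: compact_imp_closed)
    show "AE x in \<mu>. (\<lambda>j. cut (Q j) f x) \<longlonglongrightarrow> f x"
      using ae
    proof eventually_elim
      case (elim x)
      show ?case
      proof (cases "f x = 0")
        case False
        then obtain i where i: "x \<in> Q i" using elim by blast
        have "\<forall>\<^sub>F j in sequentially. cut (Q j) f x = f x"
          using eventually_ge_at_top[of i]
        proof eventually_elim
          case (elim j)
          have "Q i \<subseteq> Q j" unfolding Q_def using elim by (intro UN_mono) auto
          then show ?case using i by (auto simp: cut_def)
        qed
        then show ?thesis by (rule tendsto_eventually)
      qed (simp add: cut_def)
    qed
    show "cmod (cut (Q j) f x) \<le> 2 * cmod (f x)" for j x by (simp add: cut_def indicator_def)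
  qed
  show ?thesis
  proof (rule tendstoI)
    fix e :: real assume "e > 0"
    then obtain j where j: "norm1 \<mu> (\<lambda>x. f x - cut (Q j) f x) < e"
      using order_tendstoD(2)[OF lim, of e] by (auto simp: eventually_sequentially)
    obtain C where C: "C \<in> cfam" "Q j \<subseteq> C" using cfam_cofinal[OF Qc] by blast
    show "\<forall>\<^sub>F C in cfilter. dist (norm1 \<mu> (\<lambda>x. f x - cut C f x)) 0 < e"
      unfolding eventually_cfilter
    proof (intro bexI[of _ C] ballI impI C)
      fix D assume D: "D \<in> cfam" "C \<subseteq> D"
      have "norm1 \<mu> (\<lambda>x. f x - cut D f x) \<le> norm1 \<mu> (\<lambda>x. f x - cut (Q j) f x)"
        using C D Qc[of j] cfam_compact[OF D(1)]
        by (intro norm1_mono L1_diff cut_L1 f) (auto simp: compact_imp_closed cut_def indicator_def)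
      then show "dist (norm1 \<mu> (\<lambda>x. f x - cut D f x)) 0 < e" using j by simp
    qed
  qed
qed

section \<open>Factorization through limits of translations\<close>

definition restrict_LUC :: "((('g \<Rightarrow> complex) \<Rightarrow> complex) \<Rightarrow> complex) \<Rightarrow> ('g \<Rightarrow> complex) \<Rightarrow> complex" where
  "restrict_LUC n = (\<lambda>F. if F \<in> LUC then n (LUC_embedding \<mu> F) else 0)"

text \<open>The equality of norms in a Hahn-Banach extension does not visibly survive weak* limits.
  Each of these conditions does, and norm at most 1 together with the value 1 at the constant
  function forces the norms on both spaces to be 1.\<close>

definition mean :: "((('g \<Rightarrow> complex) \<Rightarrow> complex) \<Rightarrow> complex) \<Rightarrow> bool" where
  "mean n \<longleftrightarrow> n \<in> Linf_dual \<mu> \<and> (\<forall>u\<in>Linf \<mu>. cmod (n u) \<le> norm_inf \<mu> u) \<and>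
     restrict_LUC n \<in> weak_star LUC sup_norm closure_of range point_evaluation \<and>
     n (LUC_embedding \<mu> (\<lambda>x. 1)) = 1"

lemma LUC_embedding_scale:
  "LUC_embedding \<mu> (\<lambda>x. c * F x) = (\<lambda>f. c * LUC_embedding \<mu> F f)"
  by (auto simp: LUC_embedding_def mult.assoc)

lemma restrict_LUC_cdual:
  assumes n: "n \<in> Linf_dual \<mu>" and b: "\<And>u. u \<in> Linf \<mu> \<Longrightarrow> cmod (n u) \<le> norm_inf \<mu> u"
  shows "restrict_LUC n \<in> cdual LUC sup_norm"
proof (rule cdualI[where C = 1])
  fix F G :: "'g \<Rightarrow> complex" assume FG: "F \<in> LUC" "G \<in> LUC"
  then show "restrict_LUC n (\<lambda>x. F x + G x) = restrict_LUC n F + restrict_LUC n G"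
    using n LUC_embedding_Linf(1) unfolding Linf_dual_def
    by (simp add: restrict_LUC_def LUC_add LUC_embedding_add cdual_add)
next
  fix c F assume F: "F \<in> (LUC :: ('g \<Rightarrow> complex) set)"
  then show "restrict_LUC n (\<lambda>x. c * F x) = c * restrict_LUC n F"
    using n LUC_embedding_Linf(1) unfolding Linf_dual_def
    by (simp add: restrict_LUC_def LUC_scale LUC_embedding_scale cdual_scale)
next
  fix F assume F: "F \<in> (LUC :: ('g \<Rightarrow> complex) set)"
  have "cmod (n (LUC_embedding \<mu> F)) \<le> sup_norm F"
    using b[OF LUC_embedding_Linf(1)[OF F]] LUC_embedding_Linf(2)[OF F] by linarith
  then show "cmod (restrict_LUC n F) \<le> 1 * sup_norm F" using F by (simp add: restrict_LUC_def)
qed (simp add: restrict_LUC_def)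

lemma sup_norm_one: "sup_norm (\<lambda>x::'g. 1::complex) \<le> 1"
  unfolding sup_norm_def by (rule norm_bound) (simp add: Bcontfun_inverse const_bcontfun)

lemma mean_hahn_banach:
  assumes "mean n"
  shows "hahn_banach_extension \<mu> (restrict_LUC n) n"
proof -
  have n: "n \<in> Linf_dual \<mu>" and b: "\<And>u. u \<in> Linf \<mu> \<Longrightarrow> cmod (n u) \<le> norm_inf \<mu> u"
    and one: "n (LUC_embedding \<mu> (\<lambda>x. 1)) = 1" using assms by (auto simp: mean_def)
  have c: "restrict_LUC n \<in> cdual LUC sup_norm" by (rule restrict_LUC_cdual[OF n b])
  have e1: "LUC_embedding \<mu> (\<lambda>x. 1) \<in> Linf \<mu>" "norm_inf \<mu> (LUC_embedding \<mu> (\<lambda>x. 1)) \<le> 1"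
    using LUC_embedding_Linf[OF const_LUC, of 1] sup_norm_one by auto
  have "dual_norm (Linf \<mu>) (norm_inf \<mu>) n = 1"
  proof (rule antisym)
    show "dual_norm (Linf \<mu>) (norm_inf \<mu>) n \<le> 1"
      by (rule dual_norm_least[where v = "LUC_embedding \<mu> (\<lambda>x. 1)"]) (use b e1 in auto)
    show "1 \<le> dual_norm (Linf \<mu>) (norm_inf \<mu>) n"
      unfolding dual_norm_def using n e1 one norm_inf_nonneg
      by (intro cSUP_upper2[OF cdual_bdd_above, of _ _ _ "LUC_embedding \<mu> (\<lambda>x. 1)"]) (auto simp: Linf_dual_def)
  qed
  moreover have "dual_norm LUC sup_norm (restrict_LUC n) = 1"
  proof (rule antisym)
    show "dual_norm LUC sup_norm (restrict_LUC n) \<le> 1"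
    proof (rule dual_norm_least[where v = "\<lambda>x. 1"])
      fix F assume F: "F \<in> (LUC :: ('g \<Rightarrow> complex) set)"
      show "cmod (restrict_LUC n F) \<le> 1 * sup_norm F"
        using b[OF LUC_embedding_Linf(1)[OF F]] LUC_embedding_Linf(2)[OF F] F by (simp add: restrict_LUC_def)
    qed (use const_LUC sup_norm_one in auto)
    show "1 \<le> dual_norm LUC sup_norm (restrict_LUC n)"
      unfolding dual_norm_def using c const_LUC one sup_norm_one sup_norm_nonneg
      by (intro cSUP_upper2[OF cdual_bdd_above, of _ _ _ "\<lambda>x. 1"]) (auto simp: restrict_LUC_def)
  qed
  ultimately show ?thesis using n by (simp add: hahn_banach_extension_def restrict_LUC_def)
qed

text \<open>Two families keep two roles apart: the \<open>\<phi> i\<close> converge to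
  \<open>n\<close> on all of \<open>Linf \<mu>\<close> but their restrictions need not lie in the
  closure, whereas the \<open>\<theta> i\<close> lie in it and agree with the
  \<open>\<phi> i\<close> on \<open>LUC\<close> in the limit. This covers smeared points against
  point evaluations as well as means against their own restrictions.\<close>

lemma mean_limit:
  assumes "H \<noteq> bot" and lim: "\<And>u. ((\<lambda>i. \<phi> i u) \<longlongrightarrow> n u) H"
    and \<phi>: "\<And>i. \<phi> i \<in> Linf_dual \<mu>" and b: "\<And>i u. u \<in> Linf \<mu> \<Longrightarrow> cmod (\<phi> i u) \<le> norm_inf \<mu> u"
    and \<theta>: "\<And>i. \<theta> i \<in> weak_star LUC sup_norm closure_of range point_evaluation"
    and \<theta>1: "\<And>i. \<theta> i (\<lambda>x. 1) = 1"
    and d: "\<And>F. F \<in> LUC \<Longrightarrow> ((\<lambda>i. \<phi> i (LUC_embedding \<mu> F) - \<theta> i F) \<longlongrightarrow> 0) H"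
  shows "mean n"
proof -
  have add: "n (\<lambda>f. u f + v f) = n u + n v" if "u \<in> Linf \<mu>" "v \<in> Linf \<mu>" for u v
  proof (rule tendsto_unique[OF \<open>H \<noteq> bot\<close> lim])
    have "\<phi> i (\<lambda>f. u f + v f) = \<phi> i u + \<phi> i v" for i
      using \<phi>[of i] that unfolding Linf_dual_def by (rule cdual_add)
    then show "((\<lambda>i. \<phi> i (\<lambda>f. u f + v f)) \<longlongrightarrow> n u + n v) H" by (simp add: tendsto_add lim)
  qed
  have scale: "n (\<lambda>f. c * u f) = c * n u" if "u \<in> Linf \<mu>" for c u
  proof (rule tendsto_unique[OF \<open>H \<noteq> bot\<close> lim])
    have "\<phi> i (\<lambda>f. c * u f) = c * \<phi> i u" for i
      using \<phi>[of i] that unfolding Linf_dual_def by (rule cdual_scale)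
    then show "((\<lambda>i. \<phi> i (\<lambda>f. c * u f)) \<longlongrightarrow> c * n u) H" by (simp add: tendsto_mult lim)
  qed
  have outside: "n u = 0" if "u \<notin> Linf \<mu>" for u
  proof (rule tendsto_unique[OF \<open>H \<noteq> bot\<close> lim])
    have "\<phi> i u = 0" for i using \<phi>[of i] that unfolding Linf_dual_def by (rule cdual_outside)
    then show "((\<lambda>i. \<phi> i u) \<longlongrightarrow> 0) H" by simp
  qed
  have bound: "cmod (n u) \<le> norm_inf \<mu> u" if "u \<in> Linf \<mu>" for u
    by (rule tendsto_upperbound[OF tendsto_norm[OF lim]]) (use b[OF that] \<open>H \<noteq> bot\<close> in auto)
  have n: "n \<in> Linf_dual \<mu>" unfolding Linf_dual_def
    by (rule cdualI[where C = 1]) (use add scale outside bound in auto)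
  have \<theta>l: "((\<lambda>i. \<theta> i F) \<longlongrightarrow> n (LUC_embedding \<mu> F)) H" if "F \<in> LUC" for F
    using tendsto_diff[OF lim[of "LUC_embedding \<mu> F"] d[OF that]] by simp
  have "n (LUC_embedding \<mu> (\<lambda>x. 1)) = 1"
    using \<theta>l[OF const_LUC, of 1] \<open>H \<noteq> bot\<close> by (simp add: \<theta>1 tendsto_const_iff)
  moreover have "restrict_LUC n \<in> weak_star LUC sup_norm closure_of range point_evaluation"
  proof (rule weak_star_closure_limit[OF _ restrict_LUC_cdual[OF n bound] \<open>H \<noteq> bot\<close> _ \<theta>])
    show "(LUC :: ('g \<Rightarrow> complex) set) \<noteq> {}" using const_LUC by blast
    show "((\<lambda>i. \<theta> i F) \<longlongrightarrow> restrict_LUC n F) H" if "F \<in> LUC" for F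
      using \<theta>l[OF that] that by (simp add: restrict_LUC_def)
  qed
  ultimately show ?thesis using n bound by (simp add: mean_def)
qed

text \<open>Compact sets grow and neighbourhoods shrink together along the product filter. In the
  limit the smeared points act on \<open>LUC\<close> like evaluations at the points
  \<open>x C\<close>, which places the restriction of \<open>n\<close> in the weak* closure.\<close>

lemma mean_along_translates:
  fixes x :: "'g set \<Rightarrow> 'g"
  shows "\<exists>H n. H \<noteq> bot \<and> H \<le> cfilter \<times>\<^sub>F nbhd_filter \<and> mean n \<and>
    (\<forall>u\<in>Linf \<mu>. ((\<lambda>(C, V). u (approx_point V (x C))) \<longlongrightarrow> n u) H)"
proof -
  \<comment> \<open>The value 0 for sets that are not neighbourhoods lets the norm bound and
    linearity hold for every pair \<open>p\<close>; eventually the default is not taken.\<close>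
  define \<phi> where "\<phi> p u = (if u \<in> Linf \<mu> \<and> nbhd (snd p) then u (approx_point (snd p) (x (fst p))) else 0)"
    for p :: "'g set \<times> 'g set" and u :: "('g \<Rightarrow> complex) \<Rightarrow> complex"
  have b: "cmod (\<phi> p u) \<le> norm_inf \<mu> u" if "u \<in> Linf \<mu>" for p u
  proof (cases "nbhd (snd p)")
    case True
    then show ?thesis
      using Linf_bound[OF that approx_point_L1(1)[OF True]] approx_point_L1(2)[OF True] that by (simp add: \<phi>_def)
  qed (simp add: \<phi>_def norm_inf_nonneg that)
  have "cmod (\<phi> p u) \<le> (if u \<in> Linf \<mu> then norm_inf \<mu> u else 0)" for p u
    using b[of u p] by (auto simp: \<phi>_def)
  moreover have "cfilter \<times>\<^sub>F nbhd_filter \<noteq> bot"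
    by (simp add: prod_filter_eq_bot cfilter_not_bot nbhd_filter_not_bot)
  ultimately obtain H n where H: "H \<noteq> bot" "H \<le> cfilter \<times>\<^sub>F nbhd_filter" "\<And>u. ((\<lambda>p. \<phi> p u) \<longlongrightarrow> n u) H"
    using cluster_functional[of "cfilter \<times>\<^sub>F nbhd_filter" \<phi> "\<lambda>u. if u \<in> Linf \<mu> then norm_inf \<mu> u else 0"] by blast
  have nbE: "\<forall>\<^sub>F p in H. nbhd (snd p)"
  proof (rule filter_leD[OF H(2)])
    have "\<forall>\<^sub>F V in nbhd_filter. nbhd V" unfolding eventually_nbhd_filter by (intro exI[of _ UNIV]) auto
    then show "\<forall>\<^sub>F p in cfilter \<times>\<^sub>F nbhd_filter. nbhd (snd p)"
      using eventually_prodI[OF eventually_True[of cfilter]] by fastforce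
  qed
  have \<phi>d: "\<phi> p \<in> Linf_dual \<mu>" for p unfolding Linf_dual_def
  proof (rule cdualI[where C = 1])
    fix u v assume "u \<in> Linf \<mu>" "v \<in> Linf \<mu>"
    then show "\<phi> p (\<lambda>f. u f + v f) = \<phi> p u + \<phi> p v" by (simp add: \<phi>_def Linf_add)
  next
    fix c u assume "u \<in> Linf \<mu>"
    then show "\<phi> p (\<lambda>f. c * u f) = c * \<phi> p u" by (simp add: \<phi>_def Linf_scale)
  qed (use b in \<open>auto simp: \<phi>_def\<close>)
  have "mean n"
  proof (rule mean_limit[OF H(1) H(3) \<phi>d b, where \<theta> = "\<lambda>p. point_evaluation (x (fst p))"])
    show "point_evaluation (x (fst p)) \<in> weak_star LUC sup_norm closure_of range point_evaluation" for p :: "'g set \<times> 'g set"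
      by (rule point_evaluation_closure)
    show "point_evaluation (x (fst p)) (\<lambda>x. 1) = 1" for p :: "'g set \<times> 'g set"
      by (simp add: point_evaluation_def const_LUC)
    fix F assume F: "F \<in> (LUC :: ('g \<Rightarrow> complex) set)"
    show "((\<lambda>p. \<phi> p (LUC_embedding \<mu> F) - point_evaluation (x (fst p)) F) \<longlongrightarrow> 0) H"
    proof (rule tendstoI)
      fix e :: real assume "e > 0"
      then obtain U where U: "open U" "0 \<in> U"
        "\<And>V y. nbhd V \<Longrightarrow> V \<subseteq> U \<Longrightarrow> cmod (LUC_embedding \<mu> F (approx_point V y) - F y) \<le> e / 2"
        using LUC_embedding_approx_point[OF F, of "e / 2"] by auto
      have "\<forall>\<^sub>F V in nbhd_filter. nbhd V \<and> V \<subseteq> U" unfolding eventually_nbhd_filter using U by blast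
      then have "\<forall>\<^sub>F p in cfilter \<times>\<^sub>F nbhd_filter. nbhd (snd p) \<and> snd p \<subseteq> U"
        using eventually_prodI[OF eventually_True[of cfilter]] by fastforce
      then have "\<forall>\<^sub>F p in H. nbhd (snd p) \<and> snd p \<subseteq> U" by (rule filter_leD[OF H(2)])
      then show "\<forall>\<^sub>F p in H. dist (\<phi> p (LUC_embedding \<mu> F) - point_evaluation (x (fst p)) F) 0 < e"
      proof eventually_elim
        case (elim p)
        then have "cmod (LUC_embedding \<mu> F (approx_point (snd p) (x (fst p))) - F (x (fst p))) \<le> e / 2" using U(3) by blast
        then show ?case using \<open>e > 0\<close> elim F LUC_embedding_Linf(1)[OF F] by (simp add: \<phi>_def point_evaluation_def)
      qed
    qed
  qed
  moreover have "((\<lambda>(C, V). u (approx_point V (x C))) \<longlongrightarrow> n u) H" if "u \<in> Linf \<mu>" for u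
  proof (rule Lim_transform_eventually[OF H(3)])
    show "\<forall>\<^sub>F p in H. \<phi> p u = (case p of (C, V) \<Rightarrow> u (approx_point V (x C)))"
      using nbE by eventually_elim (simp add: \<phi>_def that case_prod_beta)
  qed
  ultimately show ?thesis using H(1,2) by (intro exI conjI ballI)
qed

text \<open>\<open>T\<close> carries, for each pair \<open>(k, C)\<close>, a copy of
  \<open>h k\<close> cut to \<open>C\<close> and moved to the place \<open>C + x (k, C)\<close>; the
  places are disjoint, so the norm of \<open>T\<close> stays at most \<open>B\<close>. Testing
  \<open>T\<close> near \<open>x (k, C)\<close> reads the copy back. The first error replaces the
  convolution by \<open>f\<close>; the second cuts \<open>f\<close> to \<open>C\<close> and counts
  twice, because it is made in \<open>T\<close> and in \<open>h k\<close>.\<close>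

lemma translate_series:
  fixes h :: "'k \<Rightarrow> ('g \<Rightarrow> complex) \<Rightarrow> complex" and K :: "'k set"
  assumes nc: "\<not> compact (UNIV :: 'g set)" and K: "(card_of K, card_of min_cover) \<in> ordLeq"
    and hh: "\<forall>k\<in>K. h k \<in> Linf \<mu> \<and> norm_inf \<mu> (h k) \<le> B" and B: "B \<ge> 0"
  shows "\<exists>T\<in>Linf \<mu>. \<exists>x. \<forall>k\<in>K. \<forall>C\<in>cfam. \<forall>V f. nbhd V \<longrightarrow> f \<in> L1 \<mu> \<longrightarrow>
       cmod (T (convolution \<mu> f (approx_point V (x (k, C)))) - h k f) \<le>
       B * norm1 \<mu> (\<lambda>y. convolution \<mu> f (bump V) y - f y) + 2 * B * norm1 \<mu> (\<lambda>y. f y - cut C f y)"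
proof -
  have h: "h k \<in> Linf \<mu>" and hB: "norm_inf \<mu> (h k) \<le> B" if "k \<in> K" for k using hh that by auto
  define J where "J = K \<times> cfam"
  have cJ: "(card_of J, card_of min_cover) \<in> ordLeq" unfolding J_def
    using min_cover_infinite[OF nc] K cfam_card[OF nc]
    by (intro card_of_Times_ordLeq_infinite_Field) (auto simp: Field_card_of card_of_card_order_on)
  have cc: "compact (snd j)" if "j \<in> J" for j using that cfam_compact by (auto simp: J_def)
  have "\<exists>x. \<forall>i\<in>J. \<forall>j\<in>J. i \<noteq> j \<longrightarrow> (\<lambda>c. c + x i) ` snd i \<inter> (\<lambda>c. c + x j) ` snd j = {}"
    by (rule disjoint_translates[OF cc cJ])
  then obtain x where x': "\<forall>i\<in>J. \<forall>j\<in>J. i \<noteq> j \<longrightarrow> (\<lambda>c. c + x i) ` snd i \<inter> (\<lambda>c. c + x j) ` snd j = {}"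
    by (elim exE)
  have x: "(\<lambda>c. c + x i) ` snd i \<inter> (\<lambda>c. c + x j) ` snd j = {}" if "i \<in> J" "j \<in> J" "i \<noteq> j" for i j
    by (rule x'[rule_format, OF that])
  define E where "E j = (\<lambda>c. c + x j) ` snd j" for j
  define t where "t j f = h (fst j) (cut (snd j) (rtrans (x j) f))" for j f
  have Cb: "snd j \<in> sets borel" if "j \<in> J" for j using that cfam_compact by (auto simp: J_def compact_imp_closed)
  have Eb: "E j \<in> sets borel" if "j \<in> J" for j
  proof -
    have "compact (E j)" unfolding E_def using that cfam_compact
      by (intro compact_continuous_image cont_right) (auto simp: J_def)
    then show ?thesis by (simp add: compact_imp_closed)
  qed
  have hk: "h (fst j) \<in> Linf \<mu>" "norm_inf \<mu> (h (fst j)) \<le> B" if "j \<in> J" for j using that h hB by (auto simp: J_def)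
  have cL: "cut (snd j) (rtrans a f) \<in> L1 \<mu>" if "j \<in> J" "f \<in> L1 \<mu>" for j a f
    by (intro cut_L1 Cb that rtrans_L1)
  define T where "T f = (if f \<in> L1 \<mu> then infsum (\<lambda>j. t j f) J else 0)" for f
  have TT: "T \<in> Linf \<mu>" "norm_inf \<mu> T \<le> B" "\<And>j f. j \<in> J \<Longrightarrow> f \<in> L1 \<mu> \<Longrightarrow> cut (E j) f = f \<Longrightarrow> T f = t j f"
  proof -
    have a: "t j (\<lambda>x. f x + g x) = t j f + t j g" if "j \<in> J" "f \<in> L1 \<mu>" "g \<in> L1 \<mu>" for j f g
      unfolding t_def rtrans_add cut_add by (rule Linf_plus[OF hk(1)[OF that(1)] cL[OF that(1,2)] cL[OF that(1,3)]])
    have s: "t j (\<lambda>x. c * f x) = c * t j f" if "j \<in> J" "f \<in> L1 \<mu>" for j c f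
      unfolding t_def rtrans_scale cut_scale by (rule Linf_times[OF hk(1)[OF that(1)] cL[OF that]])
    have b: "cmod (t j f) \<le> B * norm1 \<mu> (cut (E j) f)" if "j \<in> J" "f \<in> L1 \<mu>" for j f
    proof -
      have "norm1 \<mu> (cut (snd j) (rtrans (x j) f)) = norm1 \<mu> (cut (E j) f)"
        unfolding cut_rtrans E_def[symmetric] by (intro rtrans_L1 cut_L1 Eb that)
      then have "cmod (t j f) \<le> norm_inf \<mu> (h (fst j)) * norm1 \<mu> (cut (E j) f)"
        unfolding t_def using Linf_bound[OF hk(1)[OF that(1)] cL[OF that, of "x j"]] by simp
      also have "\<dots> \<le> B * norm1 \<mu> (cut (E j) f)" by (intro mult_right_mono hk that) simp
      finally show ?thesis .
    qed
    have d: "E i \<inter> E j = {}" if "i \<in> J" "j \<in> J" "i \<noteq> j" for i j unfolding E_def by (rule x[OF that])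
    note R = disjoint_sum_Linf[of J E t B, OF Eb d a s b B, folded T_def]
    show "T \<in> Linf \<mu>" by (rule R(1))
    show "norm_inf \<mu> T \<le> B" by (rule R(2))
    show "T f = t j f" if "j \<in> J" "f \<in> L1 \<mu>" "cut (E j) f = f" for j f
      by (rule R(3)) (use that in auto)
  qed
  show ?thesis
  proof (intro bexI[OF _ TT(1)] exI[of _ x] ballI allI impI)
    fix k C V f assume kC: "k \<in> K" "C \<in> cfam" and V: "nbhd V" and f: "f \<in> L1 \<mu>"
    define j where "j = (k, C)"
    define a where "a = x j"
    have j: "j \<in> J" using kC by (simp add: j_def J_def)
    have Cbo: "C \<in> sets borel" using Cb[OF j] by (simp add: j_def)
    have cv: "convolution \<mu> f (bump V) \<in> L1 \<mu>" by (intro convolution_L1 f bump_L1 V)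
    have cf: "cut C f \<in> L1 \<mu>" by (intro cut_L1 Cbo f)
    let ?r = "rtrans (- a)"
    \<comment> \<open>Translating the right factor translates the convolution, so the error of the
      approximate identity is that of the untranslated bump, uniformly in \<open>a\<close>.\<close>
    have e0: "convolution \<mu> f (approx_point V a) = ?r (convolution \<mu> f (bump V))"
      unfolding approx_point_def convolution_rtrans ..
    have e1: "T (?r (cut C f)) = h k (cut C f)"
    proof -
      have "cut (E j) (?r (cut C f)) = ?r (cut C f)"
        using rtrans_cut[of a C f] by (simp add: E_def a_def j_def)
      then have "T (?r (cut C f)) = t j (?r (cut C f))" using j cf rtrans_L1 by (intro TT(3)) auto
      also have "\<dots> = h k (cut C f)"
        by (simp add: t_def a_def[symmetric] rtrans_inverse cut_cut) (simp add: j_def cut_cut)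
      finally show ?thesis .
    qed
    have Tb: "cmod (T u) \<le> B * norm1 \<mu> u" if "u \<in> L1 \<mu>" for u
      using Linf_bound[OF TT(1) that] mult_right_mono[OF TT(2), of "norm1 \<mu> u"] by simp
    have hb: "cmod (h k u) \<le> B * norm1 \<mu> u" if "u \<in> L1 \<mu>" for u
      using Linf_bound[OF h[OF kC(1)] that] mult_right_mono[OF hB[OF kC(1)], of "norm1 \<mu> u"] by simp
    have "T (?r (convolution \<mu> f (bump V))) - T (?r f) = T (?r (\<lambda>y. convolution \<mu> f (bump V) y - f y))"
      unfolding rtrans_diff by (rule Linf_minus[symmetric, OF TT(1)]) (intro rtrans_L1 cv f)+
    then have d1: "cmod (T (?r (convolution \<mu> f (bump V))) - T (?r f)) \<le> B * norm1 \<mu> (\<lambda>y. convolution \<mu> f (bump V) y - f y)"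
      using Tb[OF rtrans_L1(1)[OF L1_diff[OF cv f], of "- a"]] rtrans_L1(2)[OF L1_diff[OF cv f], of "- a"] by simp
    have "T (?r f) - T (?r (cut C f)) = T (?r (\<lambda>y. f y - cut C f y))"
      unfolding rtrans_diff by (rule Linf_minus[symmetric, OF TT(1)]) (intro rtrans_L1 cf f)+
    then have d2: "cmod (T (?r f) - T (?r (cut C f))) \<le> B * norm1 \<mu> (\<lambda>y. f y - cut C f y)"
      using Tb[OF rtrans_L1(1)[OF L1_diff[OF f cf], of "- a"]] rtrans_L1(2)[OF L1_diff[OF f cf], of "- a"] by simp
    have "h k f - h k (cut C f) = h k (\<lambda>y. f y - cut C f y)"
      by (rule Linf_minus[symmetric, OF h[OF kC(1)] f cf])
    then have d3: "cmod (h k f - h k (cut C f)) \<le> B * norm1 \<mu> (\<lambda>y. f y - cut C f y)"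
      using hb[OF L1_diff[OF f cf]] by simp
    have eq: "T (convolution \<mu> f (approx_point V a)) - h k f =
       (T (?r (convolution \<mu> f (bump V))) - T (?r f)) + (T (?r f) - T (?r (cut C f))) - (h k f - h k (cut C f))"
      by (simp add: e0 e1)
    have "cmod (T (convolution \<mu> f (approx_point V a)) - h k f) \<le>
       cmod (T (?r (convolution \<mu> f (bump V))) - T (?r f)) + cmod (T (?r f) - T (?r (cut C f))) + cmod (h k f - h k (cut C f))"
      unfolding eq by (rule order_trans[OF norm_triangle_ineq4 add_right_mono[OF norm_triangle_ineq]])
    then have "cmod (T (convolution \<mu> f (approx_point V a)) - h k f) \<le>
       B * norm1 \<mu> (\<lambda>y. convolution \<mu> f (bump V) y - f y) + 2 * B * norm1 \<mu> (\<lambda>y. f y - cut C f y)"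
      using d1 d2 d3 by linarith
    then show "cmod (T (convolution \<mu> f (approx_point V (x (k, C)))) - h k f) \<le>
       B * norm1 \<mu> (\<lambda>y. convolution \<mu> f (bump V) y - f y) + 2 * B * norm1 \<mu> (\<lambda>y. f y - cut C f y)"
      by (simp only: a_def j_def)
  qed
qed

text \<open>For fixed \<open>k\<close> both errors in \<open>translate_series\<close> vanish as
  \<open>C\<close> grows and \<open>V\<close> shrinks. \<open>T\<close> is chosen before
  \<open>k\<close>, hence common to all means \<open>N k\<close>.\<close>

lemma mean_factorization:
  fixes h :: "'k \<Rightarrow> ('g \<Rightarrow> complex) \<Rightarrow> complex" and K :: "'k set"
  assumes nc: "\<not> compact (UNIV :: 'g set)" and K: "(card_of K, card_of min_cover) \<in> ordLeq"
    and hh: "\<forall>k\<in>K. h k \<in> Linf \<mu> \<and> norm_inf \<mu> (h k) \<le> B" and B: "B \<ge> 0"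
  shows "\<exists>T\<in>Linf \<mu>. \<exists>N. \<forall>k\<in>K. mean (N k) \<and> (\<forall>f\<in>L1 \<mu>. N k (arens1_hf \<mu> T f) = h k f)"
proof -
  obtain T where T: "T \<in> Linf \<mu>" and "\<exists>x. \<forall>k\<in>K. \<forall>C\<in>cfam. \<forall>V f. nbhd V \<longrightarrow> f \<in> L1 \<mu> \<longrightarrow>
       cmod (T (convolution \<mu> f (approx_point V (x (k, C)))) - h k f) \<le>
       B * norm1 \<mu> (\<lambda>y. convolution \<mu> f (bump V) y - f y) + 2 * B * norm1 \<mu> (\<lambda>y. f y - cut C f y)"
    using translate_series[OF nc K hh B] by (elim bexE)
  then obtain x where Tx': "\<forall>k\<in>K. \<forall>C\<in>cfam. \<forall>V f. nbhd V \<longrightarrow> f \<in> L1 \<mu> \<longrightarrow>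
       cmod (T (convolution \<mu> f (approx_point V (x (k, C)))) - h k f) \<le>
       B * norm1 \<mu> (\<lambda>y. convolution \<mu> f (bump V) y - f y) + 2 * B * norm1 \<mu> (\<lambda>y. f y - cut C f y)"
    by (elim exE)
  note Tx = Tx'[rule_format]
  have "\<exists>n. mean n \<and> (\<forall>f\<in>L1 \<mu>. n (arens1_hf \<mu> T f) = h k f)" if k: "k \<in> K" for k
  proof -
    obtain H n where H: "H \<noteq> bot" "H \<le> cfilter \<times>\<^sub>F nbhd_filter" "mean n"
      "\<forall>u\<in>Linf \<mu>. ((\<lambda>(C, V). u (approx_point V (x (k, C)))) \<longlongrightarrow> n u) H"
      using mean_along_translates[of "\<lambda>C. x (k, C)"] by (elim exE conjE)
    have "n (arens1_hf \<mu> T f) = h k f" if f: "f \<in> L1 \<mu>" for f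
    proof (rule tendsto_unique[OF H(1) H(4)[rule_format, OF arens1_hf_Linf[OF T f]]])
      show "((\<lambda>(C, V). arens1_hf \<mu> T f (approx_point V (x (k, C)))) \<longlongrightarrow> h k f) H"
      proof (rule tendsto_mono[OF H(2)], rule tendstoI)
        fix e :: real assume "e > 0"
        \<comment> \<open>The two errors add up to \<open>3 * B * e'\<close>, which is at most
          \<open>3 * e / 4\<close>; the added 1 covers \<open>B = 0\<close>.\<close>
        define e' where "e' = e / (4 * (B + 1))"
        have e': "e' > 0" unfolding e'_def using \<open>e > 0\<close> B by simp
        have c1: "\<forall>\<^sub>F C in cfilter. norm1 \<mu> (\<lambda>y. f y - cut C f y) < e'"
          using order_tendstoD(2)[OF cut_tendsto[OF f] e'] .
        have c2: "\<forall>\<^sub>F C in cfilter. C \<in> cfam"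
          unfolding eventually_cfilter using cfam_empty by blast
        have v: "\<forall>\<^sub>F V in nbhd_filter. nbhd V \<and> norm1 \<mu> (\<lambda>y. convolution \<mu> f (bump V) y - f y) < e'"
          unfolding eventually_nbhd_filter using bump_approx_identity[OF f, rule_format, OF e'] by auto
        show "\<forall>\<^sub>F p in cfilter \<times>\<^sub>F nbhd_filter. dist (case p of (C, V) \<Rightarrow> arens1_hf \<mu> T f (approx_point V (x (k, C)))) (h k f) < e"
          using eventually_prodI[OF eventually_conj[OF c1 c2] v]
        proof eventually_elim
          case (elim p)
          obtain C V where p: "p = (C, V)" by (cases p)
          have q: "norm1 \<mu> (\<lambda>y. f y - cut C f y) < e'" "C \<in> cfam" "nbhd V" "norm1 \<mu> (\<lambda>y. convolution \<mu> f (bump V) y - f y) < e'"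
            using elim by (simp_all add: p)
          have "cmod (T (convolution \<mu> f (approx_point V (x (k, C)))) - h k f) \<le> B * e' + 2 * B * e'"
            using B q by (intro order_trans[OF Tx[OF k q(2,3) f]] add_mono mult_left_mono) auto
          also have "\<dots> = 3 * (B * e')" by simp
          also have "\<dots> \<le> 3 * ((B + 1) * e')" using e' by (intro mult_left_mono mult_right_mono) auto
          also have "\<dots> = 3 * e / 4"
          proof -
            have "q * (e / (4 * q)) = e / 4" if "q > 0" for q :: real using that by (simp add: field_simps)
            from this[of "B + 1"] B show ?thesis by (simp add: e'_def)
          qed
          also have "\<dots> < e" using \<open>e > 0\<close> by simp
          finally show ?case using approx_point_L1(1)[OF q(3)] by (simp add: p arens1_hf_def dist_norm)
        qed
      qed
    qed
    then show ?thesis using H(3) by blast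
  qed
  then have "\<exists>N. \<forall>k\<in>K. mean (N k) \<and> (\<forall>f\<in>L1 \<mu>. N k (arens1_hf \<mu> T f) = h k f)" by (intro bchoice) simp
  then show ?thesis using T by (rule bexI)
qed

end

section \<open>From equality of Arens products to weak* null families\<close>

locale central = haar \<mu> for \<mu> :: "'g::{topological_group_add, t2_space} measure" +
  fixes m :: "(('g \<Rightarrow> complex) \<Rightarrow> complex) \<Rightarrow> complex"
  assumes noncompact: "\<not> compact (UNIV :: 'g set)"
    and m_dual: "m \<in> Linf_dual \<mu>"
    and arens_eq: "\<And>\<psi> n. \<psi> \<in> weak_star LUC sup_norm closure_of range point_evaluation \<Longrightarrow>
           hahn_banach_extension \<mu> \<psi> n \<Longrightarrow> arens1 \<mu> m n = arens2 \<mu> m n"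
begin

text \<open>Both products are evaluated at \<open>T\<close>: the left one applies \<open>m\<close>
  to the functional \<open>arens1_nh \<mu> n T\<close>, which \<open>eq\<close> identifies with
  \<open>k\<close>, and the right one applies \<open>n\<close> to
  \<open>arens2_hm \<mu> T m\<close>.\<close>

lemma arens_mean:
  assumes n: "mean n" and T: "T \<in> Linf \<mu>" and eq: "\<And>f. f \<in> L1 \<mu> \<Longrightarrow> n (arens1_hf \<mu> T f) = k f"
    and k: "k \<in> Linf \<mu>"
  shows "m k = n (arens2_hm \<mu> T m)"
proof -
  have "arens1 \<mu> m n = arens2 \<mu> m n"
    using n by (intro arens_eq[OF _ mean_hahn_banach[OF n]]) (simp add: mean_def)
  then have "arens1 \<mu> m n T = arens2 \<mu> m n T" by simp
  moreover have "arens1_nh \<mu> n T = k"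
  proof
    show "arens1_nh \<mu> n T f = k f" for f
      using eq[of f] Linf_outside[OF k, of f] by (simp add: arens1_nh_def)
  qed
  ultimately show ?thesis using T by (simp add: arens1_def arens2_def)
qed

text \<open>
  The functional \<^term>\<open>arens2_hm \<mu> T m\<close> is never shown to lie in \<^term>\<open>Linf \<mu>\<close>: a mean vanishes
  outside \<^term>\<open>Linf \<mu>\<close>, and pointwise limits of means are taken on all arguments.
\<close>
lemma weak_star_null:
  fixes h :: "'k \<Rightarrow> ('g \<Rightarrow> complex) \<Rightarrow> complex" and K :: "'k set"
  assumes K: "(card_of K, card_of min_cover) \<in> ordLeq"
    and hh: "\<forall>k\<in>K. h k \<in> Linf \<mu> \<and> norm_inf \<mu> (h k) \<le> B" and B: "B \<ge> 0"
    and F: "\<forall>\<^sub>F k in F. k \<in> K" and lim: "\<And>f. f \<in> L1 \<mu> \<Longrightarrow> ((\<lambda>k. h k f) \<longlongrightarrow> 0) F"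
  shows "((\<lambda>k. m (h k)) \<longlongrightarrow> 0) F"
proof (rule ccontr)
  have h: "h k \<in> Linf \<mu>" if "k \<in> K" for k using hh that by auto
  assume "\<not> ((\<lambda>k. m (h k)) \<longlongrightarrow> 0) F"
  then obtain e where e: "e > 0" "\<not> (\<forall>\<^sub>F k in F. dist (m (h k)) 0 < e)" unfolding tendsto_iff by blast
  \<comment> \<open>If convergence fails, indices with \<open>cmod (m (h k)) \<ge> e\<close> occur
    frequently along \<open>F\<close>; the cluster point is taken along these alone.\<close>
  define G where "G = inf F (principal {k \<in> K. cmod (m (h k)) \<ge> e})"
  have "G \<noteq> bot"
  proof
    assume "G = bot"
    then have "\<forall>\<^sub>F k in F. k \<notin> {k \<in> K. cmod (m (h k)) \<ge> e}"
      unfolding G_def trivial_limit_def eventually_inf_principal by simp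
    then have "\<forall>\<^sub>F k in F. dist (m (h k)) 0 < e"
      using F by eventually_elim auto
    then show False using e by blast
  qed
  have GE: "\<forall>\<^sub>F k in G. k \<in> K \<and> cmod (m (h k)) \<ge> e"
    unfolding G_def eventually_inf_principal by simp
  then obtain k0 where k0: "k0 \<in> K" using \<open>G \<noteq> bot\<close> eventually_happens' by blast
  obtain T where T: "T \<in> Linf \<mu>" and "\<exists>N. \<forall>k\<in>K. mean (N k) \<and> (\<forall>f\<in>L1 \<mu>. N k (arens1_hf \<mu> T f) = h k f)"
    using mean_factorization[OF noncompact K hh B] by (elim bexE)
  then obtain N where N': "\<forall>k\<in>K. mean (N k) \<and> (\<forall>f\<in>L1 \<mu>. N k (arens1_hf \<mu> T f) = h k f)"
    by (elim exE)
  have N: "mean (N k)" and Nh: "\<And>f. f \<in> L1 \<mu> \<Longrightarrow> N k (arens1_hf \<mu> T f) = h k f" if "k \<in> K" for k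
    using N' that by simp_all
  \<comment> \<open>The mean at \<open>k0\<close> fills in the indices outside \<open>K\<close>,
    since the limit lemmas ask for their conditions at all indices.\<close>
  define \<phi> where "\<phi> k = (if k \<in> K then N k else N k0)" for k
  have \<phi>: "mean (\<phi> k)" for k using N k0 by (simp add: \<phi>_def)
  have "cmod (\<phi> k u) \<le> (if u \<in> Linf \<mu> then norm_inf \<mu> u else 0)" for k u
  proof (cases "u \<in> Linf \<mu>")
    case True
    then show ?thesis using \<phi>[of k] by (simp add: mean_def)
  next
    case False
    have "\<phi> k \<in> cdual (Linf \<mu>) (norm_inf \<mu>)" using \<phi>[of k] by (simp add: mean_def Linf_dual_def)
    from cdual_outside[OF this False] show ?thesis using False by simp
  qed
  from cluster_functional[where \<phi> = \<phi>, OF \<open>G \<noteq> bot\<close> this] obtain H n where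
    H: "H \<noteq> bot" "H \<le> G" "\<And>u. ((\<lambda>k. \<phi> k u) \<longlongrightarrow> n u) H" by blast
  have HF: "H \<le> F" using H(2) by (simp add: G_def)
  have HE: "\<forall>\<^sub>F k in H. k \<in> K \<and> cmod (m (h k)) \<ge> e" by (rule filter_leD[OF H(2) GE])
  have n: "mean n"
  proof (rule mean_limit[OF H(1,3), where \<theta> = "\<lambda>k. restrict_LUC (\<phi> k)"])
    show "restrict_LUC (\<phi> k) (\<lambda>x. 1) = 1" for k
      using \<phi>[of k] by (simp add: mean_def restrict_LUC_def const_LUC)
    show "((\<lambda>k. \<phi> k (LUC_embedding \<mu> F) - restrict_LUC (\<phi> k) F) \<longlongrightarrow> 0) H" if "F \<in> LUC" for F
      using that by (simp add: restrict_LUC_def)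
  qed (use \<phi> in \<open>auto simp: mean_def\<close>)
  have z: "n (arens1_hf \<mu> T f) = 0" if f: "f \<in> L1 \<mu>" for f
  proof (rule tendsto_unique[OF H(1) H(3)])
    show "((\<lambda>k. \<phi> k (arens1_hf \<mu> T f)) \<longlongrightarrow> 0) H"
    proof (rule Lim_transform_eventually[OF tendsto_mono[OF HF lim[OF f]]])
      show "\<forall>\<^sub>F k in H. h k f = \<phi> k (arens1_hf \<mu> T f)"
        using HE by eventually_elim (simp add: \<phi>_def Nh f)
    qed
  qed
  \<comment> \<open>The cluster point is itself a mean with vanishing left product at
    \<open>T\<close>, so the hypothesis on \<open>m\<close> applies to it too and its value at this
    argument is \<open>m\<close> at 0. The same value is the limit of \<open>m (h k)\<close>, which
    stays away from 0 along \<open>H\<close>.\<close>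
  have "n (arens2_hm \<mu> T m) = m (\<lambda>f. 0)"
    by (rule arens_mean[OF n T z Linf_zero, symmetric])
  also have "\<dots> = 0"
    using cdual_scale[OF m_dual[unfolded Linf_dual_def] Linf_zero, of 0] by simp
  finally have n0: "n (arens2_hm \<mu> T m) = 0" .
  have "((\<lambda>k. m (h k)) \<longlongrightarrow> 0) H"
  proof (rule Lim_transform_eventually[OF H(3)[of "arens2_hm \<mu> T m", unfolded n0]])
    show "\<forall>\<^sub>F k in H. \<phi> k (arens2_hm \<mu> T m) = m (h k)"
      using HE by eventually_elim (simp add: \<phi>_def arens_mean[OF N T Nh h])
  qed
  then have "\<forall>\<^sub>F k in H. dist (m (h k)) 0 < e" using e(1) by (rule tendstoD)
  with HE have "\<forall>\<^sub>F k in H. False" by eventually_elim simp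
  then show False using H(1) by (simp add: eventually_False)
qed

end

section \<open>Densities of signed and complex measures\<close>

text \<open>The density may take infinite values, but the total mass \<open>P (space M)\<close> is a
  real number, so this happens only on a null set and \<open>enn2real\<close> does no harm.\<close>

lemma (in finite_measure) radon_nikodym_nonneg:
  fixes P :: "'a set \<Rightarrow> real"
  assumes pos: "\<And>A. A \<in> sets M \<Longrightarrow> P A \<ge> 0"
    and sums: "\<And>A :: nat \<Rightarrow> 'a set. range A \<subseteq> sets M \<Longrightarrow> disjoint_family A \<Longrightarrow> (\<lambda>i. P (A i)) sums P (\<Union>i. A i)"
    and null: "\<And>A. A \<in> sets M \<Longrightarrow> emeasure M A = 0 \<Longrightarrow> P A = 0"
  shows "\<exists>f :: 'a \<Rightarrow> real. integrable M f \<and> (\<forall>A\<in>sets M. P A = (\<integral>x. indicator A x * f x \<partial>M))"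
proof -
  define N where "N = measure_of (space M) (sets M) (\<lambda>A. ennreal (P A))"
  have sN: "sets N = sets M" by (simp add: N_def sets.space_closed)
  have P0: "P {} = 0" by (rule null) auto
  have eN: "emeasure N A = ennreal (P A)" if "A \<in> sets M" for A
    unfolding N_def
  proof (rule emeasure_measure_of_sigma)
    show "sigma_algebra (space M) (sets M)" by (rule sets.sigma_algebra_axioms)
    show "positive (sets M) (\<lambda>A. ennreal (P A))" by (simp add: positive_def P0)
    show "countably_additive (sets M) (\<lambda>A. ennreal (P A))"
      unfolding countably_additive_def
    proof (intro allI impI)
      fix A :: "nat \<Rightarrow> 'a set" assume A: "range A \<subseteq> sets M" "disjoint_family A"
      then show "(\<Sum>i. ennreal (P (A i))) = ennreal (P (\<Union>(range A)))"
        by (intro suminf_ennreal_eq pos sums) auto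
    qed
  qed (rule that)
  have "absolutely_continuous M N"
    unfolding absolutely_continuous_def using null eN sN by (auto simp: null_sets_def)
  then obtain g where g[measurable]: "g \<in> borel_measurable M" and dg: "density M g = N"
    using Radon_Nikodym sN by blast
  have ig: "(\<integral>\<^sup>+x. g x * indicator A x \<partial>M) = ennreal (P A)" if "A \<in> sets M" for A
    using that emeasure_density[OF g that] by (simp add: dg eN)
  have "(\<integral>\<^sup>+x. g x \<partial>M) = (\<integral>\<^sup>+x. g x * indicator (space M) x \<partial>M)"
    by (intro nn_integral_cong) simp
  then have ig0: "(\<integral>\<^sup>+x. g x \<partial>M) = ennreal (P (space M))" using ig[OF sets.top] by simp
  then have fin: "AE x in M. g x \<noteq> \<infinity>"
    by (intro nn_integral_noteq_infinite) auto
  show ?thesis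
  proof (intro exI[of _ "\<lambda>x. enn2real (g x)"] conjI ballI)
    have "(\<integral>\<^sup>+x. ennreal (norm (enn2real (g x))) \<partial>M) \<le> (\<integral>\<^sup>+x. g x \<partial>M)"
      by (intro nn_integral_mono) (simp add: ennreal_enn2real_if)
    also have "\<dots> < \<infinity>" by (simp add: ig0)
    finally show "integrable M (\<lambda>x. enn2real (g x))" by (intro integrableI_bounded) auto
    fix A assume A[measurable]: "A \<in> sets M"
    have "(\<integral>x. indicator A x * enn2real (g x) \<partial>M) = enn2real (\<integral>\<^sup>+x. ennreal (indicator A x * enn2real (g x)) \<partial>M)"
      by (rule integral_eq_nn_integral) auto
    also have "(\<integral>\<^sup>+x. ennreal (indicator A x * enn2real (g x)) \<partial>M) = (\<integral>\<^sup>+x. g x * indicator A x \<partial>M)"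
      using fin by (intro nn_integral_cong_AE) (auto simp: indicator_def ennreal_enn2real_if)
    finally show "P A = (\<integral>x. indicator A x * enn2real (g x) \<partial>M)"
      by (simp add: ig[OF A] pos[OF A])
  qed
qed

text \<open>Jordan decomposition: \<open>\<nu>\<close> is the difference of \<open>P\<close> and
  \<open>P - \<nu>\<close>, both nonnegative and countably additive. Joining subsets of disjoint
  sets makes \<open>P\<close> superadditive; conversely a competitor inside a union splits along the
  pieces. The upper bound \<open>c\<close> keeps \<open>P\<close> finite.\<close>

lemma (in finite_measure) radon_nikodym_real:
  fixes \<nu> :: "'a set \<Rightarrow> real"
  assumes sums: "\<And>A :: nat \<Rightarrow> 'a set. range A \<subseteq> sets M \<Longrightarrow> disjoint_family A \<Longrightarrow> (\<lambda>i. \<nu> (A i)) sums \<nu> (\<Union>i. A i)"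
    and null: "\<And>A. A \<in> sets M \<Longrightarrow> emeasure M A = 0 \<Longrightarrow> \<nu> A = 0"
    and bound: "\<And>A. A \<in> sets M \<Longrightarrow> \<nu> A \<le> c"
  shows "\<exists>f :: 'a \<Rightarrow> real. integrable M f \<and> (\<forall>A\<in>sets M. \<nu> A = (\<integral>x. indicator A x * f x \<partial>M))"
proof -
  \<comment> \<open>the positive variation of \<open>\<nu>\<close>\<close>
  define P where "P A = (SUP B\<in>{B \<in> sets M. B \<subseteq> A}. \<nu> B)" for A
  have \<nu>0: "\<nu> {} = 0" by (rule null) auto
  have bdd: "bdd_above (\<nu> ` {B \<in> sets M. B \<subseteq> A})" for A using bound by (auto simp: bdd_above_def)
  have up: "\<nu> B \<le> P A" if "B \<in> sets M" "B \<subseteq> A" for A B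
    unfolding P_def using that by (intro cSUP_upper bdd) auto
  have least: "P A \<le> r" if "\<And>B. B \<in> sets M \<Longrightarrow> B \<subseteq> A \<Longrightarrow> \<nu> B \<le> r" for A r
    unfolding P_def using that by (intro cSUP_least) auto
  have mono: "P A \<le> P B" if "A \<subseteq> B" for A B using that by (intro least up) auto
  have pos: "P A \<ge> 0" for A using up[of "{}" A] by (simp add: \<nu>0)
  have un: "\<nu> (B \<union> C) = \<nu> B + \<nu> C" if "B \<in> sets M" "C \<in> sets M" "B \<inter> C = {}" for B C
  proof -
    have "(\<lambda>i. \<nu> (binaryset B C i)) sums \<nu> (\<Union>i. binaryset B C i)"
      using that by (intro sums) (auto simp: range_binaryset_eq disjoint_family_on_def binaryset_def)
    moreover have "(\<lambda>i. \<nu> (binaryset B C i)) sums (\<nu> B + \<nu> C)"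
      by (rule binaryset_sums) (rule \<nu>0)
    ultimately have "\<nu> (\<Union>i. binaryset B C i) = \<nu> B + \<nu> C" by (rule sums_unique2)
    then show ?thesis by (simp only: UN_binaryset_eq)
  qed
  have super: "P A + P B \<le> P (A \<union> B)" if "A \<inter> B = {}" for A B
  proof -
    have "P A \<le> P (A \<union> B) - P B"
    proof (rule least)
      fix C assume C: "C \<in> sets M" "C \<subseteq> A"
      have "P B \<le> P (A \<union> B) - \<nu> C"
      proof (rule least)
        fix D assume D: "D \<in> sets M" "D \<subseteq> B"
        have "\<nu> C + \<nu> D = \<nu> (C \<union> D)" using C D that by (intro un[symmetric]) auto
        also have "\<dots> \<le> P (A \<union> B)" using C D by (intro up) auto
        finally show "\<nu> D \<le> P (A \<union> B) - \<nu> C" by simp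
      qed
      then show "\<nu> C \<le> P (A \<union> B) - P B" by simp
    qed
    then show ?thesis by simp
  qed
  have Psums: "(\<lambda>i. P (A i)) sums P (\<Union>i. A i)" if A: "range A \<subseteq> sets M" "disjoint_family A" for A :: "nat \<Rightarrow> 'a set"
  proof -
    have part: "(\<Sum>i<n. P (A i)) \<le> P (\<Union>i<n. A i)" for n
    proof (induction n)
      case (Suc n)
      have "(\<Union>i<n. A i) \<inter> A n = {}"
      proof (rule equals0I)
        fix x assume "x \<in> (\<Union>i<n. A i) \<inter> A n"
        then obtain i where "i < n" "x \<in> A i" "x \<in> A n" by auto
        then show False using disjoint_family_onD[OF A(2), of i n] by auto
      qed
      from super[OF this] Suc show ?case by (simp add: lessThan_Suc Un_commute)
    qed (simp add: pos)
    have part': "(\<Sum>i<n. P (A i)) \<le> P (\<Union>i. A i)" for n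
      by (rule order_trans[OF part mono]) auto
    have sm: "summable (\<lambda>i. P (A i))"
      by (rule summableI_nonneg_bounded[OF _ part']) (rule pos)
    have "(\<Sum>i. P (A i)) = P (\<Union>i. A i)"
    proof (rule antisym)
      show "(\<Sum>i. P (A i)) \<le> P (\<Union>i. A i)" by (rule suminf_le_const[OF sm part'])
      show "P (\<Union>i. A i) \<le> (\<Sum>i. P (A i))"
      proof (rule least)
        fix B assume B: "B \<in> sets M" "B \<subseteq> (\<Union>i. A i)"
        have "(\<lambda>i. \<nu> (B \<inter> A i)) sums \<nu> (\<Union>i. B \<inter> A i)"
          using A B by (intro sums) (auto simp: disjoint_family_on_def)
        moreover have "(\<Union>i. B \<inter> A i) = B" using B by auto
        ultimately have s: "(\<lambda>i. \<nu> (B \<inter> A i)) sums \<nu> B" by simp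
        have "\<nu> B = (\<Sum>i. \<nu> (B \<inter> A i))" using s by (simp add: sums_iff)
        also have "\<dots> \<le> (\<Sum>i. P (A i))"
          using A B s by (intro suminf_le up sm) (auto simp: sums_iff)
        finally show "\<nu> B \<le> (\<Sum>i. P (A i))" .
      qed
    qed
    then show ?thesis using sm by (simp add: sums_iff)
  qed
  have nullsub: "\<nu> B = 0" if "A \<in> sets M" "emeasure M A = 0" "B \<in> sets M" "B \<subseteq> A" for A B
    using null emeasure_eq_0[OF that(1,2,4)] that(3) by auto
  have Pnull: "P A = 0" if "A \<in> sets M" "emeasure M A = 0" for A
    using nullsub[OF that] pos[of A] by (intro antisym least) auto
  obtain f1 :: "'a \<Rightarrow> real" where f1: "integrable M f1" "\<forall>A\<in>sets M. P A = (\<integral>x. indicator A x * f1 x \<partial>M)"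
    using radon_nikodym_nonneg[of P, OF pos Psums Pnull] by blast
  have "\<exists>f2 :: 'a \<Rightarrow> real. integrable M f2 \<and> (\<forall>A\<in>sets M. P A - \<nu> A = (\<integral>x. indicator A x * f2 x \<partial>M))"
  proof (rule radon_nikodym_nonneg)
    show "P A - \<nu> A \<ge> 0" if "A \<in> sets M" for A using up[OF that, of A] by simp
    show "(\<lambda>i. P (A i) - \<nu> (A i)) sums (P (\<Union>i. A i) - \<nu> (\<Union>i. A i))"
      if "range A \<subseteq> sets M" "disjoint_family A" for A :: "nat \<Rightarrow> 'a set"
      by (intro sums_diff Psums sums that)
    show "P A - \<nu> A = 0" if "A \<in> sets M" "emeasure M A = 0" for A using Pnull[OF that] null[OF that] by simp
  qed
  then obtain f2 :: "'a \<Rightarrow> real" where f2: "integrable M f2" "\<forall>A\<in>sets M. P A - \<nu> A = (\<integral>x. indicator A x * f2 x \<partial>M)"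
    by blast
  show ?thesis
  proof (intro exI[of _ "\<lambda>x. f1 x - f2 x"] conjI ballI)
    show "integrable M (\<lambda>x. f1 x - f2 x)" using f1 f2 by simp
    fix A assume A: "A \<in> sets M"
    have i: "integrable M (\<lambda>x. indicator A x * f1 x)" "integrable M (\<lambda>x. indicator A x * f2 x)"
      using integrable_mult_indicator[OF A f1(1)] integrable_mult_indicator[OF A f2(1)] by simp_all
    have "\<nu> A = (\<integral>x. indicator A x * f1 x \<partial>M) - (\<integral>x. indicator A x * f2 x \<partial>M)" using f1(2) f2(2) A by fastforce
    also have "\<dots> = (\<integral>x. indicator A x * f1 x - indicator A x * f2 x \<partial>M)" using i by simp
    finally show "\<nu> A = (\<integral>x. indicator A x * (f1 x - f2 x) \<partial>M)" by (simp add: right_diff_distrib)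
  qed
qed

lemma (in finite_measure) radon_nikodym_complex:
  fixes \<nu> :: "'a set \<Rightarrow> complex"
  assumes sums: "\<And>A :: nat \<Rightarrow> 'a set. range A \<subseteq> sets M \<Longrightarrow> disjoint_family A \<Longrightarrow> (\<lambda>i. \<nu> (A i)) sums \<nu> (\<Union>i. A i)"
    and null: "\<And>A. A \<in> sets M \<Longrightarrow> emeasure M A = 0 \<Longrightarrow> \<nu> A = 0"
    and bound: "\<And>A. A \<in> sets M \<Longrightarrow> cmod (\<nu> A) \<le> c"
  shows "\<exists>f :: 'a \<Rightarrow> complex. integrable M f \<and> (\<forall>A\<in>sets M. \<nu> A = (\<integral>x. indicator A x *\<^sub>R f x \<partial>M))"
proof -
  have "\<exists>f :: 'a \<Rightarrow> real. integrable M f \<and> (\<forall>A\<in>sets M. Re (\<nu> A) = (\<integral>x. indicator A x * f x \<partial>M))"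
  proof (rule radon_nikodym_real)
    show "(\<lambda>i. Re (\<nu> (A i))) sums Re (\<nu> (\<Union>i. A i))" if "range A \<subseteq> sets M" "disjoint_family A" for A :: "nat \<Rightarrow> 'a set"
      using sums[OF that] by (simp add: sums_complex_iff)
    show "Re (\<nu> A) \<le> c" if "A \<in> sets M" for A using bound[OF that] complex_Re_le_cmod[of "\<nu> A"] by simp
  qed (simp add: null)
  then obtain f1 :: "'a \<Rightarrow> real" where f1: "integrable M f1" "\<And>A. A \<in> sets M \<Longrightarrow> Re (\<nu> A) = (\<integral>x. indicator A x * f1 x \<partial>M)"
    by blast
  have "\<exists>f :: 'a \<Rightarrow> real. integrable M f \<and> (\<forall>A\<in>sets M. Im (\<nu> A) = (\<integral>x. indicator A x * f x \<partial>M))"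
  proof (rule radon_nikodym_real)
    show "(\<lambda>i. Im (\<nu> (A i))) sums Im (\<nu> (\<Union>i. A i))" if "range A \<subseteq> sets M" "disjoint_family A" for A :: "nat \<Rightarrow> 'a set"
      using sums[OF that] by (simp add: sums_complex_iff)
    show "Im (\<nu> A) \<le> c" if "A \<in> sets M" for A using bound[OF that] abs_Im_le_cmod[of "\<nu> A"] by simp
  qed (simp add: null)
  then obtain f2 :: "'a \<Rightarrow> real" where f2: "integrable M f2" "\<And>A. A \<in> sets M \<Longrightarrow> Im (\<nu> A) = (\<integral>x. indicator A x * f2 x \<partial>M)"
    by blast
  show ?thesis
  proof (intro exI[of _ "\<lambda>x. complex_of_real (f1 x) + \<i> * complex_of_real (f2 x)"] conjI ballI)
    show int: "integrable M (\<lambda>x. complex_of_real (f1 x) + \<i> * complex_of_real (f2 x))" using f1 f2 by simp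
    fix A assume A: "A \<in> sets M"
    have i: "integrable M (\<lambda>x. indicator A x *\<^sub>R (complex_of_real (f1 x) + \<i> * complex_of_real (f2 x)))"
      by (rule integrable_mult_indicator[OF A int])
    have "Re (\<integral>x. indicator A x *\<^sub>R (complex_of_real (f1 x) + \<i> * complex_of_real (f2 x)) \<partial>M) = (\<integral>x. indicator A x * f1 x \<partial>M)"
      by (subst integral_Re[OF i, symmetric]) simp
    moreover have "Im (\<integral>x. indicator A x *\<^sub>R (complex_of_real (f1 x) + \<i> * complex_of_real (f2 x)) \<partial>M) = (\<integral>x. indicator A x * f2 x \<partial>M)"
      by (subst integral_Im[OF i, symmetric]) simp
    ultimately show "\<nu> A = (\<integral>x. indicator A x *\<^sub>R (complex_of_real (f1 x) + \<i> * complex_of_real (f2 x)) \<partial>M)"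
      using f1(2)[OF A] f2(2)[OF A] by (simp add: complex_eq_iff)
  qed
qed

section \<open>Duality of L1 over sets of finite measure\<close>

context haar
begin

lemma bmult_indicator: "A \<in> sets borel \<Longrightarrow> bmult (\<lambda>x. of_real (indicator A x)) 1"
  by (auto simp: bmult_def indicator_def)

lemma cut_functional_Linf:
  assumes h: "h \<in> Linf \<mu>" and C: "C \<in> sets borel"
  shows "(\<lambda>f. if f \<in> L1 \<mu> then h (cut C f) else 0) \<in> Linf \<mu>"
    and "norm_inf \<mu> (\<lambda>f. if f \<in> L1 \<mu> then h (cut C f) else 0) \<le> norm_inf \<mu> h"
proof -
  have b: "cmod (if f \<in> L1 \<mu> then h (cut C f) else 0) \<le> norm_inf \<mu> h * norm1 \<mu> f" if f: "f \<in> L1 \<mu>" for f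
  proof -
    have "cmod (h (cut C f)) \<le> norm_inf \<mu> h * norm1 \<mu> (cut C f)" by (intro Linf_bound h cut_L1 C f)
    also have "\<dots> \<le> norm_inf \<mu> h * norm1 \<mu> f" by (intro mult_left_mono norm1_cut_le C f norm_inf_nonneg h)
    finally show ?thesis using f by simp
  qed
  show "(\<lambda>f. if f \<in> L1 \<mu> then h (cut C f) else 0) \<in> Linf \<mu>"
  proof (rule LinfI[OF _ _ b])
    fix f g assume fg: "f \<in> L1 \<mu>" "g \<in> L1 \<mu>"
    then show "(if (\<lambda>x. f x + g x) \<in> L1 \<mu> then h (cut C (\<lambda>x. f x + g x)) else 0) =
      (if f \<in> L1 \<mu> then h (cut C f) else 0) + (if g \<in> L1 \<mu> then h (cut C g) else 0)"
      using Linf_plus[OF h cut_L1[OF C fg(1)] cut_L1[OF C fg(2)]] by (simp add: L1_add cut_add)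
  next
    fix c f assume f: "f \<in> L1 \<mu>"
    then show "(if (\<lambda>x. c * f x) \<in> L1 \<mu> then h (cut C (\<lambda>x. c * f x)) else 0) = c * (if f \<in> L1 \<mu> then h (cut C f) else 0)"
      using Linf_times[OF h cut_L1[OF C f], of c] by (simp add: L1_scale cut_scale)
  qed auto
  show "norm_inf \<mu> (\<lambda>f. if f \<in> L1 \<mu> then h (cut C f) else 0) \<le> norm_inf \<mu> h"
    by (rule norm_inf_least[OF b norm_inf_nonneg[OF h]])
qed

definition on_set :: "'g set \<Rightarrow> 'g measure" where
  "on_set C = density \<mu> (\<lambda>x. ennreal (indicator C x))"

lemma on_set:
  assumes C: "C \<in> sets borel" "emeasure \<mu> C < \<infinity>"
  shows "finite_measure (on_set C)" and "sets (on_set C) = sets borel"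
    and "\<And>A. A \<in> sets borel \<Longrightarrow> emeasure (on_set C) A = emeasure \<mu> (A \<inter> C)"
    and "\<And>f :: 'g \<Rightarrow> complex. f \<in> borel_measurable borel \<Longrightarrow> (\<integral>x. f x \<partial>on_set C) = (\<integral>x. cut C f x \<partial>\<mu>)"
    and "\<And>f :: 'g \<Rightarrow> complex. integrable (on_set C) f \<Longrightarrow> cut C f \<in> L1 \<mu>"
proof -
  note [measurable] = C(1)
  show s: "sets (on_set C) = sets borel" by (simp add: on_set_def sets_eq)
  show e: "emeasure (on_set C) A = emeasure \<mu> (A \<inter> C)" if [measurable]: "A \<in> sets borel" for A
  proof -
    have "emeasure (on_set C) A = (\<integral>\<^sup>+x. ennreal (indicator C x) * indicator A x \<partial>\<mu>)"
      unfolding on_set_def by (rule emeasure_density) auto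
    also have "\<dots> = (\<integral>\<^sup>+x. indicator (A \<inter> C) x \<partial>\<mu>)"
      by (intro nn_integral_cong) (auto simp: indicator_def)
    finally show ?thesis by (simp add: sets_eq)
  qed
  have "emeasure (on_set C) (space (on_set C)) = emeasure \<mu> C"
    using e[of UNIV] by (simp add: on_set_def)
  then show "finite_measure (on_set C)" using C by (intro finite_measureI) auto
  show "(\<integral>x. f x \<partial>on_set C) = (\<integral>x. cut C f x \<partial>\<mu>)" if [measurable]: "f \<in> borel_measurable borel" for f :: "'g \<Rightarrow> complex"
    unfolding on_set_def cut_def by (subst integral_density) (auto simp: scaleR_conv_of_real)
  show "cut C f \<in> L1 \<mu>" if f: "integrable (on_set C) f" for f :: "'g \<Rightarrow> complex"
  proof -
    have fb: "f \<in> borel_measurable borel"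
      using borel_measurable_integrable[OF f] by (simp add: measurable_cong_sets[OF s refl])
    then have "integrable \<mu> (\<lambda>x. indicator C x *\<^sub>R f x)"
      using f unfolding on_set_def by (subst (asm) integrable_density) (auto simp: measurable_cong_sets[OF sets_eq refl])
    then show ?thesis by (simp add: L1_def cut_def scaleR_conv_of_real)
  qed
qed

text \<open>Finite additivity and continuity at the empty set give countable additivity: the tails
  \<open>R n\<close> decrease to the empty set, since a point lies in at most one of the
  \<open>A i\<close>.\<close>

lemma indicator_sums:
  fixes \<nu> :: "'g set \<Rightarrow> complex"
  assumes un: "\<And>A B. A \<in> sets borel \<Longrightarrow> B \<in> sets borel \<Longrightarrow> A \<inter> B = {} \<Longrightarrow> \<nu> (A \<union> B) = \<nu> A + \<nu> B"
    and lim: "\<And>A :: nat \<Rightarrow> 'g set. (\<And>n. A n \<in> sets borel) \<Longrightarrow> decseq A \<Longrightarrow> (\<Inter>n. A n) = {} \<Longrightarrow> (\<lambda>n. \<nu> (A n)) \<longlonglongrightarrow> 0"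
    and A: "range A \<subseteq> sets borel" "disjoint_family (A :: nat \<Rightarrow> 'g set)"
  shows "(\<lambda>i. \<nu> (A i)) sums \<nu> (\<Union>i. A i)"
proof -
  have [measurable]: "A i \<in> sets borel" for i using A by auto
  define R where "R n = (\<Union>i\<in>{n..}. A i)" for n
  have Rb: "R n \<in> sets borel" for n unfolding R_def by (intro sets.countable_UN') auto
  have \<nu>0: "\<nu> {} = 0" using un[of "{}" "{}"] by simp
  have "\<nu> (\<Union>i. A i) = (\<Sum>i<n. \<nu> (A i)) + \<nu> (R n)" for n
  proof (induction n)
    case 0
    then show ?case by (simp add: R_def)
  next
    case (Suc n)
    have "{n..} = insert n {Suc n..}" by auto
    then have R: "R n = A n \<union> R (Suc n)" by (simp add: R_def)
    have "A n \<inter> R (Suc n) = {}"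
    proof (rule equals0I)
      fix x assume "x \<in> A n \<inter> R (Suc n)"
      then obtain i where "i \<ge> Suc n" "x \<in> A i" "x \<in> A n" by (auto simp: R_def)
      then show False using disjoint_family_onD[OF A(2), of n i] by auto
    qed
    then have "\<nu> (R n) = \<nu> (A n) + \<nu> (R (Suc n))" unfolding R by (intro un Rb) auto
    then show ?case using Suc by simp
  qed
  then have eq: "(\<Sum>i<n. \<nu> (A i)) = \<nu> (\<Union>i. A i) - \<nu> (R n)" for n by (simp add: algebra_simps)
  have "(\<lambda>n. \<nu> (R n)) \<longlonglongrightarrow> 0"
  proof (rule lim[OF Rb])
    show "decseq R" by (fastforce simp: decseq_def R_def)
    show "(\<Inter>n. R n) = {}"
    proof (rule ccontr)
      assume "(\<Inter>n. R n) \<noteq> {}"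
      then obtain x where x: "\<And>n. x \<in> R n" by blast
      obtain i where i: "x \<in> A i" using x[of 0] by (auto simp: R_def)
      obtain j where j: "x \<in> A j" "j \<ge> Suc i" using x[of "Suc i"] by (auto simp: R_def)
      then show False using disjoint_family_onD[OF A(2), of i j] i by auto
    qed
  qed
  then have "(\<lambda>n. \<Sum>i<n. \<nu> (A i)) \<longlonglongrightarrow> \<nu> (\<Union>i. A i) - 0"
    unfolding eq by (intro tendsto_diff tendsto_const)
  then show ?thesis by (simp add: sums_def)
qed

text \<open>Over a set of finite measure \<open>h\<close> is a bounded function, namely the
  Radon-Nikodym density of \<open>A \<mapsto> h (ind A)\<close>. Averages of the density over sets
  of positive measure are bounded by the norm of \<open>h\<close>, hence by the averaging theorem so
  is the density almost everywhere.\<close>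

lemma Linf_on_set:
  assumes h: "h \<in> Linf \<mu>" and C: "C \<in> sets borel" "emeasure \<mu> C < \<infinity>"
  shows "\<exists>\<phi>. bmult \<phi> (norm_inf \<mu> h) \<and> (\<forall>f\<in>L1 \<mu>. h (cut C f) = (\<integral>x. \<phi> x * cut C f x \<partial>\<mu>))"
proof -
  define B where "B = norm_inf \<mu> h"
  have B0: "B \<ge> 0" unfolding B_def by (rule norm_inf_nonneg[OF h])
  interpret M: finite_measure "on_set C" by (rule on_set[OF C])
  note sM = on_set(2)[OF C] and eM = on_set(3)[OF C]
  define ind :: "'g set \<Rightarrow> 'g \<Rightarrow> complex" where "ind A = (\<lambda>x. of_real (indicator (A \<inter> C) x))" for A
  have fin: "emeasure \<mu> (A \<inter> C) < \<infinity>" if "A \<in> sets borel" for A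
  proof -
    have "emeasure \<mu> (A \<inter> C) \<le> emeasure \<mu> C" using C by (intro emeasure_mono) (auto simp: sets_eq)
    then show ?thesis using C(2) by (rule le_less_trans)
  qed
  have iL: "ind A \<in> L1 \<mu>" if "A \<in> sets borel" for A
    unfolding ind_def using that C fin by (intro indicator_L1) auto
  have nI: "norm1 \<mu> (ind A) = measure (on_set C) A" if "A \<in> sets borel" for A
    unfolding ind_def using that C by (subst norm1_indicator) (auto simp: measure_def eM)
  define \<nu> where "\<nu> A = h (ind A)" for A
  have b: "cmod (\<nu> A) \<le> B * measure (on_set C) A" if "A \<in> sets borel" for A
    using Linf_bound[OF h iL[OF that]] by (simp add: \<nu>_def B_def nI that)
  have un: "\<nu> (A1 \<union> A2) = \<nu> A1 + \<nu> A2" if "A1 \<in> sets borel" "A2 \<in> sets borel" "A1 \<inter> A2 = {}" for A1 A2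
  proof -
    have "ind (A1 \<union> A2) = (\<lambda>x. ind A1 x + ind A2 x)" using that(3) by (auto simp: ind_def indicator_def fun_eq_iff)
    then show ?thesis unfolding \<nu>_def using Linf_plus[OF h iL[OF that(1)] iL[OF that(2)]] by simp
  qed
  have "\<exists>f :: 'g \<Rightarrow> complex. integrable (on_set C) f \<and> (\<forall>A\<in>sets (on_set C). \<nu> A = (\<integral>x. indicator A x *\<^sub>R f x \<partial>on_set C))"
  proof (rule M.radon_nikodym_complex)
    fix A :: "nat \<Rightarrow> 'g set" assume A: "range A \<subseteq> sets (on_set C)" "disjoint_family A"
    show "(\<lambda>i. \<nu> (A i)) sums \<nu> (\<Union>i. A i)"
    proof (rule indicator_sums[OF un])
      fix A :: "nat \<Rightarrow> 'g set" assume A: "\<And>n. A n \<in> sets borel" "decseq A" "(\<Inter>n. A n) = {}"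
      have "(\<lambda>n. measure (on_set C) (A n)) \<longlonglongrightarrow> measure (on_set C) (\<Inter>n. A n)"
        by (rule M.finite_Lim_measure_decseq) (use A sM in auto)
      then have "(\<lambda>n. B * measure (on_set C) (A n)) \<longlonglongrightarrow> 0"
        using A(3) by (intro tendsto_mult_right_zero) simp
      then show "(\<lambda>n. \<nu> (A n)) \<longlonglongrightarrow> 0"
        by (rule Lim_null_comparison[rotated]) (simp add: b A)
    qed (use A sM in auto)
  next
    fix A assume "A \<in> sets (on_set C)" "emeasure (on_set C) A = 0"
    then show "\<nu> A = 0" using b[of A] by (simp add: sM measure_def)
  next
    fix A assume "A \<in> sets (on_set C)"
    then show "cmod (\<nu> A) \<le> B * measure (on_set C) (space (on_set C))"
      using b[of A] M.bounded_measure[of A] B0 mult_left_mono[of "measure (on_set C) A" "measure (on_set C) (space (on_set C))" B]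
      by (simp add: sM)
  qed
  then obtain f :: "'g \<Rightarrow> complex" where f: "integrable (on_set C) f"
    and \<nu>f: "\<And>A. A \<in> sets borel \<Longrightarrow> \<nu> A = (\<integral>x. indicator A x *\<^sub>R f x \<partial>on_set C)"
    unfolding sM by blast
  have fb[measurable]: "f \<in> borel_measurable borel"
    using borel_measurable_integrable[OF f] by (simp add: measurable_cong_sets[OF sM refl])
  have "AE x in on_set C. f x \<in> cball 0 B"
  proof (rule M.averaging_theorem[OF f closed_cball])
    fix A assume A: "A \<in> sets (on_set C)" "measure (on_set C) A > 0"
    have "set_lebesgue_integral (on_set C) A f = \<nu> A"
      using \<nu>f[of A] A by (simp add: set_lebesgue_integral_def sM)
    then show "(1 / measure (on_set C) A) *\<^sub>R set_lebesgue_integral (on_set C) A f \<in> cball 0 B"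
      using b[of A] A by (simp add: sM field_simps)
  qed
  then have ae: "AE x in \<mu>. x \<in> C \<longrightarrow> cmod (f x) \<le> B"
    unfolding on_set_def using C by (subst (asm) AE_density) (auto simp: sets_eq indicator_def measurable_cong_sets[OF sets_eq refl])
  \<comment> \<open>The density is bounded only almost everywhere on \<open>C\<close>, while
    \<open>bmult\<close> asks for a bound at every point. The points reset to 0 are null within
    \<open>C\<close> or lie outside \<open>C\<close>, where \<open>cut C\<close> kills the
    integrand.\<close>
  define \<phi> where "\<phi> x = (if cmod (f x) \<le> B then f x else 0)" for x
  have [measurable]: "\<phi> \<in> borel_measurable borel" unfolding \<phi>_def by measurable
  have \<phi>: "bmult \<phi> B" using B0 by (auto simp: bmult_def \<phi>_def)
  have main: "h (cut C u) = (\<integral>x. \<phi> x * cut C u x \<partial>\<mu>)" if "integrable \<mu> u" for u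
    using that
  proof (induction rule: integrable_induct)
    case (base A c)
    then have A[measurable]: "A \<in> sets borel" by (simp add: sets_eq)
    have ci: "cut C (\<lambda>x. indicator A x *\<^sub>R c) = (\<lambda>x. c * ind A x)"
      by (auto simp: cut_def ind_def indicator_def)
    have "h (\<lambda>x. c * ind A x) = c * \<nu> A" unfolding \<nu>_def by (rule Linf_times[OF h iL[OF A]])
    also have "\<nu> A = (\<integral>x. cut C (\<lambda>x. indicator A x *\<^sub>R f x) x \<partial>\<mu>)"
      unfolding \<nu>f[OF A] by (rule on_set(4)[OF C]) measurable
    also have "\<dots> = (\<integral>x. \<phi> x * ind A x \<partial>\<mu>)"
    proof (rule integral_cong_AE)
      show "AE x in \<mu>. cut C (\<lambda>x. indicator A x *\<^sub>R f x) x = \<phi> x * ind A x"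
        using ae by eventually_elim (auto simp: cut_def ind_def indicator_def \<phi>_def)
      note [measurable] = C(1)
      show "cut C (\<lambda>x. indicator A x *\<^sub>R f x) \<in> borel_measurable \<mu>" unfolding cut_def by measurable
      show "(\<lambda>x. \<phi> x * ind A x) \<in> borel_measurable \<mu>" unfolding ind_def by measurable
    qed
    also have "c * \<dots> = (\<integral>x. \<phi> x * (c * ind A x) \<partial>\<mu>)"
      by (simp add: mult.left_commute flip: integral_mult_right_zero)
    finally show ?case unfolding ci .
  next
    case (add u v)
    have uv: "cut C u \<in> L1 \<mu>" "cut C v \<in> L1 \<mu>" using add C by (auto intro: cut_L1 L1I)
    show ?case unfolding cut_add Linf_plus[OF h uv] add.IH
      using bmult_integrable[OF \<phi> uv(1)] bmult_integrable[OF \<phi> uv(2)] by (simp add: distrib_left)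
  next
    case (lim u s)
    have u: "u \<in> L1 \<mu>" and s: "s i \<in> L1 \<mu>" for i using lim by (auto intro: L1I)
    have n0: "(\<lambda>i. norm1 \<mu> (\<lambda>x. u x - s i x)) \<longlonglongrightarrow> 0"
      using lim by (intro norm1_dominated_convergence u s) auto
    have conv: "(\<lambda>i. k (s i)) \<longlonglongrightarrow> k u" if k: "k \<in> Linf \<mu>" for k
    proof -
      have b: "cmod (k (s i) - k u) \<le> norm_inf \<mu> k * norm1 \<mu> (\<lambda>x. u x - s i x)" for i
        using Linf_bound[OF k L1_diff[OF u s[of i]]] by (simp add: Linf_minus[OF k u s] norm_minus_commute)
      have "(\<lambda>i. k (s i) - k u) \<longlonglongrightarrow> 0"
        by (rule Lim_null_comparison[OF _ tendsto_mult_right_zero[OF n0, of "norm_inf \<mu> k"]]) (intro always_eventually allI b)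
      then show ?thesis by (rule LIM_zero_cancel)
    qed
    have k1: "(\<lambda>i. h (cut C (s i))) \<longlonglongrightarrow> h (cut C u)"
      using conv[OF cut_functional_Linf(1)[OF h C(1)]] u s by simp
    have k2: "(\<lambda>i. \<integral>x. \<phi> x * cut C (s i) x \<partial>\<mu>) \<longlonglongrightarrow> (\<integral>x. \<phi> x * cut C u x \<partial>\<mu>)"
      using conv[OF cut_functional_Linf(1)[OF bmult_Linf(1)[OF \<phi>] C(1)]] u s cut_L1[OF C(1)]
      by (simp add: LUC_embedding_def)
    show ?case using LIMSEQ_unique[OF k1] k2 by (simp add: lim.IH)
  qed
  show ?thesis using \<phi> main by (auto simp: B_def L1_def)
qed

end

section \<open>Central functionals are integrable functions\<close>

context haar
begin

lemma bmult_tendsto: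
  assumes \<phi>: "\<And>n. bmult (\<phi> n) B" and lim: "\<And>x. (\<lambda>n. \<phi> n x) \<longlonglongrightarrow> \<psi> x" and \<psi>: "bmult \<psi> B" and f: "f \<in> L1 \<mu>"
  shows "(\<lambda>n. \<integral>x. \<phi> n x * f x \<partial>\<mu>) \<longlonglongrightarrow> (\<integral>x. \<psi> x * f x \<partial>\<mu>)"
proof (rule integral_dominated_convergence[where w = "\<lambda>x. B * cmod (f x)"])
  show "integrable \<mu> (\<lambda>x. B * cmod (f x))" using f by (simp add: L1_def)
  show "AE x in \<mu>. (\<lambda>n. \<phi> n x * f x) \<longlonglongrightarrow> \<psi> x * f x" by (intro AE_I2 tendsto_mult lim tendsto_const)
  show "AE x in \<mu>. norm (\<phi> n x * f x) \<le> B * cmod (f x)" for n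
    using \<phi>[of n] by (intro AE_I2) (simp add: norm_mult mult_right_mono bmult_def)
  show "(\<lambda>x. \<psi> x * f x) \<in> borel_measurable \<mu>" using bmult_integrable[OF \<psi> f] by (rule borel_measurable_integrable)
  show "(\<lambda>x. \<phi> n x * f x) \<in> borel_measurable \<mu>" for n using bmult_integrable[OF \<phi> f] by (rule borel_measurable_integrable)
qed

lemma norm1_attained:
  assumes u: "u \<in> L1 \<mu>"
  obtains \<phi> where "bmult \<phi> 1" "LUC_embedding \<mu> \<phi> u = of_real (norm1 \<mu> u)"
proof -
  \<comment> \<open>The conjugate phase of \<open>u\<close>. Division by zero gives 0 where
    \<open>u\<close> vanishes, so the bound 1 holds everywhere.\<close>
  define \<phi> where "\<phi> x = cnj (u x) / of_real (cmod (u x))" for x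
  have [measurable]: "u \<in> borel_measurable borel" by (rule L1_borel[OF u])
  have "(\<lambda>x. cnj (u x)) \<in> borel_measurable borel"
    by (rule measurable_compose[of u borel borel cnj]) (auto intro!: borel_measurable_continuous_onI continuous_intros)
  then have "\<phi> \<in> borel_measurable borel" unfolding \<phi>_def by measurable
  then have b: "bmult \<phi> 1" by (auto simp: bmult_def \<phi>_def norm_divide)
  have "\<phi> x * u x = of_real (cmod (u x))" for x
  proof (cases "u x = 0")
    case False
    have "cnj (u x) * u x = of_real (cmod (u x)) * of_real (cmod (u x))"
      using complex_norm_square[of "u x"] by (simp add: power2_eq_square mult.commute)
    then show ?thesis using False by (simp add: \<phi>_def)
  qed (simp add: \<phi>_def)
  then have "LUC_embedding \<mu> \<phi> u = of_real (norm1 \<mu> u)" using u by (simp add: LUC_embedding_def norm1_def)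
  then show thesis using that b by blast
qed

lemma norm1_zero_AE:
  assumes u: "u \<in> L1 \<mu>" and "norm1 \<mu> u = 0"
  shows "AE x in \<mu>. u x = 0"
  using assms integral_nonneg_eq_0_iff_AE[of \<mu> "\<lambda>x. cmod (u x)"] by (simp add: norm1_def L1_def)

end

section \<open>Densities of \<open>m\<close> over sets of finite measure and their limit\<close>

context central
begin

lemma m_bound: "\<exists>c\<ge>0. \<forall>u\<in>Linf \<mu>. cmod (m u) \<le> c * norm_inf \<mu> u"
proof -
  obtain C where C: "\<forall>u\<in>Linf \<mu>. cmod (m u) \<le> C * norm_inf \<mu> u"
    using cdual_bound_ex[OF m_dual[unfolded Linf_dual_def]] by (elim exE)
  show ?thesis
  proof (intro exI[of _ "\<bar>C\<bar>"] conjI ballI)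
    fix u assume u: "u \<in> Linf \<mu>"
    have "C * norm_inf \<mu> u \<le> \<bar>C\<bar> * norm_inf \<mu> u" by (intro mult_right_mono norm_inf_nonneg u) simp
    then show "cmod (m u) \<le> \<bar>C\<bar> * norm_inf \<mu> u" using C u by force
  qed simp
qed

lemma m_plus: "h \<in> Linf \<mu> \<Longrightarrow> k \<in> Linf \<mu> \<Longrightarrow> m (\<lambda>f. h f + k f) = m h + m k"
  by (rule cdual_add[OF m_dual[unfolded Linf_dual_def]])

lemma m_times: "h \<in> Linf \<mu> \<Longrightarrow> m (\<lambda>f. c * h f) = c * m h"
  by (rule cdual_scale[OF m_dual[unfolded Linf_dual_def]])

lemma m_minus:
  assumes "h \<in> Linf \<mu>" "k \<in> Linf \<mu>"
  shows "m (\<lambda>f. h f - k f) = m h - m k"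
  using m_plus[OF assms(1) Linf_scale[OF assms(2), of "-1"]] m_times[OF assms(2), of "-1"] by simp

lemma m_zero: "m (\<lambda>f. 0) = 0"
  using m_times[OF Linf_zero, of 0] by simp

lemma norm_inf_diff_le:
  assumes "h \<in> Linf \<mu>" "k \<in> Linf \<mu>"
  shows "norm_inf \<mu> (\<lambda>f. h f - k f) \<le> norm_inf \<mu> h + norm_inf \<mu> k"
proof (rule norm_inf_least)
  fix f assume f: "f \<in> L1 \<mu>"
  show "cmod (h f - k f) \<le> (norm_inf \<mu> h + norm_inf \<mu> k) * norm1 \<mu> f"
    using norm_triangle_ineq4[of "h f" "k f"] Linf_bound[OF assms(1) f] Linf_bound[OF assms(2) f]
    by (simp add: distrib_right)
qed (simp add: norm_inf_nonneg assms)

lemma m_bmult_tendsto: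
  assumes \<phi>: "\<And>n. bmult (\<phi> n) B" and lim: "\<And>x. (\<lambda>n. \<phi> n x) \<longlonglongrightarrow> \<psi> x" and \<psi>: "bmult \<psi> B"
  shows "(\<lambda>n. m (LUC_embedding \<mu> (\<phi> n))) \<longlonglongrightarrow> m (LUC_embedding \<mu> \<psi>)"
proof -
  note E = bmult_Linf(1)[OF \<phi>] bmult_Linf(1)[OF \<psi>]
  have "(\<lambda>n. m (\<lambda>f. LUC_embedding \<mu> (\<phi> n) f - LUC_embedding \<mu> \<psi> f)) \<longlonglongrightarrow> 0"
  proof (rule weak_star_null[where K = UNIV and B = "2 * B"])
    show "(card_of (UNIV :: nat set), card_of min_cover) \<in> ordLeq"
      using min_cover_infinite[OF noncompact] infinite_iff_card_of_nat by blast
    show "\<forall>n\<in>UNIV. (\<lambda>f. LUC_embedding \<mu> (\<phi> n) f - LUC_embedding \<mu> \<psi> f) \<in> Linf \<mu> \<and>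
        norm_inf \<mu> (\<lambda>f. LUC_embedding \<mu> (\<phi> n) f - LUC_embedding \<mu> \<psi> f) \<le> 2 * B"
    proof
      fix n
      have "norm_inf \<mu> (LUC_embedding \<mu> (\<phi> n)) \<le> B" "norm_inf \<mu> (LUC_embedding \<mu> \<psi>) \<le> B"
        using bmult_Linf(2)[OF \<phi>] bmult_Linf(2)[OF \<psi>] by auto
      then show "(\<lambda>f. LUC_embedding \<mu> (\<phi> n) f - LUC_embedding \<mu> \<psi> f) \<in> Linf \<mu> \<and>
        norm_inf \<mu> (\<lambda>f. LUC_embedding \<mu> (\<phi> n) f - LUC_embedding \<mu> \<psi> f) \<le> 2 * B"
        using norm_inf_diff_le[OF E(1)[of n] E(2)] Linf_diff[OF E(1)[of n] E(2)] by simp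
    qed
    show "2 * B \<ge> 0" using bmult_nonneg[OF \<psi>] by simp
    fix f assume f: "f \<in> L1 \<mu>"
    show "(\<lambda>n. LUC_embedding \<mu> (\<phi> n) f - LUC_embedding \<mu> \<psi> f) \<longlonglongrightarrow> 0"
      using bmult_tendsto[OF \<phi> lim \<psi> f] f by (intro LIM_zero) (simp add: LUC_embedding_def)
  qed simp
  then have "(\<lambda>n. m (LUC_embedding \<mu> (\<phi> n)) - m (LUC_embedding \<mu> \<psi>)) \<longlonglongrightarrow> 0"
    by (simp only: m_minus[OF E])
  then show ?thesis by (rule LIM_zero_cancel)
qed

text \<open>Within \<open>C\<close> the functional \<open>m\<close> is a complex measure, countably
  additive by \<open>m_bmult_tendsto\<close>, and \<open>g\<close> is its density. Agreement extends
  from indicators through simple functions to bounded Borel functions, and over \<open>C\<close>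
  these account for all of \<open>Linf \<mu>\<close> by \<open>Linf_on_set\<close>.\<close>

lemma m_on_set:
  assumes C: "C \<in> sets borel" "emeasure \<mu> C < \<infinity>"
  shows "\<exists>g\<in>L1 \<mu>. cut C g = g \<and> (\<forall>h\<in>Linf \<mu>. m (\<lambda>f. if f \<in> L1 \<mu> then h (cut C f) else 0) = h g)"
proof -
  obtain c where c: "c \<ge> 0" "\<And>u. u \<in> Linf \<mu> \<Longrightarrow> cmod (m u) \<le> c * norm_inf \<mu> u" using m_bound by blast
  interpret M: finite_measure "on_set C" by (rule on_set[OF C])
  note sM = on_set(2)[OF C] and eM = on_set(3)[OF C]
  define ind :: "'g set \<Rightarrow> 'g \<Rightarrow> complex" where "ind A = (\<lambda>x. of_real (indicator (A \<inter> C) x))" for A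
  have ib: "bmult (ind A) 1" if "A \<in> sets borel" for A
    unfolding ind_def using that C by (intro bmult_indicator) auto
  define \<nu> where "\<nu> A = m (LUC_embedding \<mu> (ind A))" for A
  have z: "LUC_embedding \<mu> (\<lambda>x. 0) = (\<lambda>f. 0)" by (auto simp: LUC_embedding_def)
  have "\<exists>f :: 'g \<Rightarrow> complex. integrable (on_set C) f \<and> (\<forall>A\<in>sets (on_set C). \<nu> A = (\<integral>x. indicator A x *\<^sub>R f x \<partial>on_set C))"
  proof (rule M.radon_nikodym_complex)
    fix A :: "nat \<Rightarrow> 'g set" assume A: "range A \<subseteq> sets (on_set C)" "disjoint_family A"
    show "(\<lambda>i. \<nu> (A i)) sums \<nu> (\<Union>i. A i)"
    proof (rule indicator_sums)
      fix A1 A2 :: "'g set" assume A12: "A1 \<in> sets borel" "A2 \<in> sets borel" "A1 \<inter> A2 = {}"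
      have "ind (A1 \<union> A2) = (\<lambda>x. ind A1 x + ind A2 x)" using A12(3) by (auto simp: ind_def indicator_def fun_eq_iff)
      then show "\<nu> (A1 \<union> A2) = \<nu> A1 + \<nu> A2"
        unfolding \<nu>_def using bmult_add[OF ib ib] m_plus[OF bmult_Linf(1)[OF ib] bmult_Linf(1)[OF ib]] A12 by simp
    next
      fix A :: "nat \<Rightarrow> 'g set" assume A: "\<And>n. A n \<in> sets borel" "decseq A" "(\<Inter>n. A n) = {}"
      have "(\<lambda>n. m (LUC_embedding \<mu> (ind (A n)))) \<longlonglongrightarrow> m (LUC_embedding \<mu> (\<lambda>x. 0))"
      proof (rule m_bmult_tendsto[OF ib[OF A(1)]])
        fix x
        obtain n where n: "x \<notin> A n" using A(3) by blast
        have "\<forall>\<^sub>F k in sequentially. ind (A k) x = 0"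
          using eventually_ge_at_top[of n]
        proof eventually_elim
          case (elim k)
          then have "A k \<subseteq> A n" using A(2) by (auto simp: decseq_def)
          then show ?case using n by (auto simp: ind_def indicator_def)
        qed
        then show "(\<lambda>n. ind (A n) x) \<longlonglongrightarrow> 0" by (rule tendsto_eventually)
      qed (simp add: bmult_def)
      then show "(\<lambda>n. \<nu> (A n)) \<longlonglongrightarrow> 0" by (simp add: \<nu>_def z m_zero)
    qed (use A sM in auto)
  next
    fix A assume A: "A \<in> sets (on_set C)" "emeasure (on_set C) A = 0"
    then have "A \<inter> C \<in> null_sets \<mu>" using C by (intro null_setsI) (auto simp: eM sM sets_eq)
    then have ae: "AE x in \<mu>. x \<notin> A \<inter> C" by (rule AE_not_in)
    have "LUC_embedding \<mu> (ind A) = (\<lambda>f. 0)"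
    proof
      fix f
      have "(\<integral>x. ind A x * f x \<partial>\<mu>) = 0"
        by (rule integral_eq_zero_AE) (use ae in \<open>eventually_elim, simp add: ind_def\<close>)
      then show "LUC_embedding \<mu> (ind A) f = 0" by (simp add: LUC_embedding_def)
    qed
    then show "\<nu> A = 0" by (simp add: \<nu>_def m_zero)
  next
    fix A assume "A \<in> sets (on_set C)"
    then have i: "bmult (ind A) 1" by (simp add: ib sM)
    show "cmod (\<nu> A) \<le> c"
      unfolding \<nu>_def using c(2)[OF bmult_Linf(1)[OF i]] mult_left_mono[OF bmult_Linf(2)[OF i] c(1)] by simp
  qed
  then obtain g0 :: "'g \<Rightarrow> complex" where g0: "integrable (on_set C) g0"
    and \<nu>g: "\<And>A. A \<in> sets borel \<Longrightarrow> \<nu> A = (\<integral>x. indicator A x *\<^sub>R g0 x \<partial>on_set C)"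
    unfolding sM by blast
  have [measurable]: "g0 \<in> borel_measurable borel"
    using borel_measurable_integrable[OF g0] by (simp add: measurable_cong_sets[OF sM refl])
  define g where "g = cut C g0"
  have g: "g \<in> L1 \<mu>" unfolding g_def by (rule on_set(5)[OF C g0])
  have gC: "cut C g = g" by (simp add: g_def cut_cut)
  have \<nu>: "\<nu> A = (\<integral>x. of_real (indicator A x) * g x \<partial>\<mu>)" if [measurable]: "A \<in> sets borel" for A
  proof -
    have "\<nu> A = (\<integral>x. cut C (\<lambda>x. indicator A x *\<^sub>R g0 x) x \<partial>\<mu>)"
      unfolding \<nu>g[OF that] by (rule on_set(4)[OF C]) measurable
    also have "\<dots> = (\<integral>x. of_real (indicator A x) * g x \<partial>\<mu>)"
      by (intro Bochner_Integration.integral_cong refl) (auto simp: cut_def g_def indicator_def)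
    finally show ?thesis .
  qed
  \<comment> \<open>A simple function is summed over its values, hence the index \<open>v\<close>.
    The crude bound by the sum of the moduli only ensures that each partial sum embeds into
    \<open>Linf \<mu>\<close>; a bound uniform along the approximation comes from \<open>s2\<close>
    below.\<close>
  have fs: "bmult (\<lambda>x. \<Sum>v\<in>S. v * ind (A v) x) (\<Sum>v\<in>S. cmod v) \<and>
     m (LUC_embedding \<mu> (\<lambda>x. \<Sum>v\<in>S. v * ind (A v) x)) = (\<integral>x. (\<Sum>v\<in>S. v * of_real (indicator (A v) x)) * g x \<partial>\<mu>)"
    if "finite S" "\<And>v. A v \<in> sets borel" for S and A :: "complex \<Rightarrow> 'g set"
    using that(1)
  proof induction
    case empty
    then show ?case by (simp add: bmult_def z m_zero)
  next
    case (insert v S)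
    let ?s = "\<lambda>x. \<Sum>v\<in>S. v * ind (A v) x"
    have i: "bmult (ind (A v)) 1" by (rule ib[OF that(2)])
    have vi: "bmult (\<lambda>x. v * ind (A v) x) (cmod v)"
      using i by (auto simp: bmult_def norm_mult intro!: mult_left_le)
    have s: "bmult ?s (\<Sum>v\<in>S. cmod v)" using insert.IH by simp
    have "bmult (\<lambda>x. v * ind (A v) x + ?s x) (cmod v + (\<Sum>v\<in>S. cmod v))"
      using vi s unfolding bmult_def by (auto intro: norm_triangle_mono)
    moreover have "m (LUC_embedding \<mu> (\<lambda>x. v * ind (A v) x + ?s x)) =
        m (LUC_embedding \<mu> (\<lambda>x. v * ind (A v) x)) + m (LUC_embedding \<mu> ?s)"
      unfolding bmult_add[OF vi s] by (rule m_plus[OF bmult_Linf(1)[OF vi] bmult_Linf(1)[OF s]])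
    moreover have "m (LUC_embedding \<mu> (\<lambda>x. v * ind (A v) x)) = v * \<nu> (A v)"
      unfolding LUC_embedding_scale \<nu>_def by (rule m_times[OF bmult_Linf(1)[OF i]])
    moreover have "v * \<nu> (A v) + (\<integral>x. (\<Sum>v\<in>S. v * of_real (indicator (A v) x)) * g x \<partial>\<mu>) =
       (\<integral>x. (v * of_real (indicator (A v) x) + (\<Sum>v\<in>S. v * of_real (indicator (A v) x))) * g x \<partial>\<mu>)"
    proof -
      have ii: "integrable \<mu> (\<lambda>x. of_real (indicator (A v) x) * g x)" for v
        by (rule bmult_integrable[OF bmult_indicator[OF that(2)] g])
      have i1: "integrable \<mu> (\<lambda>x. v * (of_real (indicator (A v) x) * g x))" for v using ii by simp
      have i2: "integrable \<mu> (\<lambda>x. (\<Sum>v\<in>S. v * of_real (indicator (A v) x)) * g x)"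
        unfolding sum_distrib_right mult.assoc by (intro Bochner_Integration.integrable_sum i1)
      have "v * \<nu> (A v) = (\<integral>x. v * (of_real (indicator (A v) x) * g x) \<partial>\<mu>)"
        unfolding \<nu>[OF that(2)] by simp
      then show ?thesis using Bochner_Integration.integral_add[OF i1[of v] i2] by (simp add: distrib_right mult.assoc)
    qed
    ultimately show ?case using insert by simp
  qed
  have main: "m (LUC_embedding \<mu> (\<lambda>x. of_real (indicator C x) * \<phi> x)) = (\<integral>x. \<phi> x * g x \<partial>\<mu>)" if \<phi>: "bmult \<phi> B" for \<phi> B
  proof -
    have "\<phi> \<in> borel_measurable borel" using \<phi> by (simp add: bmult_def)
    then obtain s where s: "\<And>i. simple_function borel (s i)" "\<And>x. (\<lambda>i. s i x) \<longlonglongrightarrow> \<phi> x"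
      and sb: "\<And>i x. dist (s i x) 0 \<le> 2 * dist (\<phi> x) 0"
      using borel_measurable_implies_sequence_metric[of \<phi> borel 0] by auto
    have B: "B \<ge> 0" by (rule bmult_nonneg[OF \<phi>])
    \<comment> \<open>The factor 2 stems from the domination \<open>sb\<close> of the simple
      approximations; \<open>\<phi>\<close> is given the same bound, so that one constant serves the
      sequence and its limit.\<close>
    have s2: "bmult (s i) (2 * B)" for i
    proof -
      have "cmod (s i x) \<le> 2 * B" for x
      proof -
        have "cmod (\<phi> x) \<le> B" using \<phi> by (simp add: bmult_def)
        then show ?thesis using sb[of i x] by simp
      qed
      then show ?thesis using borel_measurable_simple_function[OF s(1)] by (simp add: bmult_def)
    qed
    have \<phi>2: "bmult \<phi> (2 * B)" using \<phi> B by (auto simp: bmult_def intro: order_trans)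
    have cm: "bmult (\<lambda>x. of_real (indicator C x) * \<psi> x) (2 * B)" if "bmult \<psi> (2 * B)" for \<psi>
      using that C(1) B unfolding bmult_def by (auto simp: norm_mult indicator_def)
    have eq: "m (LUC_embedding \<mu> (\<lambda>x. of_real (indicator C x) * s i x)) = (\<integral>x. s i x * g x \<partial>\<mu>)" for i
    proof -
      have f: "finite (range (s i))" using s(1)[of i] by (simp add: simple_function_def)
      have A: "s i -` {v} \<in> sets borel" for v using simple_functionD(2)[OF s(1), of i "{v}"] by simp
      have r: "s i x = (\<Sum>v\<in>range (s i). v * of_real (indicator (s i -` {v}) x))" for x
      proof -
        have "(\<Sum>v\<in>range (s i). v * of_real (indicator (s i -` {v}) x)) = (\<Sum>v\<in>{s i x}. v * of_real (indicator (s i -` {v}) x))"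
          using f by (intro sum.mono_neutral_right) auto
        then show ?thesis by simp
      qed
      have rC: "of_real (indicator C x) * s i x = (\<Sum>v\<in>range (s i). v * ind (s i -` {v}) x)" for x
        by (subst r) (simp add: sum_distrib_left ind_def indicator_inter_arith mult_ac)
      have "m (LUC_embedding \<mu> (\<lambda>x. \<Sum>v\<in>range (s i). v * ind (s i -` {v}) x)) =
         (\<integral>x. (\<Sum>v\<in>range (s i). v * of_real (indicator (s i -` {v}) x)) * g x \<partial>\<mu>)"
        using fs[OF f A] by simp
      then show ?thesis unfolding rC r[symmetric] .
    qed
    have l1: "(\<lambda>i. m (LUC_embedding \<mu> (\<lambda>x. of_real (indicator C x) * s i x))) \<longlonglongrightarrow> m (LUC_embedding \<mu> (\<lambda>x. of_real (indicator C x) * \<phi> x))"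
      by (rule m_bmult_tendsto[OF cm[OF s2] _ cm[OF \<phi>2]]) (intro tendsto_mult tendsto_const s(2))
    have l2: "(\<lambda>i. \<integral>x. s i x * g x \<partial>\<mu>) \<longlonglongrightarrow> (\<integral>x. \<phi> x * g x \<partial>\<mu>)"
      by (rule bmult_tendsto[OF s2 s(2) \<phi>2 g])
    show ?thesis using LIMSEQ_unique[OF l1] l2 by (simp add: eq)
  qed
  have "m (\<lambda>f. if f \<in> L1 \<mu> then h (cut C f) else 0) = h g" if h: "h \<in> Linf \<mu>" for h
  proof -
    obtain \<phi> where \<phi>: "bmult \<phi> (norm_inf \<mu> h)" "\<And>f. f \<in> L1 \<mu> \<Longrightarrow> h (cut C f) = (\<integral>x. \<phi> x * cut C f x \<partial>\<mu>)"
      using Linf_on_set[OF h C] by blast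
    have "(\<lambda>f. if f \<in> L1 \<mu> then h (cut C f) else 0) = LUC_embedding \<mu> (\<lambda>x. of_real (indicator C x) * \<phi> x)"
    proof
      fix f
      have "(\<integral>x. \<phi> x * cut C f x \<partial>\<mu>) = (\<integral>x. of_real (indicator C x) * \<phi> x * f x \<partial>\<mu>)"
        by (simp add: cut_def mult_ac)
      then show "(if f \<in> L1 \<mu> then h (cut C f) else 0) = LUC_embedding \<mu> (\<lambda>x. of_real (indicator C x) * \<phi> x) f"
        by (simp add: LUC_embedding_def \<phi>(2))
    qed
    then have "m (\<lambda>f. if f \<in> L1 \<mu> then h (cut C f) else 0) = (\<integral>x. \<phi> x * g x \<partial>\<mu>)"
      using main[OF \<phi>(1)] by simp
    also have "\<dots> = h g" using \<phi>(2)[OF g] by (simp add: gC)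
    finally show ?thesis .
  qed
  then show ?thesis using g gC by blast
qed

text \<open>The densities are restrictions of one another almost everywhere, so their L1 distances
  are differences of norms. The norms increase with \<open>C\<close> and are bounded; a sequence
  whose norms approach the supremum is therefore Cauchy, and its limit serves the whole net although
  \<open>cfam\<close> may be uncountable.\<close>

lemma m_represented: "\<exists>f\<in>L1 \<mu>. \<forall>h\<in>Linf \<mu>. m h = h f"
proof -
  obtain c where c: "c \<ge> 0" "\<And>u. u \<in> Linf \<mu> \<Longrightarrow> cmod (m u) \<le> c * norm_inf \<mu> u" using m_bound by blast
  define cutf where "cutf C h = (\<lambda>f. if f \<in> L1 \<mu> then h (cut C f) else (0::complex))" for C and h :: "('g \<Rightarrow> complex) \<Rightarrow> complex"
  have Cb: "C \<in> sets borel" "emeasure \<mu> C < \<infinity>" if "C \<in> cfam" for C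
    using cfam_compact[OF that] compact_finite by (auto simp: compact_imp_closed)
  have cL: "cutf C h \<in> Linf \<mu>" "norm_inf \<mu> (cutf C h) \<le> norm_inf \<mu> h" if "C \<in> cfam" "h \<in> Linf \<mu>" for C h
    unfolding cutf_def using cut_functional_Linf[OF that(2) Cb(1)[OF that(1)]] by auto
  have "\<exists>g. \<forall>C\<in>cfam. g C \<in> L1 \<mu> \<and> cut C (g C) = g C \<and> (\<forall>h\<in>Linf \<mu>. m (cutf C h) = h (g C))"
    by (rule bchoice) (use m_on_set[OF Cb] in \<open>unfold cutf_def, blast\<close>)
  then obtain g where g': "\<forall>C\<in>cfam. g C \<in> L1 \<mu> \<and> cut C (g C) = g C \<and> (\<forall>h\<in>Linf \<mu>. m (cutf C h) = h (g C))"
    by (elim exE)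
  have g: "g C \<in> L1 \<mu>" and gC: "cut C (g C) = g C" and mg: "\<And>h. h \<in> Linf \<mu> \<Longrightarrow> m (cutf C h) = h (g C)"
    if "C \<in> cfam" for C using g' that by simp_all
  have cons: "AE x in \<mu>. g C x = cut C (g D) x" if CD: "C \<in> cfam" "D \<in> cfam" "C \<subseteq> D" for C D
  proof -
    have cg: "cut C (g D) \<in> L1 \<mu>" by (intro cut_L1 Cb g CD)
    have d: "(\<lambda>x. g C x - cut C (g D) x) \<in> L1 \<mu>" by (intro L1_diff g cg CD)
    \<comment> \<open>A functional attaining the norm of the difference tests for equality. Cutting
      to \<open>C\<close> and then to \<open>D\<close> is cutting to \<open>C\<close>, so
      \<open>m\<close> assigns this functional the same value through either density.\<close>
    obtain \<phi> where \<phi>: "bmult \<phi> 1" "LUC_embedding \<mu> \<phi> (\<lambda>x. g C x - cut C (g D) x) = of_real (norm1 \<mu> (\<lambda>x. g C x - cut C (g D) x))"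
      by (rule norm1_attained[OF d])
    define h where "h = LUC_embedding \<mu> \<phi>"
    have h: "h \<in> Linf \<mu>" unfolding h_def by (rule bmult_Linf[OF \<phi>(1)])
    have "cutf D (cutf C h) = cutf C h"
    proof
      fix f
      show "cutf D (cutf C h) f = cutf C h f"
        using CD Cb by (auto simp: cutf_def cut_L1 cut_cut Int_absorb2)
    qed
    then have "h (g C) = cutf C h (g D)"
      using mg[OF CD(1) h] mg[OF CD(2) cL(1)[OF CD(1) h]] by simp
    then have "h (\<lambda>x. g C x - cut C (g D) x) = 0"
      using g[OF CD(2)] by (simp add: Linf_minus[OF h g[OF CD(1)] cg] cutf_def)
    then have "norm1 \<mu> (\<lambda>x. g C x - cut C (g D) x) = 0" using \<phi>(2) by (simp add: h_def)
    from norm1_zero_AE[OF d this] show ?thesis by simp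
  qed
  define N where "N C = norm1 \<mu> (g C)" for C
  have Nle: "N C \<le> c" if C: "C \<in> cfam" for C
  proof -
    obtain \<phi> where \<phi>: "bmult \<phi> 1" "LUC_embedding \<mu> \<phi> (g C) = of_real (N C)"
      unfolding N_def by (rule norm1_attained[OF g[OF C]])
    define h where "h = LUC_embedding \<mu> \<phi>"
    have h: "h \<in> Linf \<mu>" "norm_inf \<mu> h \<le> 1" unfolding h_def using bmult_Linf[OF \<phi>(1)] by auto
    have "N C = cmod (h (g C))" using \<phi>(2) by (simp add: h_def N_def)
    also have "\<dots> = cmod (m (cutf C h))" by (simp add: mg[OF C h(1)])
    also have "\<dots> \<le> c * norm_inf \<mu> (cutf C h)" by (rule c(2)[OF cL(1)[OF C h(1)]])
    also have "\<dots> \<le> c * 1" using cL(2)[OF C h(1)] h(2) c(1) by (intro mult_left_mono) auto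
    finally show ?thesis by simp
  qed
  have diff: "norm1 \<mu> (\<lambda>x. g D x - g C x) = N D - N C" if CD: "C \<in> cfam" "D \<in> cfam" "C \<subseteq> D" for C D
  proof -
    have cg: "cut C (g D) \<in> L1 \<mu>" by (intro cut_L1 Cb g CD)
    have "norm1 \<mu> (\<lambda>x. g D x - g C x) = norm1 \<mu> (\<lambda>x. g D x - cut C (g D) x)"
      using cons[OF CD] by (intro norm1_cong_AE L1_diff g cg CD) auto
    also have "\<dots> = (\<integral>x. cmod (g D x) - cmod (cut C (g D) x) \<partial>\<mu>)"
      unfolding norm1_def by (intro Bochner_Integration.integral_cong refl) (auto simp: cut_def indicator_def)
    also have "\<dots> = N D - norm1 \<mu> (cut C (g D))"
      using g[OF CD(2)] cg by (simp add: N_def norm1_def L1_def)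
    also have "norm1 \<mu> (cut C (g D)) = N C"
      unfolding N_def using cons[OF CD] by (intro norm1_cong_AE g cg CD) auto
    finally show ?thesis .
  qed
  define S where "S = (SUP C\<in>cfam. N C)"
  have bdd: "bdd_above (N ` cfam)" using Nle by (auto simp: bdd_above_def)
  have NS: "N C \<le> S" if "C \<in> cfam" for C unfolding S_def using that by (intro cSUP_upper bdd)
  have "\<exists>C\<in>cfam. S - 1 / real (Suc n) < N C" for n
  proof -
    have "S - 1 / real (Suc n) < S" by simp
    then show ?thesis
      using less_cSUP_iff[of cfam N "S - 1 / real (Suc n)"] cfam_empty bdd by (auto simp: S_def[symmetric])
  qed
  then obtain C where C: "\<And>n. C n \<in> cfam" "\<And>n. S - 1 / real (Suc n) < N (C n)" by metis
  \<comment> \<open>Unions make the chosen sets increasing. Norms grow with the set, so those over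
    \<open>D n\<close> are still within \<open>1 / (n + 1)\<close> of the supremum; by
    \<open>diff\<close> every density over a larger set in \<open>cfam\<close> is that close to
    \<open>g (D n)\<close>.\<close>
  define D where "D n = (\<Union>k\<le>n. C k)" for n
  have D: "D n \<in> cfam" for n
  proof (induction n)
    case (Suc n)
    have "D (Suc n) = D n \<union> C (Suc n)" by (auto simp: D_def atMost_Suc)
    then show ?case using Suc C by (simp add: cfam_Un)
  qed (simp add: D_def C)
  have Dmono: "D i \<subseteq> D j" if "i \<le> j" for i j using that unfolding D_def by (intro UN_mono) auto
  have ND: "S - 1 / real (Suc n) < N (D n)" for n
  proof -
    have "C n \<subseteq> D n" by (auto simp: D_def)
    then have "N (C n) \<le> N (D n)" using diff[OF C(1) D, of n n] norm1_nonneg[of \<mu> "\<lambda>x. g (D n) x - g (C n) x"] by simp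
    then show ?thesis using C(2)[of n] by simp
  qed
  \<comment> \<open>\<open>lim\<close> is unspecified at points without convergence; these lie in a
    null set.\<close>
  define f where "f x = lim (\<lambda>n. g (D n) x)" for x
  have [measurable]: "g (D n) \<in> borel_measurable borel" for n by (rule L1_borel[OF g[OF D]])
  have fb[measurable]: "f \<in> borel_measurable borel" unfolding f_def by (rule borel_measurable_lim_metric) measurable
  have "AE x in \<mu>. \<forall>i j. i \<le> j \<longrightarrow> g (D i) x = cut (D i) (g (D j)) x"
    unfolding AE_all_countable
  proof (intro allI)
    fix i j
    show "AE x in \<mu>. i \<le> j \<longrightarrow> g (D i) x = cut (D i) (g (D j)) x"
      using cons[OF D D Dmono, of i j] by (cases "i \<le> j") auto
  qed
  then have flim: "AE x in \<mu>. (\<lambda>n. g (D n) x) \<longlonglongrightarrow> f x"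
  proof eventually_elim
    case (elim x)
    have "convergent (\<lambda>n. g (D n) x)"
    proof (cases "\<exists>i. x \<in> D i")
      case True
      then obtain i where i: "x \<in> D i" by blast
      have "\<forall>\<^sub>F n in sequentially. g (D n) x = g (D i) x"
        using eventually_ge_at_top[of i]
      proof eventually_elim
        case (elim n)
        then show ?case using \<open>\<forall>i j. i \<le> j \<longrightarrow> g (D i) x = cut (D i) (g (D j)) x\<close> i by (simp add: cut_def)
      qed
      then show ?thesis by (intro convergentI tendsto_eventually)
    next
      case False
      have "g (D n) x = 0" for n
      proof -
        have "g (D n) x = cut (D n) (g (D n)) x" using gC[OF D] by simp
        then show ?thesis using False by (simp add: cut_def)
      qed
      then show ?thesis by (simp add: convergent_const)
    qed
    then show ?case unfolding f_def by (simp add: convergent_LIMSEQ_iff)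
  qed
  \<comment> \<open>Fatou's lemma converts the Cauchy estimate for the sequence into one for its
    limit, before \<open>f\<close> is known to be integrable.\<close>
  have fd: "(\<integral>\<^sup>+x. ennreal (cmod (f x - g (D n) x)) \<partial>\<mu>) \<le> ennreal (1 / real (Suc n))" for n
  proof -
    have "(\<integral>\<^sup>+x. ennreal (cmod (f x - g (D n) x)) \<partial>\<mu>) = (\<integral>\<^sup>+x. liminf (\<lambda>j. ennreal (cmod (g (D j) x - g (D n) x))) \<partial>\<mu>)"
    proof (rule nn_integral_cong_AE)
      show "AE x in \<mu>. ennreal (cmod (f x - g (D n) x)) = liminf (\<lambda>j. ennreal (cmod (g (D j) x - g (D n) x)))"
        using flim
      proof eventually_elim
        case (elim x)
        have "(\<lambda>j. ennreal (cmod (g (D j) x - g (D n) x))) \<longlonglongrightarrow> ennreal (cmod (f x - g (D n) x))"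
          by (intro tendsto_ennrealI tendsto_norm tendsto_diff elim tendsto_const)
        then show ?case by (intro lim_imp_Liminf[symmetric]) auto
      qed
    qed
    also have "\<dots> \<le> liminf (\<lambda>j. \<integral>\<^sup>+x. ennreal (cmod (g (D j) x - g (D n) x)) \<partial>\<mu>)"
      by (rule nn_integral_liminf) measurable
    also have "\<dots> \<le> ennreal (1 / real (Suc n))"
    proof (rule Liminf_le)
      show "\<forall>\<^sub>F j in sequentially. (\<integral>\<^sup>+x. ennreal (cmod (g (D j) x - g (D n) x)) \<partial>\<mu>) \<le> ennreal (1 / real (Suc n))"
        using eventually_ge_at_top[of n]
      proof eventually_elim
        case (elim j)
        have "(\<integral>\<^sup>+x. ennreal (cmod (g (D j) x - g (D n) x)) \<partial>\<mu>) = ennreal (N (D j) - N (D n))"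
          using nn_integral_norm1[OF L1_diff[OF g[OF D] g[OF D]], of j n] diff[OF D D Dmono[OF elim]] by simp
        also have "\<dots> \<le> ennreal (1 / real (Suc n))"
          using NS[OF D, of j] ND[of n] by (intro ennreal_leI) linarith
        finally show ?case .
      qed
    qed simp
    finally show ?thesis .
  qed
  have fdL: "(\<lambda>x. f x - g (D n) x) \<in> L1 \<mu>" for n
    unfolding L1_iff using le_less_trans[OF fd ennreal_less_top, of n] by simp
  have fL: "f \<in> L1 \<mu>" using L1_add[OF fdL[of 0] g[OF D, of 0]] by simp
  have fn: "norm1 \<mu> (\<lambda>x. f x - g (D n) x) \<le> 1 / real (Suc n)" for n
    by (rule norm1_le_nn_integral[OF fdL fd]) simp
  have "m h = h f" if h: "h \<in> Linf \<mu>" for h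
  proof -
    \<comment> \<open>Here an index set of the cardinality of \<open>min_cover\<close> is used in
      full: the complements of all \<open>C \<in> cfam\<close> enter, and \<open>h\<close> cut to
      them is weak* null by \<open>cut_tendsto\<close>.\<close>
    have "((\<lambda>C. m (\<lambda>u. h u - cutf C h u)) \<longlongrightarrow> 0) cfilter"
    proof (rule weak_star_null[where K = cfam and B = "2 * norm_inf \<mu> h"])
      show "(card_of cfam, card_of min_cover) \<in> ordLeq" by (rule cfam_card[OF noncompact])
      show "\<forall>C\<in>cfam. (\<lambda>u. h u - cutf C h u) \<in> Linf \<mu> \<and> norm_inf \<mu> (\<lambda>u. h u - cutf C h u) \<le> 2 * norm_inf \<mu> h"
      proof
        fix C assume C: "C \<in> cfam"
        show "(\<lambda>u. h u - cutf C h u) \<in> Linf \<mu> \<and> norm_inf \<mu> (\<lambda>u. h u - cutf C h u) \<le> 2 * norm_inf \<mu> h"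
          using Linf_diff[OF h cL(1)[OF C h]] norm_inf_diff_le[OF h cL(1)[OF C h]] cL(2)[OF C h] by simp
      qed
      show "2 * norm_inf \<mu> h \<ge> 0" using norm_inf_nonneg[OF h] by simp
      show "\<forall>\<^sub>F C in cfilter. C \<in> cfam" unfolding eventually_cfilter using cfam_empty by blast
      fix u assume u: "u \<in> L1 \<mu>"
      show "((\<lambda>C. h u - cutf C h u) \<longlongrightarrow> 0) cfilter"
      proof (rule Lim_null_comparison)
        show "((\<lambda>C. norm_inf \<mu> h * norm1 \<mu> (\<lambda>x. u x - cut C u x)) \<longlongrightarrow> 0) cfilter"
          by (rule tendsto_mult_right_zero[OF cut_tendsto[OF u]])
        have "\<forall>\<^sub>F C in cfilter. C \<in> cfam" unfolding eventually_cfilter using cfam_empty by blast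
        then show "\<forall>\<^sub>F C in cfilter. cmod (h u - cutf C h u) \<le> norm_inf \<mu> h * norm1 \<mu> (\<lambda>x. u x - cut C u x)"
        proof eventually_elim
          case (elim C)
          have "cut C u \<in> L1 \<mu>" by (intro cut_L1 Cb elim u)
          then show ?case
            using Linf_bound[OF h L1_diff[OF u]] Linf_minus[OF h u] u by (simp add: cutf_def)
        qed
      qed
    qed
    moreover have "\<forall>\<^sub>F C in cfilter. m (\<lambda>u. h u - cutf C h u) = m h - h (g C)"
      unfolding eventually_cfilter using cfam_empty m_minus[OF h cL(1)[OF _ h]] mg[OF _ h] by auto
    ultimately have t1: "((\<lambda>C. m h - h (g C)) \<longlongrightarrow> 0) cfilter" by (rule Lim_transform_eventually)
    have t2: "((\<lambda>C. h f - h (g C)) \<longlongrightarrow> 0) cfilter"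
    proof (rule tendstoI)
      fix e :: real assume e: "e > 0"
      \<comment> \<open>The added 1 avoids division by 0, and \<open>2 * q\<close> leaves room for
        two errors of size \<open>1 / (n + 1)\<close>: from \<open>f\<close> to
        \<open>g (D n)\<close> and on to \<open>g C\<close>.\<close>
      define q where "q = norm_inf \<mu> h + 1"
      have q: "q > 0" "norm_inf \<mu> h \<le> q" using norm_inf_nonneg[OF h] by (auto simp: q_def)
      obtain n where n: "1 / real (Suc n) < e / (2 * q)"
        using reals_Archimedean[of "e / (2 * q)"] e q by (auto simp: inverse_eq_divide)
      show "\<forall>\<^sub>F C in cfilter. dist (h f - h (g C)) 0 < e"
        unfolding eventually_cfilter
      proof (intro bexI[of _ "D n"] D ballI impI)
        fix C assume C: "C \<in> cfam" "D n \<subseteq> C"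
        have "norm1 \<mu> (\<lambda>x. f x - g C x) \<le> norm1 \<mu> (\<lambda>x. f x - g (D n) x) + norm1 \<mu> (\<lambda>x. g (D n) x - g C x)"
          by (intro norm1_triangle_diff fL g D C)
        also have "\<dots> \<le> 1 / real (Suc n) + 1 / real (Suc n)"
          using fn[of n] diff[OF D C] NS[OF C(1)] ND[of n] norm1_minus_commute[of \<mu> "g C" "g (D n)"] by linarith
        finally have b: "norm1 \<mu> (\<lambda>x. f x - g C x) < e / q" using n by simp
        have "cmod (h f - h (g C)) \<le> norm_inf \<mu> h * norm1 \<mu> (\<lambda>x. f x - g C x)"
          using Linf_bound[OF h L1_diff[OF fL g[OF C(1)]]] Linf_minus[OF h fL g[OF C(1)]] by simp
        also have "\<dots> \<le> q * norm1 \<mu> (\<lambda>x. f x - g C x)" by (intro mult_right_mono q) simp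
        also have "\<dots> < e" using b q(1) by (simp add: field_simps)
        finally show "dist (h f - h (g C)) 0 < e" by simp
      qed
    qed
    have "((\<lambda>C. (m h - h (g C)) - (h f - h (g C))) \<longlongrightarrow> 0 - 0) cfilter" by (intro tendsto_diff t1 t2)
    then have "((\<lambda>C. m h - h f) \<longlongrightarrow> 0) cfilter" by simp
    then show ?thesis using cfilter_not_bot by (simp add: tendsto_const_iff)
  qed
  then show ?thesis using fL by blast
qed

end

text \<open>Local compactness puts a neighbourhood of each point inside a compact set and so turns
  finiteness on compact sets into local finiteness.\<close>

lemma haar_left_haar_measure:
  fixes \<mu> :: "'g::{topological_group_add, t2_space} measure"
  assumes lc: "locally_compact_space (euclidean :: 'g topology)" and \<mu>: "left_haar_measure \<mu>"
  shows "haar \<mu>"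
proof -
  have nb: "\<exists>V K. open V \<and> compact K \<and> x \<in> V \<and> V \<subseteq> K" for x :: 'g
  proof -
    have "\<exists>V K. openin (euclidean :: 'g topology) V \<and> compactin euclidean K \<and> x \<in> V \<and> V \<subseteq> K"
      using lc by (simp add: locally_compact_space_def)
    then show ?thesis by (simp add: compactin_euclidean_iff)
  qed
  note P = \<mu>[unfolded left_haar_measure_def]
  note s = P[THEN conjunct1] and cf = P[THEN conjunct2, THEN conjunct1, rule_format]
    and P3 = P[THEN conjunct2, THEN conjunct2]
  show ?thesis
  proof
    show "\<exists>U. open U \<and> x \<in> U \<and> emeasure \<mu> U < \<infinity>" for x
    proof -
      obtain V K where V: "open V" "compact K" "x \<in> V" "V \<subseteq> K" using nb by blast
      have "emeasure \<mu> V \<le> emeasure \<mu> K" using V by (intro emeasure_mono) (auto simp: s compact_imp_closed)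
      then show ?thesis using V cf[OF V(2)] by (intro exI[of _ V]) auto
    qed
    show "\<exists>V K. open V \<and> compact K \<and> (0::'g) \<in> V \<and> V \<subseteq> K" by (rule nb)
  qed (fact s cf P3[THEN conjunct1, rule_format] P3[THEN conjunct2, THEN conjunct1, rule_format]
      P3[THEN conjunct2, THEN conjunct2, THEN conjunct1]
      P3[THEN conjunct2, THEN conjunct2, THEN conjunct2, rule_format])+
qed

theorem mainTheorem1:
  fixes \<mu> :: "'g::{topological_group_add, t2_space} measure"
    and m :: "(('g \<Rightarrow> complex) \<Rightarrow> complex) \<Rightarrow> complex"
  assumes "locally_compact_space (euclidean :: 'g topology)"
    and "\<not> compact (UNIV :: 'g set)"
    and "left_haar_measure \<mu>"
    and "m \<in> Linf_dual \<mu>"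
    and "\<And>\<psi> n. \<psi> \<in> weak_star LUC sup_norm closure_of range point_evaluation \<Longrightarrow>
           hahn_banach_extension \<mu> \<psi> n \<Longrightarrow> arens1 \<mu> m n = arens2 \<mu> m n"
  shows "m \<in> canonical_embedding \<mu> ` L1 \<mu>"
proof -
  interpret haar \<mu> by (rule haar_left_haar_measure[OF assms(1,3)])
  interpret central \<mu> m
    by (intro central.intro haar_axioms central_axioms.intro assms)
  obtain f where f: "f \<in> L1 \<mu>" "\<forall>h\<in>Linf \<mu>. m h = h f" using m_represented by blast
  \<comment> \<open>Equality holds as total functions: outside \<open>Linf \<mu>\<close> both sides
    are 0 by the convention for duals.\<close>
  have "m = canonical_embedding \<mu> f"
  proof
    fix h
    show "m h = canonical_embedding \<mu> f h"
      using f(2) cdual_outside[OF assms(4)[unfolded Linf_dual_def], of h] by (simp add: canonical_embedding_def)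
  qed
  then show ?thesis using f(1) by blast
qed

end
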